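(* Let $p\ge 0$ be an integer, let $q_0,q_+\in H^p(\mathbb{S}^1)$ with $q_+$ strictly positive almost everywhere, and let $\mathcal{C}_1\subset H^p(\mathbb{S}^1)$ be the set of potentials $q$ for which the operator $L_p(q): H^{p+2}(\mathbb{S}^1)\to H^p(\mathbb{S}^1)$, $L_p(q)v=-v''+qv$, has nontrivial kernel. Let $\Psi^p_{\mathbb{S}^1}: G_0\times\mathbb{H}\to H^p(\mathbb{S}^1)$ be a smooth diffeomorphism such that $\mu\circ\Psi^p_{\mathbb{S}^1}$ is the projection on the first coordinate, where $\mu$ is the monodromy map. Then the straight line $\{q_0-sq_+,\ s\in\mathbb{R}\}$ meets the hyperplane in $\mathcal{C}_1$ and each sheet of a cone in $\mathcal{C}_1$ exactly once. More precisely, for all integers $n\ge 0$, $$q_0-s_n(q_0)q_+\in\begin{cases}\Psi^p_{\mathbb{S}^1}\bigl((T_2^0\cap G_0)\times\mathbb{H}\bigr),& n=0,\\ \Psi^p_{\mathbb{S}^1}\bigl((T_2\cap A_{2\lceil n/2\rceil})\times\mathbb{H}\bigr),& n>0.\end{cases}$$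
   Context: $\mathbb{H}$ is the real separable infinite dimensional Hilbert space. $H^p([0,2\pi])$ is the Sobolev space of real functions on $[0,2\pi]$ whose $p$-th derivative is in $H^0([0,2\pi])=L^2([0,2\pi])$; $H^p(\mathbb{S}^1)\subset H^p([0,2\pi])$ is the closed subspace of functions $u$ with $u^{(j)}(0)=u^{(j)}(2\pi)$ for $0\le j\le p-1$. The numbers $s_n$: the spectrum of $L_p(q)$ consists of real eigenvalues, listed with multiplicity (at most 2) as $\lambda_0<\lambda_1\le\lambda_2<\lambda_3\le\lambda_4<\cdots$. For fixed $q_+$ and for $n\ge0$, $s_n(q_0)$ denotes the real number such that $0$ is the $n$-th eigenvalue $\lambda_n$ of $L_p(q_0-s_n(q_0)q_+)$; by standard oscillation theory $s_0(q_0)<s_1(q_0)\le s_2(q_0)<s_3(q_0)\le s_4(q_0)<\cdots$. Let $\Pi: G = \widetilde{SL(2,\mathbb{R})} \to SL(2,\mathbb{R})$ be the universal cover, a Lie group with identity $I$. For $g\in G$ write $\operatorname{tr} g=\operatorname{tr}\Pi(g)$; $T_c=\{g\in G\;|\;\operatorname{tr}g=c\}$; $T_2^0$ is the connected component of $T_2$ containing $I$. Monodromy: for $q \in H^0([0,2\pi])$ let $\Phi$ be the solution of $\Phi(0) = I$, $\Phi'(t) = \begin{pmatrix} 0 & 1 \\ q(t) & 0 \end{pmatrix}\Phi(t)$, and let $\tilde\Phi: [0,2\pi] \to G$ be its continuous lift with $\tilde\Phi(0) = I$, $\Pi\circ\tilde\Phi = \Phi$. Then $\mu(q) = \tilde\Phi(2\pi)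 \in G$. Coordinates on $G$: let $\phi_L: \mathbb{R} \times (0,\infty) \times \mathbb{R} \to G$ be the diffeomorphism determined by continuity, $\phi_L(0,1,0) = I$ and $$(\Pi \circ \phi_L)(\theta,\rho,\nu) = \begin{pmatrix} \cos\theta & \sin\theta \\ -\sin\theta & \cos\theta \end{pmatrix} \begin{pmatrix} \sqrt{\rho} & 0 \\ 0 & 1/\sqrt{\rho} \end{pmatrix} \begin{pmatrix} 1 & 0 \\ \nu/2 & 1 \end{pmatrix};$$ $G_0 = \phi_L((0,+\infty)\times(0,+\infty)\times\mathbb{R})$. Let $\phi_C:\mathbb{R}^3\to G$ be the diffeomorphism (Cartan decomposition) determined by continuity, $\phi_C(0,0,0)=I$ and $$(\Pi\circ\phi_C)(\alpha,r\cos\eta,r\sin\eta)=\begin{pmatrix}\cos\alpha&\sin\alpha\\-\sin\alpha&\cos\alpha\end{pmatrix}\begin{pmatrix}\cosh r+\sinh r\cos\eta&\sinh r\sin\eta\\ \sinh r\sin\eta&\cosh r-\sinh r\cos\eta\end{pmatrix};$$ $A_n=\phi_C((n\pi-\pi/2,n\pi+\pi/2)\times\mathbb{R}^2)$ for $n \in \mathbb{Z}$. Put $\iota=\phi_C(\pi,0,0)$. Smooth diffeomorphisms $\Psi^p_{\mathbb{S}^1}$ with the stated property exist. The set $\mathcal{C}_1$ is the disjoint union of the "hyperplane" $\Psi^p_{\mathbb{S}^1}((T_2^0\cap G_0)\times\mathbb{H})$ and the "cones" $\Psi^p_{\mathbb{S}^1}((T_2\cap A_{2k})\times\mathbb{H})$,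 $k=1,2,\ldots$ (for $k\ge1$, $T_2\cap A_{2k}\subset G_0$). The set $(T_2\cap A_{2k})\setminus\{\iota^{2k}\}$ has two connected components (leaves); the two sheets of the corresponding cone are the sets $\Psi^p_{\mathbb{S}^1}((\ell\cup\{\iota^{2k}\})\times\mathbb{H})$, $\ell$ one of the two leaves, so that the two sheets meet exactly at the vertex set $\Psi^p_{\mathbb{S}^1}(\{\iota^{2k}\}\times\mathbb{H})$. *)

theory Defs
  imports "HOL-Analysis.Analysis" "HOL-Algebra.Group"
begin

section \<open>The Hilbert space \<open>L\<^sup>2([0,2\<pi>])\<close>\<close>

abbreviation Leb :: "real measure" where
  "Leb \<equiv> lebesgue_on {0..2*pi}"

definition square_integrable :: "(real \<Rightarrow> real) \<Rightarrow> bool" where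
  "square_integrable f \<longleftrightarrow> f \<in> borel_measurable Leb \<and> integrable Leb (\<lambda>x. (f x)\<^sup>2)"

definition L2_rel :: "(real \<Rightarrow> real) \<Rightarrow> (real \<Rightarrow> real) \<Rightarrow> bool" where
  "L2_rel f g \<longleftrightarrow> square_integrable f \<and> square_integrable g \<and> (AE x in Leb. f x = g x)"

lemma square_integrable_zero: "square_integrable (\<lambda>_. 0)"
  by (simp add: square_integrable_def)

lemma square_integrable_mult:
  assumes "square_integrable f" "square_integrable g"
  shows "integrable Leb (\<lambda>x. f x * g x)"
proof (rule Bochner_Integration.integrable_bound)
  show "integrable Leb (\<lambda>x. (f x)\<^sup>2 + (g x)\<^sup>2)"
    using assms by (auto simp: square_integrable_def)
  show "(\<lambda>x. f x * g x) \<in> borel_measurable Leb"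
    using assms by (auto simp: square_integrable_def intro: borel_measurable_times)
  have "\<bar>a * b\<bar> \<le> a\<^sup>2 + b\<^sup>2" for a b :: real
  proof -
    have "2 * \<bar>a * b\<bar> \<le> a\<^sup>2 + b\<^sup>2"
      using sum_squares_bound[of "\<bar>a\<bar>" "\<bar>b\<bar>"] by (simp add: abs_mult)
    then show ?thesis
      using abs_ge_zero[of "a * b"] by linarith
  qed
  then show "AE x in Leb. norm (f x * g x) \<le> norm ((f x)\<^sup>2 + (g x)\<^sup>2)"
    by auto
qed

lemma square_integrable_add:
  assumes "square_integrable f" "square_integrable g"
  shows "square_integrable (\<lambda>x. f x + g x)"
proof -
  have "integrable Leb (\<lambda>x. (f x)\<^sup>2 + (g x)\<^sup>2 + 2 * (f x * g x))"
    using assms square_integrable_mult[OF assms] by (auto simp: square_integrable_def)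
  then have "integrable Leb (\<lambda>x. (f x + g x)\<^sup>2)"
    by (simp add: power2_sum mult.assoc)
  then show ?thesis
    using assms by (auto simp: square_integrable_def)
qed

lemma square_integrable_scale:
  "square_integrable f \<Longrightarrow> square_integrable (\<lambda>x. c * f x)"
  by (auto simp: square_integrable_def power_mult_distrib)

quotient_type L2 = "real \<Rightarrow> real" / partial: L2_rel
proof (rule part_equivpI)
  show "\<exists>f. L2_rel f f"
    using square_integrable_zero by (auto simp: L2_rel_def)
  show "symp L2_rel"
    by (rule sympI) (simp add: L2_rel_def eq_commute)
  show "transp L2_rel"
  proof (rule transpI)
    fix f g h
    assume fg: "L2_rel f g" and gh: "L2_rel g h"
    have "AE x in Leb. f x = g x" "AE x in Leb. g x = h x"
      using fg gh by (simp_all add: L2_rel_def)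
    then have "AE x in Leb. f x = h x"
      by eventually_elim simp
    then show "L2_rel f h"
      using fg gh by (simp add: L2_rel_def)
  qed
qed

lemma integral_L2_cong:
  assumes "L2_rel f f'" "L2_rel g g'"
  shows "integral\<^sup>L Leb (\<lambda>x. f x * g x) = integral\<^sup>L Leb (\<lambda>x. f' x * g' x)"
proof (rule integral_cong_AE)
  show "(\<lambda>x. f x * g x) \<in> borel_measurable Leb" "(\<lambda>x. f' x * g' x) \<in> borel_measurable Leb"
    using assms by (auto simp: L2_rel_def square_integrable_def intro: borel_measurable_times)
  have "AE x in Leb. f x = f' x" "AE x in Leb. g x = g' x"
    using assms by (simp_all add: L2_rel_def)
  then show "AE x in Leb. f x * g x = f' x * g' x"
    by eventually_elim simp
qed

lemma L2_rel_add:
  assumes "L2_rel f f'" "L2_rel g g'"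
  shows "L2_rel (\<lambda>x. f x + g x) (\<lambda>x. f' x + g' x)"
proof -
  have "AE x in Leb. f x = f' x" "AE x in Leb. g x = g' x"
    using assms by (simp_all add: L2_rel_def)
  then have "AE x in Leb. f x + g x = f' x + g' x"
    by eventually_elim simp
  then show ?thesis
    using assms by (simp add: L2_rel_def square_integrable_add)
qed

lemma L2_rel_scale:
  assumes "L2_rel f f'"
  shows "L2_rel (\<lambda>x. c * f x) (\<lambda>x. c * f' x)"
proof -
  have "AE x in Leb. f x = f' x"
    using assms by (simp add: L2_rel_def)
  then have "AE x in Leb. c * f x = c * f' x"
    by eventually_elim simp
  then show ?thesis
    using assms by (simp add: L2_rel_def square_integrable_scale)
qed

instantiation L2 :: real_inner
begin

lift_definition zero_L2 :: L2 is "\<lambda>_. 0"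
  using square_integrable_zero by (simp add: L2_rel_def)

lift_definition plus_L2 :: "L2 \<Rightarrow> L2 \<Rightarrow> L2" is "\<lambda>f g x. f x + g x"
  by (rule L2_rel_add)

lift_definition scaleR_L2 :: "real \<Rightarrow> L2 \<Rightarrow> L2" is "\<lambda>c f x. c * f x"
  by (rule L2_rel_scale)

lift_definition uminus_L2 :: "L2 \<Rightarrow> L2" is "\<lambda>f x. - f x"
  using L2_rel_scale[where c = "-1"] by simp

lift_definition inner_L2 :: "L2 \<Rightarrow> L2 \<Rightarrow> real" is "\<lambda>f g. integral\<^sup>L Leb (\<lambda>x. f x * g x)"
  by (rule integral_L2_cong)

definition minus_L2 :: "L2 \<Rightarrow> L2 \<Rightarrow> L2" where
  "minus_L2 u v = u + - v"

definition norm_L2 :: "L2 \<Rightarrow> real" where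
  "norm_L2 u = sqrt (inner u u)"

definition sgn_L2 :: "L2 \<Rightarrow> L2" where
  "sgn_L2 u = scaleR (inverse (norm u)) u"

definition dist_L2 :: "L2 \<Rightarrow> L2 \<Rightarrow> real" where
  "dist_L2 u v = norm (u - v)"

definition uniformity_L2 :: "(L2 \<times> L2) filter" where
  "uniformity_L2 = (INF e\<in>{0<..}. principal {(u, v). dist u v < e})"

definition open_L2 :: "L2 set \<Rightarrow> bool" where
  "open_L2 U \<longleftrightarrow> (\<forall>u\<in>U. \<forall>\<^sub>F (u', v) in uniformity. u' = u \<longrightarrow> v \<in> U)"

instance
proof
  fix u v w :: L2 and a b :: real
  show "u + v + w = u + (v + w)"
    by transfer (auto simp: L2_rel_def add.assoc intro!: square_integrable_add)
  show "u + v = v + u"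
    by transfer (auto simp: L2_rel_def add.commute intro!: square_integrable_add)
  show "0 + u = u"
    by transfer (auto simp: L2_rel_def)
  show "- u + u = 0"
    by transfer (auto simp: L2_rel_def square_integrable_zero)
  show "u - v = u + - v"
    by (rule minus_L2_def)
  show "a *\<^sub>R (u + v) = a *\<^sub>R u + a *\<^sub>R v"
    by transfer (auto simp: L2_rel_def distrib_left
        intro!: square_integrable_add square_integrable_scale)
  show "(a + b) *\<^sub>R u = a *\<^sub>R u + b *\<^sub>R u"
    by transfer (auto simp: L2_rel_def distrib_right
        intro!: square_integrable_add square_integrable_scale)
  show "a *\<^sub>R b *\<^sub>R u = (a * b) *\<^sub>R u"
    by transfer (auto simp: L2_rel_def mult.assoc intro!: square_integrable_scale)
  show "1 *\<^sub>R u = u"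
    by transfer (auto simp: L2_rel_def)
  show "sgn u = inverse (norm u) *\<^sub>R u"
    by (rule sgn_L2_def)
  show "dist u v = norm (u - v)"
    by (rule dist_L2_def)
  show "uniformity = (INF e\<in>{0<..}. principal {(x::L2, y). dist x y < e})"
    by (rule uniformity_L2_def)
  show "open U \<longleftrightarrow> (\<forall>x\<in>U. \<forall>\<^sub>F (x', y) in uniformity. x' = x \<longrightarrow> y \<in> U)" for U :: "L2 set"
    by (rule open_L2_def)
  show "inner u v = inner v u"
    by transfer (simp add: mult.commute)
  show "inner (u + v) w = inner u w + inner v w"
    by transfer (auto simp: L2_rel_def distrib_right square_integrable_mult
        intro!: Bochner_Integration.integral_add)
  show "inner (a *\<^sub>R u) v = a * inner u v"
    by transfer (simp add: mult.assoc)
  show "0 \<le> inner u u"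
    by transfer simp
  show "inner u u = 0 \<longleftrightarrow> u = 0"
  proof transfer
    fix f :: "real \<Rightarrow> real"
    assume "L2_rel f f"
    then have f: "square_integrable f" by (simp add: L2_rel_def)
    have "(integral\<^sup>L Leb (\<lambda>x. f x * f x) = 0) \<longleftrightarrow> (AE x in Leb. f x * f x = 0)"
      by (rule integral_nonneg_eq_0_iff_AE) (use square_integrable_mult[OF f f] in auto)
    then show "(integral\<^sup>L Leb (\<lambda>x. f x * f x) = 0) \<longleftrightarrow> L2_rel f (\<lambda>_. 0)"
      using f by (simp add: L2_rel_def square_integrable_zero)
  qed
  show "norm u = sqrt (inner u u)"
    by (rule norm_L2_def)
qed

end

text \<open>Pointwise product of representatives; meaningful when the product is square integrable,
  e.g. if one of the factors has a continuous representative.\<close>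

definition L2_mult :: "L2 \<Rightarrow> L2 \<Rightarrow> L2" where
  "L2_mult u v = abs_L2 (\<lambda>x. rep_L2 u x * rep_L2 v x)"

section \<open>Sobolev spaces\<close>

text \<open>\<open>f j\<close> is the \<open>j\<close>-th derivative of \<open>u\<close>: for \<open>j < p\<close> it is the absolutely continuous
  representative, and \<open>f p\<close> is square integrable.\<close>

definition sobolev_jet :: "nat \<Rightarrow> L2 \<Rightarrow> (nat \<Rightarrow> real \<Rightarrow> real) \<Rightarrow> bool" where
  "sobolev_jet p u f \<longleftrightarrow>
     (\<forall>j\<le>p. square_integrable (f j)) \<and> abs_L2 (f 0) = u \<and>
     (\<forall>j<p. \<forall>x\<in>{0..2*pi}. f j x = f j 0 + integral\<^sup>L (lebesgue_on {0..x}) (f (Suc j)))"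

definition Hp_interval :: "nat \<Rightarrow> L2 set" where
  "Hp_interval p = {u. \<exists>f. sobolev_jet p u f}"

definition Hp_circle :: "nat \<Rightarrow> L2 set" where
  "Hp_circle p = {u. \<exists>f. sobolev_jet p u f \<and> (\<forall>j<p. f j 0 = f j (2*pi))}"

definition sobolev_deriv :: "nat \<Rightarrow> L2 \<Rightarrow> L2" where
  "sobolev_deriv j u = (THE w. \<exists>f. sobolev_jet j u f \<and> w = abs_L2 (f j))"

definition Hp_norm :: "nat \<Rightarrow> L2 \<Rightarrow> real" where
  "Hp_norm p u = sqrt (\<Sum>j\<le>p. (norm (sobolev_deriv j u))\<^sup>2)"

section \<open>The operator, its kernel and its periodic eigenvalues\<close>

definition schroedinger :: "L2 \<Rightarrow> L2 \<Rightarrow> L2" where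
  "schroedinger q v = - sobolev_deriv 2 v + L2_mult q v"

definition C1 :: "nat \<Rightarrow> L2 set" where
  "C1 p = {q \<in> Hp_circle p. \<exists>v\<in>Hp_circle (p + 2). v \<noteq> 0 \<and> schroedinger q v = 0}"

definition eigenspace :: "nat \<Rightarrow> L2 \<Rightarrow> real \<Rightarrow> L2 set" where
  "eigenspace p q c = {v \<in> Hp_circle (p + 2). schroedinger q v = c *\<^sub>R v}"

definition lists_eigenvalues :: "nat \<Rightarrow> L2 \<Rightarrow> (nat \<Rightarrow> real) \<Rightarrow> bool" where
  "lists_eigenvalues p q ev \<longleftrightarrow>
     mono ev \<and> (\<forall>c. finite {n. ev n = c} \<and> card {n. ev n = c} = dim (eigenspace p q c))"

definition nth_eigenvalue :: "nat \<Rightarrow> L2 \<Rightarrow> nat \<Rightarrow> real" where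
  "nth_eigenvalue p q = (THE ev. lists_eigenvalues p q ev)"

definition s_number :: "nat \<Rightarrow> L2 \<Rightarrow> L2 \<Rightarrow> nat \<Rightarrow> real" where
  "s_number p q0 qp n = (THE s. nth_eigenvalue p (q0 - s *\<^sub>R qp) n = 0)"

section \<open>The universal cover of \<open>SL(2,\<real>)\<close>\<close>

definition mat2 :: "real \<Rightarrow> real \<Rightarrow> real \<Rightarrow> real \<Rightarrow> real^2^2" where
  "mat2 a b c d = vector [vector [a, b], vector [c, d]]"

definition SL2 :: "(real^2^2) set" where
  "SL2 = {A. det A = 1}"

text \<open>The universal covering group is given as a topological group whose carrier is a subset, with
  the subspace topology, of a normed space (the setting of the covering space theory in the
  library). This is no restriction, since the group is homeomorphic to \<open>\<real>\<^sup>3\<close>.\<close>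

definition universal_cover_SL2 ::
    "('g::real_normed_vector, 'm) monoid_scheme \<Rightarrow> ('g \<Rightarrow> real^2^2) \<Rightarrow> bool" where
  "universal_cover_SL2 G pr \<longleftrightarrow>
     group G \<and>
     continuous_on (carrier G \<times> carrier G) (\<lambda>(x, y). x \<otimes>\<^bsub>G\<^esub> y) \<and>
     continuous_on (carrier G) (\<lambda>x. inv\<^bsub>G\<^esub> x) \<and>
     (\<forall>x\<in>carrier G. \<forall>y\<in>carrier G. pr (x \<otimes>\<^bsub>G\<^esub> y) = pr x ** pr y) \<and>
     covering_space (carrier G) pr SL2 \<and>
     simply_connected (carrier G)"

definition trace_level :: "('g::real_normed_vector, 'm) monoid_scheme \<Rightarrow> ('g \<Rightarrow> real^2^2) \<Rightarrow> real \<Rightarrow> 'g set"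
  where "trace_level G pr c = {g \<in> carrier G. trace (pr g) = c}"

definition T20 :: "('g::real_normed_vector, 'm) monoid_scheme \<Rightarrow> ('g \<Rightarrow> real^2^2) \<Rightarrow> 'g set"
  where "T20 G pr = connected_component_set (trace_level G pr 2) \<one>\<^bsub>G\<^esub>"

definition phiL_dom :: "(real \<times> real \<times> real) set" where
  "phiL_dom = UNIV \<times> {0<..} \<times> UNIV"

text \<open>The parametrisations are the lifts through the identity; uniqueness of lifts determines
  them on the stated domain.\<close>

definition phiL :: "('g::real_normed_vector, 'm) monoid_scheme \<Rightarrow> ('g \<Rightarrow> real^2^2) \<Rightarrow>
    real \<times> real \<times> real \<Rightarrow> 'g" where
  "phiL G pr = (SOME \<phi>. continuous_on phiL_dom \<phi> \<and> \<phi> ` phiL_dom \<subseteq> carrier G \<and>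
     \<phi> (0, 1, 0) = \<one>\<^bsub>G\<^esub> \<and>
     (\<forall>(\<theta>, \<rho>, \<nu>)\<in>phiL_dom. pr (\<phi> (\<theta>, \<rho>, \<nu>)) =
        mat2 (cos \<theta>) (sin \<theta>) (- sin \<theta>) (cos \<theta>) **
        mat2 (sqrt \<rho>) 0 0 (1 / sqrt \<rho>) **
        mat2 1 0 (\<nu> / 2) 1))"

definition G0_dom :: "(real \<times> real \<times> real) set" where
  "G0_dom = {0<..} \<times> {0<..} \<times> UNIV"

definition G0 :: "('g::real_normed_vector, 'm) monoid_scheme \<Rightarrow> ('g \<Rightarrow> real^2^2) \<Rightarrow> 'g set" where
  "G0 G pr = phiL G pr ` G0_dom"

definition phiC :: "('g::real_normed_vector, 'm) monoid_scheme \<Rightarrow> ('g \<Rightarrow> real^2^2) \<Rightarrow>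
    real \<times> real \<times> real \<Rightarrow> 'g" where
  "phiC G pr = (THE \<phi>. continuous_on UNIV \<phi> \<and> range \<phi> \<subseteq> carrier G \<and>
     \<phi> (0, 0, 0) = \<one>\<^bsub>G\<^esub> \<and>
     (\<forall>\<alpha> r \<eta>. pr (\<phi> (\<alpha>, r * cos \<eta>, r * sin \<eta>)) =
        mat2 (cos \<alpha>) (sin \<alpha>) (- sin \<alpha>) (cos \<alpha>) **
        mat2 (cosh r + sinh r * cos \<eta>) (sinh r * sin \<eta>)
             (sinh r * sin \<eta>) (cosh r - sinh r * cos \<eta>)))"

definition cartan_strip :: "('g::real_normed_vector, 'm) monoid_scheme \<Rightarrow> ('g \<Rightarrow> real^2^2) \<Rightarrow> int \<Rightarrow> 'g set"
  where "cartan_strip G pr n = phiC G pr ` ({of_int n * pi - pi / 2<..<of_int n * pi + pi / 2} \<times> UNIV)"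

definition iota :: "('g::real_normed_vector, 'm) monoid_scheme \<Rightarrow> ('g \<Rightarrow> real^2^2) \<Rightarrow> 'g" where
  "iota G pr = phiC G pr (pi, 0, 0)"

section \<open>Monodromy\<close>

text \<open>The potential is only square integrable, so the initial value problem is understood in
  integrated form.\<close>

definition fundamental_solution :: "L2 \<Rightarrow> (real \<Rightarrow> real^2^2) \<Rightarrow> bool" where
  "fundamental_solution q \<Phi> \<longleftrightarrow>
     continuous_on {0..2*pi} \<Phi> \<and>
     (\<forall>t\<in>{0..2*pi}. \<Phi> t =
        mat 1 + integral\<^sup>L (lebesgue_on {0..t}) (\<lambda>x. mat2 0 1 (rep_L2 q x) 0 ** \<Phi> x))"

definition monodromy :: "('g::real_normed_vector, 'm) monoid_scheme \<Rightarrow> ('g \<Rightarrow> real^2^2) \<Rightarrow> L2 \<Rightarrow> 'g"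
  where "monodromy G pr q = (THE g. \<exists>\<Phi> \<Phi>'. fundamental_solution q \<Phi> \<and>
     continuous_on {0..2*pi} \<Phi>' \<and> \<Phi>' ` {0..2*pi} \<subseteq> carrier G \<and> \<Phi>' 0 = \<one>\<^bsub>G\<^esub> \<and>
     (\<forall>t\<in>{0..2*pi}. pr (\<Phi>' t) = \<Phi> t) \<and> g = \<Phi>' (2*pi))"

section \<open>Smooth diffeomorphisms between subsets of normed spaces\<close>

text \<open>A normed space is given by a linear subspace of the ambient type and a norm on it, so that
  \<open>Hp_circle p\<close> can be used with \<open>Hp_norm p\<close>. \<open>D k x\<close> is the \<open>k\<close>-th Frechet
  derivative at \<open>x\<close>, a bounded \<open>k\<close>-linear map on lists of length \<open>k\<close>; the last clause says
  that \<open>D (Suc k) x\<close> is the Frechet derivative of \<open>D k\<close> in the operator norm. The set \<open>U\<close> is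
  meant to be open in \<open>E\<close>.\<close>

definition smooth_between ::
    "'a::real_vector set \<Rightarrow> ('a \<Rightarrow> real) \<Rightarrow> 'b::real_vector set \<Rightarrow> ('b \<Rightarrow> real) \<Rightarrow>
     'a set \<Rightarrow> ('a \<Rightarrow> 'b) \<Rightarrow> bool" where
  "smooth_between E nE F nF U f \<longleftrightarrow>
    (\<exists>D :: nat \<Rightarrow> 'a \<Rightarrow> 'a list \<Rightarrow> 'b.
      (\<forall>x\<in>U. D 0 x [] = f x) \<and>
      (\<forall>k. \<forall>x\<in>U.
        (\<forall>vs\<in>lists E. length vs = k \<longrightarrow> D k x vs \<in> F) \<and>
        (\<forall>vs\<in>lists E. length vs = k \<longrightarrow> (\<forall>i<k. \<forall>v\<in>E. \<forall>w\<in>E. \<forall>a b.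
           D k x (vs[i := a *\<^sub>R v + b *\<^sub>R w]) = a *\<^sub>R D k x (vs[i := v]) + b *\<^sub>R D k x (vs[i := w]))) \<and>
        (\<exists>C. \<forall>vs\<in>lists E. length vs = k \<longrightarrow> nF (D k x vs) \<le> C * prod_list (map nE vs)) \<and>
        (\<forall>\<epsilon>>0. \<exists>\<delta>>0. \<forall>h\<in>E. nE h < \<delta> \<and> x + h \<in> U \<longrightarrow>
           (\<forall>vs\<in>lists E. length vs = k \<longrightarrow>
              nF (D k (x + h) vs - D k x vs - D (Suc k) x (h # vs))
                \<le> \<epsilon> * nE h * prod_list (map nE vs)))))"

definition diffeomorphism_between ::
    "'a::real_vector set \<Rightarrow> ('a \<Rightarrow> real) \<Rightarrow> 'b::real_vector set \<Rightarrow> ('b \<Rightarrow> real) \<Rightarrow>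
     'a set \<Rightarrow> 'b set \<Rightarrow> ('a \<Rightarrow> 'b) \<Rightarrow> bool" where
  "diffeomorphism_between E nE F nF U V f \<longleftrightarrow>
     bij_betw f U V \<and> smooth_between E nE F nF U f \<and> smooth_between F nF E nE V (inv_into U f)"

text \<open>The smooth structure of \<open>G\<^sub>0\<close> is the one given by the global chart \<open>phiL\<close>.\<close>

definition diffeo_G0_Hp :: "nat \<Rightarrow> ('g::real_normed_vector, 'm) monoid_scheme \<Rightarrow>
    ('g \<Rightarrow> real^2^2) \<Rightarrow> ('g \<times> 'h::real_inner \<Rightarrow> L2) \<Rightarrow> bool" where
  "diffeo_G0_Hp p G pr \<Psi> \<longleftrightarrow>
     diffeomorphism_between UNIV norm (Hp_circle p) (Hp_norm p) (G0_dom \<times> UNIV) (Hp_circle p)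
       (\<lambda>(x, h). \<Psi> (phiL G pr x, h))"

definition hyperplane :: "('g::real_normed_vector, 'm) monoid_scheme \<Rightarrow> ('g \<Rightarrow> real^2^2) \<Rightarrow>
    ('g \<times> 'h::real_inner \<Rightarrow> L2) \<Rightarrow> L2 set" where
  "hyperplane G pr \<Psi> = \<Psi> ` ((T20 G pr \<inter> G0 G pr) \<times> UNIV)"

definition cone_leaves :: "('g::real_normed_vector, 'm) monoid_scheme \<Rightarrow> ('g \<Rightarrow> real^2^2) \<Rightarrow>
    nat \<Rightarrow> 'g set set" where
  "cone_leaves G pr k =
     components (trace_level G pr 2 \<inter> cartan_strip G pr (2 * int k) - {iota G pr [^]\<^bsub>G\<^esub> (2 * k)})"

definition cone_sheets :: "('g::real_normed_vector, 'm) monoid_scheme \<Rightarrow> ('g \<Rightarrow> real^2^2) \<Rightarrow>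
    ('g \<times> 'h::real_inner \<Rightarrow> L2) \<Rightarrow> nat \<Rightarrow> L2 set set" where
  "cone_sheets G pr \<Psi> k =
     {\<Psi> ` ((l \<union> {iota G pr [^]\<^bsub>G\<^esub> (2 * k)}) \<times> UNIV) | l. l \<in> cone_leaves G pr k}"

definition line :: "L2 \<Rightarrow> L2 \<Rightarrow> L2 set" where
  "line q0 qp = range (\<lambda>s. q0 - s *\<^sub>R qp)"

end

theory Submission
  imports Defs
begin

text \<open>
  The diffeomorphism identifies \<open>\<Psi> ` (A \<times> UNIV)\<close> with the set of potentials whose monodromy lies in
  \<open>A\<close>, so everything takes place in the universal cover. An element \<open>g\<close> of the cover displaces
  directions of the plane by real angles, measured clockwise; they fill the interval
  \<open>[lo g, hi g] = [\<alpha> - \<beta>, \<alpha> + \<beta>]\<close>, where \<open>\<alpha>\<close> is the rotation angle of the Cartan decomposition and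
  \<open>cos \<beta> = 1 / cosh r\<close>. Since the trace is \<open>2 cos \<alpha> cosh r\<close>, the two sheets of the \<open>k\<close>-th cone are
  \<open>hi g = 2k\<pi>\<close> and \<open>lo g = 2k\<pi>\<close>, and the hyperplane is \<open>lo g = 0\<close> (there \<open>hi g > 0\<close>, because the
  direction \<open>(0, 1)\<close> is displaced by the positive angle \<open>\<theta>\<close> of the Iwasawa chart).

  Along \<open>q - s w\<close> with \<open>w > 0\<close> almost everywhere the Wronskian of the solutions for the parameters \<open>s\<close>
  and \<open>t\<close> with equal initial data is \<open>(t - s)\<close> times the integral of \<open>w\<close> against their product, so all
  displacements, and with them \<open>lo\<close> and \<open>hi\<close>, are continuous and strictly increasing in \<open>s\<close>.
  Comparison with constant potentials gives the limits at both ends, and each sheet is met exactly once.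
  The same statement for \<open>w = 1\<close> enumerates the periodic eigenvalues: \<open>\<lambda>\<^sub>2\<^sub>k\<close> is on the sheet
  \<open>lo = 2k\<pi>\<close> and \<open>\<lambda>\<^sub>2\<^sub>k\<^sub>-\<^sub>1\<close> on \<open>hi = 2k\<pi>\<close>, which places \<open>s\<^sub>n\<close>.
\<close>

section \<open>Absolutely continuous functions on \<open>[0,2\<pi>]\<close>\<close>

text \<open>Little can be done pointwise in t: potentials are only square integrable, and w is
  positive only almost everywhere, with no lower bound. Monotonicity is therefore read off from an
  integral of w against a product of two solutions, known to be positive only for nearby parameters,
  and globalized by continuity. Nor does q - s w pass below or above a constant uniformly as s
  varies; truncations that bound it from one side, are dominated and tend to a constant almost
  everywhere are put in between. They are close to the constant in L1, which is the sense in which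
  solutions depend continuously on the coefficient. Counting sheets gives eigenvalues with
  multiplicity only if the identity of the group is excluded: there lo = hi = 0 carries a single
  index while the kernel is two-dimensional. The exclusion, hi > 0, is taken from the surjectivity
  of \<Psi>, by which every potential in \<open>Hp_circle p\<close> has its monodromy in
  \<open>G0\<close>. The definite descriptions behind \<lambda>_n and s_n are then resolved because
  a nondecreasing sequence is determined by its multiplicities.\<close>

definition ac :: "(real \<Rightarrow> real) \<Rightarrow> (real \<Rightarrow> real) \<Rightarrow> bool" where
  "ac f g \<longleftrightarrow> integrable Leb g \<and>
     (\<forall>x\<in>{0..2*pi}. f x = f 0 + integral\<^sup>L (lebesgue_on {0..x}) g)"

lemma integrable_initial:
  fixes f :: "real \<Rightarrow> 'a::euclidean_space"
  assumes "integrable Leb f" "x \<le> 2*pi"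
  shows "integrable (lebesgue_on {0..x}) f"
proof (rule integrable_subinterval)
  show "integrable (lebesgue_on {0..2*pi}) f" by fact
qed (use assms in auto)

lemma AE_initial:
  assumes "AE t in Leb. P t" "x \<le> 2*pi"
  shows "AE t in lebesgue_on {0..x}. P t"
  using assms by (auto simp: AE_restrict_space_iff)

lemma integral_initial_cong_AE:
  fixes f g :: "real \<Rightarrow> real"
  assumes "AE t in Leb. f t = g t" "f \<in> borel_measurable Leb" "g \<in> borel_measurable Leb" "x \<le> 2*pi"
  shows "integral\<^sup>L (lebesgue_on {0..x}) f = integral\<^sup>L (lebesgue_on {0..x}) g"
proof -
  have "{0..x} \<subseteq> {0..2*pi}"
    using assms by auto
  then have "f \<in> borel_measurable (lebesgue_on {0..x})" "g \<in> borel_measurable (lebesgue_on {0..x})"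
    using assms measurable_restrict_mono by blast+
  then show ?thesis
    using AE_initial[OF assms(1,4)] by (intro integral_cong_AE) auto
qed

lemma AE_on_intervalI:
  assumes "\<And>t. t \<in> {0..x} \<Longrightarrow> P t"
  shows "AE t in lebesgue_on {0..x}. P t"
  using assms by (auto simp: AE_restrict_space_iff)

lemma integrable_Leb_continuous:
  fixes f :: "real \<Rightarrow> 'a::euclidean_space"
  assumes "continuous_on {0..2*pi} f"
  shows "integrable Leb f"
  using assms continuous_imp_integrable_real by blast

lemma measurable_Leb_continuous:
  fixes f :: "real \<Rightarrow> real"
  assumes "continuous_on {0..2*pi} f"
  shows "f \<in> borel_measurable Leb"
  using integrable_Leb_continuous[OF assms] by auto

lemma bounded_on_interval:
  fixes f :: "real \<Rightarrow> real"
  assumes "continuous_on {0..2*pi} f"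
  obtains B where "B > 0" "\<And>t. t \<in> {0..2*pi} \<Longrightarrow> \<bar>f t\<bar> \<le> B"
proof -
  have "bounded (f ` {0..2*pi})"
    using assms compact_continuous_image compact_imp_bounded by blast
  then obtain B where "B > 0" "\<forall>y\<in>f ` {0..2*pi}. norm y \<le> B"
    using bounded_pos by blast
  then show ?thesis
    using that by auto
qed

lemma integrable_mult_continuous:
  fixes f g :: "real \<Rightarrow> real"
  assumes "integrable Leb f" "continuous_on {0..2*pi} g"
  shows "integrable Leb (\<lambda>t. f t * g t)"
proof -
  obtain B where B: "B > 0" "\<And>t. t \<in> {0..2*pi} \<Longrightarrow> \<bar>g t\<bar> \<le> B"
    using bounded_on_interval assms by blast
  show ?thesis
  proof (rule Bochner_Integration.integrable_bound)
    show "integrable Leb (\<lambda>t. B * f t)"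
      using assms by simp
    show "(\<lambda>t. f t * g t) \<in> borel_measurable Leb"
      using assms measurable_Leb_continuous by auto
    show "AE t in Leb. norm (f t * g t) \<le> norm (B * f t)"
    proof (rule AE_on_intervalI)
      fix t assume "t \<in> {0..2*pi}"
      then have "\<bar>f t\<bar> * \<bar>g t\<bar> \<le> \<bar>f t\<bar> * B"
        using B by (intro mult_left_mono) auto
      then show "norm (f t * g t) \<le> norm (B * f t)"
        using B by (simp add: abs_mult mult.commute)
    qed
  qed
qed

lemma integrable_mult_continuous':
  fixes f g :: "real \<Rightarrow> real"
  assumes "integrable Leb f" "continuous_on {0..2*pi} g"
  shows "integrable Leb (\<lambda>t. g t * f t)"
  using integrable_mult_continuous[OF assms] by (simp add: mult.commute)

lemma acD:
  assumes "ac f g"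
  shows "integrable Leb g" "\<And>x. x \<in> {0..2*pi} \<Longrightarrow> f x = f 0 + integral\<^sup>L (lebesgue_on {0..x}) g"
  using assms unfolding ac_def by blast+

lemma ac_continuous:
  assumes "ac f g"
  shows "continuous_on {0..2*pi} f"
proof -
  have "continuous_on {0..2*pi} (\<lambda>x. f 0 + integral\<^sup>L (lebesgue_on {0..x}) g)"
    using assms
    by (intro continuous_on_add continuous_on_const indefinite_integral_continuous_real)
       (rule acD(1))
  then show ?thesis
    by (rule continuous_on_eq) (metis acD(2) assms)
qed

lemma AE_lebesgue_on_neq: "S \<in> sets lebesgue \<Longrightarrow> AE s in lebesgue_on S. s \<noteq> (t::real)"
  using AE_completion[OF AE_lborel_singleton[of t]] by (auto simp: AE_restrict_space_iff)

lemma integral_initial_0: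
  fixes g :: "real \<Rightarrow> real"
  shows "integral\<^sup>L (lebesgue_on {0..0}) g = 0"
proof (rule integral_eq_zero_AE)
  have "AE s in lebesgue_on {0..0::real}. s \<noteq> 0" "AE s in lebesgue_on {0..0::real}. s \<in> space (lebesgue_on {0..0})"
    by (rule AE_lebesgue_on_neq) (auto intro: AE_I2)
  then show "AE s in lebesgue_on {0..0}. g s = 0"
    by eventually_elim auto
qed

lemma ac_integral:
  assumes "integrable Leb g"
  shows "ac (\<lambda>x. c + integral\<^sup>L (lebesgue_on {0..x}) g) g"
  using assms by (simp add: ac_def integral_initial_0 del: atLeastAtMost_singleton)

text \<open>Integration by parts without derivatives: the integral of f s * g t over the square
  [0,x]^2 is cut along the diagonal. For fixed t the part s < t integrates to F t; for fixed s the
  part t > s integrates to G x - G s.\<close>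

lemma integral_initial_mult:
  fixes f g :: "real \<Rightarrow> real"
  assumes f: "integrable (lebesgue_on {0..x}) f" and g: "integrable (lebesgue_on {0..x}) g"
    and x: "0 \<le> x"
  defines "F \<equiv> \<lambda>t. integral\<^sup>L (lebesgue_on {0..t}) f"
  defines "G \<equiv> \<lambda>t. integral\<^sup>L (lebesgue_on {0..t}) g"
  shows "F x * G x = integral\<^sup>L (lebesgue_on {0..x}) (\<lambda>t. f t * G t + F t * g t)"
proof -
  let ?M = "lebesgue_on {0..x}"
  interpret M: finite_measure ?M
    by (rule finite_measure_lebesgue_on) simp
  interpret P: pair_sigma_finite ?M ?M ..
  \<comment> \<open>Fubini on the triangle \<open>s < t\<close>\<close>
  have prod: "integrable (?M \<Otimes>\<^sub>M ?M) (\<lambda>(s, t). f s * g t)"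
  proof (rule P.Fubini_integrable)
    show "(\<lambda>(s, t). f s * g t) \<in> borel_measurable (?M \<Otimes>\<^sub>M ?M)"
      using f g by (auto simp: split_beta')
    show "integrable ?M (\<lambda>s. \<integral>t. norm (case (s, t) of (s, t) \<Rightarrow> f s * g t) \<partial>?M)"
      using f g by (simp add: abs_mult)
    show "AE s in ?M. integrable ?M (\<lambda>t. case (s, t) of (s, t) \<Rightarrow> f s * g t)"
      using g by simp
  qed
  have id: "(\<lambda>t. t) \<in> borel_measurable ?M"
    using continuous_imp_integrable_real[of 0 x "\<lambda>t. t"] by auto
  have [measurable]: "fst \<in> borel_measurable (?M \<Otimes>\<^sub>M ?M)" "snd \<in> borel_measurable (?M \<Otimes>\<^sub>M ?M)"
    using measurable_compose[OF measurable_fst id] measurable_compose[OF measurable_snd id] by auto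
  have less: "{p \<in> space (?M \<Otimes>\<^sub>M ?M). fst p < snd p} \<in> sets (?M \<Otimes>\<^sub>M ?M)"
    by measurable
  have "integrable (?M \<Otimes>\<^sub>M ?M) (\<lambda>p. indicator {p \<in> space (?M \<Otimes>\<^sub>M ?M). fst p < snd p} p *\<^sub>R
      (case p of (s, t) \<Rightarrow> f s * g t))"
    by (rule integrable_mult_indicator[OF less prod])
  then have half: "integrable (?M \<Otimes>\<^sub>M ?M) (\<lambda>(s, t). (if s < t then f s * g t else 0))"
    by (rule Bochner_Integration.integrable_cong[THEN iffD1, rotated -1])
      (auto simp: indicator_def space_pair_measure)
  have le: "integral\<^sup>L (lebesgue_on {0..t}) h = (\<integral>s. (if s \<le> t then h s else 0) \<partial>?M)"
    if "t \<in> {0..x}" for t and h :: "real \<Rightarrow> real"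
  proof -
    have "(\<integral>s. (if s \<le> t then h s else 0) \<partial>?M) = (\<integral>s. indicator {0..t} s *\<^sub>R h s \<partial>lebesgue)"
      unfolding integral_restrict_space[of "{0..x}" lebesgue, simplified]
      using that by (intro Bochner_Integration.integral_cong) (auto simp: indicator_def)
    then show ?thesis
      by (simp add: integral_restrict_space)
  qed
  have ifI: "integrable ?M (\<lambda>s. if Q s then h s else 0)" if "integrable ?M h" "Measurable.pred ?M Q" 
    for h :: "real \<Rightarrow> real" and Q
  proof -
    have "integrable ?M (\<lambda>s. indicator {s \<in> space ?M. Q s} s *\<^sub>R h s)"
      using that by (intro integrable_mult_indicator predE)
    then show ?thesis
      by (rule Bochner_Integration.integrable_cong[THEN iffD1, rotated -1]) (auto simp: indicator_def)
  qed
  have pm: "Measurable.pred ?M (\<lambda>s. s < t)" "Measurable.pred ?M (\<lambda>s. s \<le> t)" 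
    "Measurable.pred ?M (\<lambda>s. t < s)" for t
    using id by measurable
  \<comment> \<open>The triangle carries the strict inequality and \<open>F\<close> the weak one;
    the single point s = t is null.\<close>
  have lt: "integral\<^sup>L (lebesgue_on {0..t}) f = (\<integral>s. (if s < t then f s else 0) \<partial>?M)"
    if "t \<in> {0..x}" for t
    unfolding le[OF that]
  proof (rule integral_cong_AE)
    show "AE s in ?M. (if s \<le> t then f s else 0) = (if s < t then f s else 0)"
      using AE_lebesgue_on_neq[of "{0..x}" t, simplified] by eventually_elim auto
  qed (rule borel_measurable_integrable[OF ifI[OF f pm(2)]] borel_measurable_integrable[OF ifI[OF f pm(1)]])+
  have gt: "(\<integral>t. (if s < t then g t else 0) \<partial>?M) = G x - G s" if "s \<in> {0..x}" for s
  proof -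
    have "(\<integral>t. (if s < t then g t else 0) \<partial>?M) = (\<integral>t. g t - (if t \<le> s then g t else 0) \<partial>?M)"
      by (rule Bochner_Integration.integral_cong) auto
    also have "\<dots> = integral\<^sup>L ?M g - (\<integral>t. (if t \<le> s then g t else 0) \<partial>?M)"
      using g ifI[OF g pm(2)] by (rule Bochner_Integration.integral_diff)
    finally show ?thesis
      using le[OF that, of g] by (simp add: G_def)
  qed
  have cont: "continuous_on {0..x} F" "continuous_on {0..x} G"
    unfolding F_def G_def using f g by (auto intro!: indefinite_integral_continuous_real)
  have int1: "integrable ?M (\<lambda>t. f t * G t)" and int2: "integrable ?M (\<lambda>t. F t * g t)"
  proof -
    have *: "integrable ?M (\<lambda>t. u t * v t)" if u: "integrable ?M u" and v: "continuous_on {0..x} v" 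
      for u v :: "real \<Rightarrow> real"
    proof -
      have "compact (v ` {0..x})"
        using v by (intro compact_continuous_image) auto
      then obtain B where B: "\<And>t. t \<in> {0..x} \<Longrightarrow> \<bar>v t\<bar> \<le> B"
        by (metis bounded_pos compact_imp_bounded image_eqI real_norm_def)
      have vi: "integrable ?M v"
        using v by (rule continuous_imp_integrable_real)
      show ?thesis
      proof (rule Bochner_Integration.integrable_bound)
        show "integrable ?M (\<lambda>t. B * u t)"
          using u by simp
        show "(\<lambda>t. u t * v t) \<in> borel_measurable ?M"
          using u vi by (intro borel_measurable_times borel_measurable_integrable)
        show "AE t in ?M. norm (u t * v t) \<le> norm (B * u t)"
        proof (rule AE_on_intervalI)
          fix t assume "t \<in> {0..x}"
          then have "\<bar>v t\<bar> \<le> \<bar>B\<bar>"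
            using B[of t] by linarith
          then have "\<bar>u t\<bar> * \<bar>v t\<bar> \<le> \<bar>u t\<bar> * \<bar>B\<bar>"
            by (rule mult_left_mono) simp
          then show "norm (u t * v t) \<le> norm (B * u t)"
            by (simp add: abs_mult mult.commute)
        qed
      qed
    qed
    show "integrable ?M (\<lambda>t. f t * G t)" using *[OF f cont(2)] .
    show "integrable ?M (\<lambda>t. F t * g t)" using *[OF g cont(1)] by (simp add: mult.commute)
  qed
  have "(\<integral>t. F t * g t \<partial>?M) = (\<integral>t. (\<integral>s. (if s < t then f s * g t else 0) \<partial>?M) \<partial>?M)"
  proof (rule Bochner_Integration.integral_cong)
    fix t assume "t \<in> space ?M"
    then have "F t * g t = (\<integral>s. (if s < t then f s else 0) * g t \<partial>?M)"
      using lt by (simp add: F_def)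
    also have "\<dots> = (\<integral>s. (if s < t then f s * g t else 0) \<partial>?M)"
      by (rule Bochner_Integration.integral_cong) auto
    finally show "F t * g t = (\<integral>s. (if s < t then f s * g t else 0) \<partial>?M)" .
  qed simp
  also have "\<dots> = (\<integral>s. (\<integral>t. (if s < t then f s * g t else 0) \<partial>?M) \<partial>?M)"
    using P.Fubini_integral[OF half] by simp
  also have "\<dots> = (\<integral>s. f s * G x - f s * G s \<partial>?M)"
  proof (rule Bochner_Integration.integral_cong)
    fix s assume "s \<in> space ?M"
    then have "f s * (G x - G s) = (\<integral>t. f s * (if s < t then g t else 0) \<partial>?M)"
      using gt by simp
    also have "\<dots> = (\<integral>t. (if s < t then f s * g t else 0) \<partial>?M)"
      by (rule Bochner_Integration.integral_cong) auto
    finally show "(\<integral>t. (if s < t then f s * g t else 0) \<partial>?M) = f s * G x - f s * G s"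
      by (simp add: right_diff_distrib)
  qed simp
  also have "\<dots> = F x * G x - (\<integral>s. f s * G s \<partial>?M)"
    using f int1 by (subst Bochner_Integration.integral_diff) (auto simp: F_def)
  finally show ?thesis
    using int1 int2 by simp
qed

lemma integral_initial_cong:
  "(\<And>t. t \<in> {0..x} \<Longrightarrow> f t = g t) \<Longrightarrow>
    integral\<^sup>L (lebesgue_on {0..x}) f = integral\<^sup>L (lebesgue_on {0..x}) g"
  by (rule Bochner_Integration.integral_cong) auto

lemma acI:
  "integrable Leb g \<Longrightarrow> (\<And>x. x \<in> {0..2*pi} \<Longrightarrow> f x = f 0 + integral\<^sup>L (lebesgue_on {0..x}) g) \<Longrightarrow> ac f g"
  unfolding ac_def by blast

lemma ac_mult:
  assumes f: "ac f f'" and g: "ac g g'"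
  shows "ac (\<lambda>x. f x * g x) (\<lambda>x. f' x * g x + f x * g' x)"
proof (rule acI)
  show "integrable Leb (\<lambda>x. f' x * g x + f x * g' x)"
    using acD(1)[OF f] acD(1)[OF g] ac_continuous[OF f] ac_continuous[OF g]
    by (intro Bochner_Integration.integrable_add integrable_mult_continuous integrable_mult_continuous')
next
  fix x :: real assume x: "x \<in> {0..2*pi}"
  let ?M = "lebesgue_on {0..x}"
  let ?F = "\<lambda>t. integral\<^sup>L (lebesgue_on {0..t}) f'"
  let ?G = "\<lambda>t. integral\<^sup>L (lebesgue_on {0..t}) g'"
  have int: "integrable ?M f'" "integrable ?M g'"
    using acD(1)[OF f] acD(1)[OF g] x by (auto intro: integrable_initial)
  have FG: "continuous_on {0..2*pi} ?F" "continuous_on {0..2*pi} ?G"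
    using acD(1)[OF f] acD(1)[OF g] by (auto intro: indefinite_integral_continuous_real)
  have int2: "integrable ?M (\<lambda>t. f' t * ?G t)" "integrable ?M (\<lambda>t. ?F t * g' t)"
    using integrable_initial[OF integrable_mult_continuous[OF acD(1)[OF f] FG(2)], of x]
      integrable_initial[OF integrable_mult_continuous'[OF acD(1)[OF g] FG(1)], of x] x by auto
  have "integral\<^sup>L ?M (\<lambda>t. f' t * g t + f t * g' t) =
      integral\<^sup>L ?M (\<lambda>t. (g 0 * f' t + f 0 * g' t) + (f' t * ?G t + ?F t * g' t))"
  proof (rule integral_initial_cong)
    fix t assume "t \<in> {0..x}"
    then have t: "t \<in> {0..2*pi}"
      using x by auto
    have "f' t * g t + f t * g' t = f' t * (g 0 + ?G t) + (f 0 + ?F t) * g' t"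
      using acD(2)[OF f t] acD(2)[OF g t] by metis
    also have "\<dots> = (g 0 * f' t + f 0 * g' t) + (f' t * ?G t + ?F t * g' t)"
      by (simp add: algebra_simps)
    finally show "f' t * g t + f t * g' t = (g 0 * f' t + f 0 * g' t) + (f' t * ?G t + ?F t * g' t)" .
  qed
  also have "\<dots> = integral\<^sup>L ?M (\<lambda>t. g 0 * f' t + f 0 * g' t) + integral\<^sup>L ?M (\<lambda>t. f' t * ?G t + ?F t * g' t)"
    using int int2 by (intro Bochner_Integration.integral_add Bochner_Integration.integrable_add) auto
  also have "\<dots> = (g 0 * ?F x + f 0 * ?G x) + ?F x * ?G x"
    using int integral_initial_mult[OF int] x by simp
  finally have *: "integral\<^sup>L ?M (\<lambda>t. f' t * g t + f t * g' t) = (g 0 * ?F x + f 0 * ?G x) + ?F x * ?G x" .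
  have "f x * g x = (f 0 + ?F x) * (g 0 + ?G x)"
    using acD(2)[OF f x] acD(2)[OF g x] by metis
  then show "f x * g x = f 0 * g 0 + integral\<^sup>L ?M (\<lambda>t. f' t * g t + f t * g' t)"
    unfolding * by (simp add: algebra_simps)
qed

lemma ac_add:
  assumes "ac f f'" "ac g g'"
  shows "ac (\<lambda>x. f x + g x) (\<lambda>x. f' x + g' x)"
proof (rule acI)
  show "integrable Leb (\<lambda>x. f' x + g' x)"
    by (intro Bochner_Integration.integrable_add acD(1)[OF assms(1)] acD(1)[OF assms(2)])
  fix x :: real assume x: "x \<in> {0..2*pi}"
  have "integral\<^sup>L (lebesgue_on {0..x}) (\<lambda>x. f' x + g' x) =
      integral\<^sup>L (lebesgue_on {0..x}) f' + integral\<^sup>L (lebesgue_on {0..x}) g'"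
    using x integrable_initial[OF acD(1)[OF assms(1)]] integrable_initial[OF acD(1)[OF assms(2)]]
    by (intro Bochner_Integration.integral_add) auto
  then show "f x + g x = f 0 + g 0 + integral\<^sup>L (lebesgue_on {0..x}) (\<lambda>x. f' x + g' x)"
    using acD(2)[OF assms(1) x] acD(2)[OF assms(2) x] by linarith
qed

lemma ac_const: "ac (\<lambda>_. c) (\<lambda>_. 0)"
  by (rule acI) auto

lemma ac_scale:
  assumes "ac f f'"
  shows "ac (\<lambda>x. c * f x) (\<lambda>x. c * f' x)"
  using ac_mult[OF ac_const[of c] assms] by simp

lemma ac_diff:
  assumes "ac f f'" "ac g g'"
  shows "ac (\<lambda>x. f x - g x) (\<lambda>x. f' x - g' x)"
  using ac_add[OF assms(1) ac_scale[OF assms(2), of "-1"]] by simp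

text \<open>Serves to verify the explicit solutions for constant coefficients, where classical
  derivatives are at hand.\<close>

lemma ac_deriv:
  assumes "\<And>x. x \<in> {0..2*pi} \<Longrightarrow> (f has_real_derivative g x) (at x within {0..2*pi})"
    and "continuous_on {0..2*pi} g"
  shows "ac f g"
proof (rule acI)
  show int: "integrable Leb g"
    using assms(2) by (rule integrable_Leb_continuous)
  fix x :: real assume x: "x \<in> {0..2*pi}"
  have "(f has_vector_derivative g t) (at t within {0..x})" if "t \<in> {0..x}" for t
    using has_vector_derivative_within_subset[of f "g t" t "{0..2*pi}" "{0..x}"] assms(1)[of t] that x
    by (auto simp: has_real_derivative_iff_has_vector_derivative)
  then have "(g has_integral f x - f 0) {0..x}"
    using x by (intro fundamental_theorem_of_calculus) auto
  moreover have "(g has_integral integral\<^sup>L (lebesgue_on {0..x}) g) {0..x}"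
    using integrable_initial[OF int] x by (intro has_integral_integral_lebesgue_on) auto
  ultimately have "f x - f 0 = integral\<^sup>L (lebesgue_on {0..x}) g"
    by (rule has_integral_unique)
  then show "f x = f 0 + integral\<^sup>L (lebesgue_on {0..x}) g"
    by simp
qed

section \<open>Integral estimates and the Gronwall inequality\<close>

lemma integral_initial_mono:
  fixes f g :: "real \<Rightarrow> real"
  assumes "integrable Leb f" "integrable Leb g" "x \<le> 2*pi" "\<And>t. t \<in> {0..x} \<Longrightarrow> f t \<le> g t"
  shows "integral\<^sup>L (lebesgue_on {0..x}) f \<le> integral\<^sup>L (lebesgue_on {0..x}) g"
  using integrable_initial[OF assms(1,3)] integrable_initial[OF assms(2,3)] assms(4)
  by (intro integral_mono) auto

lemma abs_integral_initial_le:
  fixes f g :: "real \<Rightarrow> real"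
  assumes "integrable Leb f" "integrable Leb g" "x \<le> 2*pi" "\<And>t. t \<in> {0..x} \<Longrightarrow> \<bar>f t\<bar> \<le> g t"
  shows "\<bar>integral\<^sup>L (lebesgue_on {0..x}) f\<bar> \<le> integral\<^sup>L (lebesgue_on {0..x}) g"
proof -
  have "\<bar>integral\<^sup>L (lebesgue_on {0..x}) f\<bar> \<le> integral\<^sup>L (lebesgue_on {0..x}) (\<lambda>t. \<bar>f t\<bar>)"
    using integral_norm_bound[of "lebesgue_on {0..x}" f] by simp
  also have "\<dots> \<le> integral\<^sup>L (lebesgue_on {0..x}) g"
    using assms by (intro integral_initial_mono) auto
  finally show ?thesis .
qed

lemma integral_initial_le_Leb:
  fixes f :: "real \<Rightarrow> real"
  assumes "integrable Leb f" "x \<le> 2*pi" "\<And>t. 0 \<le> f t"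
  shows "integral\<^sup>L (lebesgue_on {0..x}) f \<le> integral\<^sup>L Leb f"
proof -
  have "integrable lebesgue (\<lambda>t. indicator {0..2*pi} t *\<^sub>R f t)"
    using assms(1) by (simp add: integrable_restrict_space)
  moreover have "integrable lebesgue (\<lambda>t. indicator {0..x} t *\<^sub>R f t)"
    using integrable_initial[OF assms(1,2)] by (simp add: integrable_restrict_space)
  ultimately show ?thesis
    using assms(2,3) by (simp add: integral_restrict_space)
      (intro integral_mono, auto simp: indicator_def)
qed

text \<open>Induction by the product rule. The terms of the exponential series thus appear as
  iterated integrals of an integrable weight, which drives both the Gronwall inequality and the
  Picard estimates.\<close>

lemma ac_power_fact:
  fixes \<kappa> :: "real \<Rightarrow> real"
  assumes "integrable Leb \<kappa>"
  defines "K \<equiv> \<lambda>t. integral\<^sup>L (lebesgue_on {0..t}) \<kappa>"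
  shows "ac (\<lambda>t. K t ^ Suc n / fact (Suc n)) (\<lambda>t. \<kappa> t * (K t ^ n / fact n))"
proof (induction n)
  case 0
  show ?case
    using ac_integral[OF assms(1), of 0] by (simp add: K_def)
next
  case (Suc n)
  have "ac K \<kappa>"
    using ac_integral[OF assms(1), of 0] by (simp add: K_def)
  \<comment> \<open>The product rule for \<open>K\<close> and the previous term produces the
    coefficient 1/(n+1)! + 1/n! = (n+2)/(n+1)!, hence the factor 1/(n+2).\<close>
  note step = ac_scale[OF ac_mult[OF this Suc], of "1 / (real n + 2)"]
  have eqs: "1 / (real n + 2) * (K t * (K t ^ Suc n / fact (Suc n))) = K t ^ Suc (Suc n) / fact (Suc (Suc n))"
    "1 / (real n + 2) * (\<kappa> t * (K t ^ Suc n / fact (Suc n)) + K t * (\<kappa> t * (K t ^ n / fact n)))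
       = \<kappa> t * (K t ^ Suc n / fact (Suc n))" for t
  proof -
    have *: "(fact (Suc (Suc n)) :: real) = (real n + 2) * fact (Suc n)"
      by (simp add: algebra_simps)
    show "1 / (real n + 2) * (K t * (K t ^ Suc n / fact (Suc n))) = K t ^ Suc (Suc n) / fact (Suc (Suc n))"
      unfolding * by simp
    have **: "(fact (Suc n) :: real) = (real n + 1) * fact n"
      by (simp add: algebra_simps)
    have "1 / (real n + 2) * (\<kappa> t * (K t ^ Suc n / fact (Suc n)) + K t * (\<kappa> t * (K t ^ n / fact n)))
       = \<kappa> t * K t ^ Suc n * ((1 / (real n + 2)) * (1 / fact (Suc n) + 1 / fact n))"
      by (simp add: algebra_simps)
    also have "(1 / (real n + 2)) * (1 / fact (Suc n) + 1 / fact n) = 1 / fact (Suc n)"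
    proof -
      have "(1 / (N + 1)) * (1 / (N * a) + 1 / a) = 1 / (N * a)" if "N > 0" "a > 0" for N a :: real
        using that by (simp add: divide_simps)
      from this[of "real n + 1" "fact n"] show ?thesis
        unfolding ** by (simp add: add.assoc)
    qed
    finally show "1 / (real n + 2) * (\<kappa> t * (K t ^ Suc n / fact (Suc n)) + K t * (\<kappa> t * (K t ^ n / fact n)))
       = \<kappa> t * (K t ^ Suc n / fact (Suc n))"
      by simp
  qed
  show ?case
    using step unfolding eqs .
qed

lemma integral_power_fact:
  fixes \<kappa> :: "real \<Rightarrow> real"
  assumes "integrable Leb \<kappa>" "x \<in> {0..2*pi}"
  defines "K \<equiv> \<lambda>t. integral\<^sup>L (lebesgue_on {0..t}) \<kappa>"
  shows "integral\<^sup>L (lebesgue_on {0..x}) (\<lambda>t. \<kappa> t * (K t ^ n / fact n)) = K x ^ Suc n / fact (Suc n)"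
  using acD(2)[OF ac_power_fact[OF assms(1), of n] assms(2)] integral_initial_0[of \<kappa>]
  by (simp add: K_def del: atLeastAtMost_singleton)

text \<open>Inserting the inequality into itself n times leaves C times a partial sum of the
  exponential series plus B times its n-th term, where B bounds u; the remainder vanishes as n
  grows.\<close>

lemma gronwall:
  fixes \<kappa> u :: "real \<Rightarrow> real"
  assumes \<kappa>: "integrable Leb \<kappa>" "\<And>t. 0 \<le> \<kappa> t" and u: "continuous_on {0..2*pi} u"
    and le: "\<And>t. t \<in> {0..2*pi} \<Longrightarrow> u t \<le> C + integral\<^sup>L (lebesgue_on {0..t}) (\<lambda>x. \<kappa> x * u x)"
    and t: "t \<in> {0..2*pi}"
  shows "u t \<le> C * exp (integral\<^sup>L (lebesgue_on {0..t}) \<kappa>)"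
proof -
  define K where "K = (\<lambda>t. integral\<^sup>L (lebesgue_on {0..t}) \<kappa>)"
  obtain B where B: "\<And>t. t \<in> {0..2*pi} \<Longrightarrow> \<bar>u t\<bar> \<le> B"
    using bounded_on_interval[OF u] by blast
  have K: "continuous_on {0..2*pi} K"
    unfolding K_def using \<kappa>(1) by (rule indefinite_integral_continuous_real)
  have bound: "u t \<le> C * (\<Sum>i<n. K t ^ i / fact i) + B * (K t ^ n / fact n)" if "t \<in> {0..2*pi}" for n t
    using that
  proof (induction n arbitrary: t)
    case 0
    then show ?case using B[of t] by auto
  next
    case (Suc n)
    have cont: "continuous_on {0..2*pi} (\<lambda>x. C * (\<Sum>i<n. K x ^ i / fact i) + B * (K x ^ n / fact n))"
      using K by (intro continuous_on_add continuous_on_mult continuous_on_sum continuous_on_divide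
         continuous_on_power continuous_on_const) auto
    have i: "integrable (lebesgue_on {0..t}) (\<lambda>x. \<kappa> x * (K x ^ i / fact i))" for i
    proof (rule integrable_initial)
      show "integrable Leb (\<lambda>x. \<kappa> x * (K x ^ i / fact i))"
        using K \<kappa>(1) by (intro integrable_mult_continuous
         continuous_on_divide continuous_on_power continuous_on_const) auto
    qed (use Suc.prems in auto)
    have "integral\<^sup>L (lebesgue_on {0..t}) (\<lambda>x. \<kappa> x * u x) \<le>
      integral\<^sup>L (lebesgue_on {0..t}) (\<lambda>x. \<kappa> x * (C * (\<Sum>i<n. K x ^ i / fact i) + B * (K x ^ n / fact n)))"
      using Suc \<kappa> u cont by (intro integral_initial_mono integrable_mult_continuous mult_left_mono) auto
    also have "\<dots> = integral\<^sup>L (lebesgue_on {0..t})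
        (\<lambda>x. C * (\<Sum>i<n. \<kappa> x * (K x ^ i / fact i)) + B * (\<kappa> x * (K x ^ n / fact n)))"
      by (rule integral_initial_cong) (simp only: distrib_left sum_distrib_left mult_ac)
    also have "\<dots> = C * (\<Sum>i<n. K t ^ Suc i / fact (Suc i)) + B * (K t ^ Suc n / fact (Suc n))"
    proof -
      have "integral\<^sup>L M (\<lambda>x. C * (\<Sum>i<n. h i x) + B * h n x) =
          C * (\<Sum>i<n. integral\<^sup>L M (h i)) + B * integral\<^sup>L M (h n)"
        if "\<And>i. integrable M (h i)" for h :: "nat \<Rightarrow> real \<Rightarrow> real" and M
        using that by simp
      from this[OF i] show ?thesis
        unfolding K_def integral_power_fact[OF \<kappa>(1) Suc.prems] .
    qed
    finally have "u t \<le> C + C * (\<Sum>i<n. K t ^ Suc i / fact (Suc i)) + B * (K t ^ Suc n / fact (Suc n))"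
      using le[OF Suc.prems] by linarith
    moreover have "(\<Sum>i<Suc n. K t ^ i / fact i) = 1 + (\<Sum>i<n. K t ^ Suc i / fact (Suc i))"
      by (subst sum.lessThan_Suc_shift) simp
    ultimately show ?case
      by (simp add: distrib_left)
  qed
  have "(\<lambda>n. \<Sum>i<n. K t ^ i / fact i) \<longlonglongrightarrow> exp (K t)"
    using exp_converges[of "K t"] by (simp add: sums_def scaleR_conv_of_real field_simps)
  moreover have "(\<lambda>n. K t ^ n / fact n) \<longlonglongrightarrow> 0"
    using summable_LIMSEQ_zero[OF summable_exp[of "K t"]] by (simp add: field_simps)
  ultimately have "(\<lambda>n. C * (\<Sum>i<n. K t ^ i / fact i) + B * (K t ^ n / fact n)) \<longlonglongrightarrow> C * exp (K t) + B * 0"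
    by (intro tendsto_intros)
  then show ?thesis
    using bound[OF t] by (simp add: K_def LIMSEQ_le_const)
qed

section \<open>The second order linear equation with integrable coefficient\<close>

definition solves :: "(real \<Rightarrow> real) \<Rightarrow> (real \<Rightarrow> real) \<Rightarrow> (real \<Rightarrow> real) \<Rightarrow> bool" where
  "solves k y z \<longleftrightarrow> ac y z \<and> ac z (\<lambda>t. k t * y t)"

lemma solvesD:
  assumes "solves k y z"
  shows "ac y z" "ac z (\<lambda>t. k t * y t)" "continuous_on {0..2*pi} y" "continuous_on {0..2*pi} z"
  using assms ac_continuous unfolding solves_def by blast+

text \<open>\<open>rep_L2\<close> respects the vector space operations only almost everywhere, so
  passing from a potential to an explicit coefficient always changes it on a null set.\<close>

lemma solves_cong_AE:
  assumes s: "solves k y z" and eq: "AE t in Leb. k t = l t" and l: "integrable Leb l"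
  shows "solves l y z"
  unfolding solves_def
proof (rule conjI[OF solvesD(1)[OF s] acI])
  show int: "integrable Leb (\<lambda>t. l t * y t)"
    using l solvesD(3)[OF s] by (rule integrable_mult_continuous)
  fix x :: real assume x: "x \<in> {0..2*pi}"
  have "AE t in Leb. k t * y t = l t * y t"
    using eq by eventually_elim simp
  then have "integral\<^sup>L (lebesgue_on {0..x}) (\<lambda>t. k t * y t) = integral\<^sup>L (lebesgue_on {0..x}) (\<lambda>t. l t * y t)"
    using acD(1)[OF solvesD(2)[OF s]] int x by (intro integral_initial_cong_AE) auto
  then show "z x = z 0 + integral\<^sup>L (lebesgue_on {0..x}) (\<lambda>t. l t * y t)"
    using acD(2)[OF solvesD(2)[OF s] x] by simp
qed

lemma solves_lincomb:
  assumes "solves k y z" "solves k v w"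
  shows "solves k (\<lambda>t. a * y t + b * v t) (\<lambda>t. a * z t + b * w t)"
  using ac_add[OF ac_scale[OF solvesD(1)[OF assms(1)]] ac_scale[OF solvesD(1)[OF assms(2)]], of a b]
    ac_add[OF ac_scale[OF solvesD(2)[OF assms(1)]] ac_scale[OF solvesD(2)[OF assms(2)]], of a b]
  by (simp add: solves_def algebra_simps)

text \<open>Used twice: with equal coefficients it makes the determinant of a fundamental matrix
  constant, and with two coefficients from one line of potentials it gives the sign behind the
  monotonicity.\<close>

lemma wronskian:
  assumes y: "solves k y z" and v: "solves l v w"
  shows "ac (\<lambda>t. v t * z t - w t * y t) (\<lambda>t. (k t - l t) * v t * y t)"
  using ac_diff[OF ac_mult[OF solvesD(1)[OF v] solvesD(2)[OF y]] ac_mult[OF solvesD(2)[OF v] solvesD(1)[OF y]]]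
  by (simp add: algebra_simps)

text \<open>Gronwall for the sum of the two differences with weight 1 + |l|. Writing k y - l y' = (k
  - l) y + l (y - y') lets only \<open>y\<close> meet k - l, so an a priori bound on one of the two
  solutions suffices and the coefficients enter through their L1 distance.\<close>

lemma solves_close:
  fixes k l :: "real \<Rightarrow> real"
  assumes s: "solves k y z" and s': "solves l y' z'" and k: "integrable Leb k" and l: "integrable Leb l"
    and init: "y 0 = y' 0" "z 0 = z' 0"
    and B: "\<And>t. t \<in> {0..2*pi} \<Longrightarrow> \<bar>y t\<bar> \<le> B" and t: "t \<in> {0..2*pi}"
  shows "\<bar>y t - y' t\<bar> + \<bar>z t - z' t\<bar> \<le>
    B * (\<integral>x. \<bar>k x - l x\<bar> \<partial>Leb) * exp (2*pi + (\<integral>x. \<bar>l x\<bar> \<partial>Leb))"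
proof -
  define u where "u t = \<bar>y t - y' t\<bar> + \<bar>z t - z' t\<bar>" for t
  define D where "D = (\<integral>x. \<bar>k x - l x\<bar> \<partial>Leb)"
  note c = solvesD(3,4)[OF s] solvesD(3,4)[OF s']
  have \<kappa>: "integrable Leb (\<lambda>x. 1 + \<bar>l x\<bar>)"
    using l integrable_Leb_continuous[of "\<lambda>_. 1"] by (intro Bochner_Integration.integrable_add) auto
  have u: "continuous_on {0..2*pi} u"
    unfolding u_def using c by (intro continuous_on_add continuous_on_rabs continuous_on_diff)
  have B0: "B \<ge> 0"
    using B[OF t] by linarith
  have "u t \<le> B * D + integral\<^sup>L (lebesgue_on {0..t}) (\<lambda>x. (1 + \<bar>l x\<bar>) * u x)" if t: "t \<in> {0..2*pi}" for t
  proof -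
    have t': "t \<le> 2*pi" using t by simp
    have dy: "ac (\<lambda>t. y t - y' t) (\<lambda>t. z t - z' t)"
      using ac_diff[OF solvesD(1)[OF s] solvesD(1)[OF s']] .
    have dz: "ac (\<lambda>t. z t - z' t) (\<lambda>t. k t * y t - l t * y' t)"
      using ac_diff[OF solvesD(2)[OF s] solvesD(2)[OF s']] .
    have i1: "integrable Leb (\<lambda>x. \<bar>z x - z' x\<bar>)"
      using c by (intro integrable_Leb_continuous continuous_on_rabs continuous_on_diff)
    have i2: "integrable Leb (\<lambda>x. B * \<bar>k x - l x\<bar>)"
      using k l by simp
    have i3: "integrable Leb (\<lambda>x. \<bar>l x\<bar> * \<bar>y x - y' x\<bar>)"
      using c l by (intro integrable_mult_continuous continuous_on_rabs continuous_on_diff) auto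
    have i4: "integrable Leb (\<lambda>x. (1 + \<bar>l x\<bar>) * u x)"
      using \<kappa> u by (rule integrable_mult_continuous)
    have "\<bar>y t - y' t\<bar> \<le> integral\<^sup>L (lebesgue_on {0..t}) (\<lambda>x. \<bar>z x - z' x\<bar>)"
      using acD(2)[OF dy t] init abs_integral_initial_le[OF acD(1)[OF dy] i1 t'] by simp
    moreover have "\<bar>z t - z' t\<bar> \<le> integral\<^sup>L (lebesgue_on {0..t}) (\<lambda>x. B * \<bar>k x - l x\<bar> + \<bar>l x\<bar> * \<bar>y x - y' x\<bar>)"
    proof -
      have "\<bar>k x * y x - l x * y' x\<bar> \<le> B * \<bar>k x - l x\<bar> + \<bar>l x\<bar> * \<bar>y x - y' x\<bar>" if "x \<in> {0..t}" for x
      proof -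
        have "k x * y x - l x * y' x = (k x - l x) * y x + l x * (y x - y' x)"
          by (simp add: algebra_simps)
        then have "\<bar>k x * y x - l x * y' x\<bar> \<le> \<bar>k x - l x\<bar> * \<bar>y x\<bar> + \<bar>l x\<bar> * \<bar>y x - y' x\<bar>"
          using abs_triangle_ineq[of "(k x - l x) * y x" "l x * (y x - y' x)"] by (simp add: abs_mult)
        moreover have "\<bar>k x - l x\<bar> * \<bar>y x\<bar> \<le> \<bar>k x - l x\<bar> * B"
          using B[of x] that t by (intro mult_left_mono) auto
        ultimately show ?thesis
          by (simp add: mult.commute)
      qed
      then have "\<bar>integral\<^sup>L (lebesgue_on {0..t}) (\<lambda>x. k x * y x - l x * y' x)\<bar> \<le>
          integral\<^sup>L (lebesgue_on {0..t}) (\<lambda>x. B * \<bar>k x - l x\<bar> + \<bar>l x\<bar> * \<bar>y x - y' x\<bar>)"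
        using abs_integral_initial_le[OF acD(1)[OF dz] Bochner_Integration.integrable_add[OF i2 i3] t'] by simp
      then show ?thesis
        using acD(2)[OF dz t] init by simp
    qed
    moreover have "integral\<^sup>L (lebesgue_on {0..t}) (\<lambda>x. B * \<bar>k x - l x\<bar> + \<bar>l x\<bar> * \<bar>y x - y' x\<bar>)
        = integral\<^sup>L (lebesgue_on {0..t}) (\<lambda>x. B * \<bar>k x - l x\<bar>) +
          integral\<^sup>L (lebesgue_on {0..t}) (\<lambda>x. \<bar>l x\<bar> * \<bar>y x - y' x\<bar>)"
      using integrable_initial[OF i2 t'] integrable_initial[OF i3 t']
      by (rule Bochner_Integration.integral_add)
    moreover have "integral\<^sup>L (lebesgue_on {0..t}) (\<lambda>x. B * \<bar>k x - l x\<bar>) \<le> B * D"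
      using integral_initial_le_Leb[OF i2 t'] B0 by (simp add: D_def)
    moreover have "integral\<^sup>L (lebesgue_on {0..t}) (\<lambda>x. \<bar>z x - z' x\<bar>) + integral\<^sup>L (lebesgue_on {0..t}) (\<lambda>x. \<bar>l x\<bar> * \<bar>y x - y' x\<bar>)
       \<le> integral\<^sup>L (lebesgue_on {0..t}) (\<lambda>x. (1 + \<bar>l x\<bar>) * u x)"
    proof -
      have "integral\<^sup>L (lebesgue_on {0..t}) (\<lambda>x. \<bar>z x - z' x\<bar> + \<bar>l x\<bar> * \<bar>y x - y' x\<bar>)
         \<le> integral\<^sup>L (lebesgue_on {0..t}) (\<lambda>x. (1 + \<bar>l x\<bar>) * u x)"
        using i4 Bochner_Integration.integrable_add[OF i1 i3] t'
        by (intro integral_initial_mono) (auto simp: u_def algebra_simps)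
      then show ?thesis
        by (simp add: Bochner_Integration.integral_add[OF integrable_initial[OF i1 t'] integrable_initial[OF i3 t']])
    qed
    ultimately show ?thesis
      unfolding u_def by linarith
  qed
  then have "u t \<le> B * D * exp (integral\<^sup>L (lebesgue_on {0..t}) (\<lambda>x. 1 + \<bar>l x\<bar>))"
    by (intro gronwall[OF \<kappa> _ u _ t]) auto
  also have "\<dots> \<le> B * D * exp (2*pi + (\<integral>x. \<bar>l x\<bar> \<partial>Leb))"
  proof -
    have "integral\<^sup>L (lebesgue_on {0..t}) (\<lambda>x. 1 + \<bar>l x\<bar>) \<le> (\<integral>x. 1 + \<bar>l x\<bar> \<partial>Leb)"
      using \<kappa> t by (intro integral_initial_le_Leb) auto
    also have "\<dots> = 2*pi + (\<integral>x. \<bar>l x\<bar> \<partial>Leb)"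
      using l integrable_Leb_continuous[of "\<lambda>_. 1"]
      by (subst Bochner_Integration.integral_add) (auto simp: measure_restrict_space)
    finally show ?thesis
      using B0 by (intro mult_left_mono) (auto simp: D_def)
  qed
  finally show ?thesis
    by (simp add: u_def D_def)
qed

lemma solves_unique:
  fixes k :: "real \<Rightarrow> real"
  assumes s: "solves k y z" and s': "solves k y' z'" and k: "integrable Leb k"
    and init: "y 0 = y' 0" "z 0 = z' 0" and t: "t \<in> {0..2*pi}"
  shows "y t = y' t" "z t = z' t"
proof -
  obtain B where "\<And>t. t \<in> {0..2*pi} \<Longrightarrow> \<bar>y t\<bar> \<le> B"
    using bounded_on_interval[OF solvesD(3)[OF s]] by blast
  from solves_close[OF s s' k k init this t] show "y t = y' t" "z t = z' t"
    by auto
qed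

text \<open>These are the increments of Picard iteration, not the iterates: by linearity the
  solution is the sum of the iterated integrals of the initial values.\<close>

fun picard :: "(real \<Rightarrow> real) \<Rightarrow> real \<Rightarrow> real \<Rightarrow> nat \<Rightarrow> (real \<Rightarrow> real) \<times> (real \<Rightarrow> real)" where
  "picard k a b 0 = ((\<lambda>_. a), (\<lambda>_. b))"
| "picard k a b (Suc n) = ((\<lambda>t. integral\<^sup>L (lebesgue_on {0..t}) (snd (picard k a b n))),
     (\<lambda>t. integral\<^sup>L (lebesgue_on {0..t}) (\<lambda>x. k x * fst (picard k a b n) x)))"

lemma picard_continuous:
  assumes "integrable Leb k"
  shows "continuous_on {0..2*pi} (fst (picard k a b n)) \<and> continuous_on {0..2*pi} (snd (picard k a b n))"
proof (induction n)
  case (Suc n)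
  show ?case
    using indefinite_integral_continuous_real[OF integrable_Leb_continuous[OF conjunct2[OF Suc]]]
      indefinite_integral_continuous_real[OF integrable_mult_continuous[OF assms conjunct1[OF Suc]]]
    by simp
qed auto

text \<open>The weight 1 + |k| dominates both right-hand sides, 1 in the equation for y and |k| in
  the one for z, so one bound covers both components.\<close>

lemma picard_bound:
  assumes k: "integrable Leb k" and t: "t \<in> {0..2*pi}"
  defines "K \<equiv> \<lambda>t. integral\<^sup>L (lebesgue_on {0..t}) (\<lambda>x. 1 + \<bar>k x\<bar>)"
  shows "\<bar>fst (picard k a b n) t\<bar> \<le> (\<bar>a\<bar> + \<bar>b\<bar>) * (K t ^ n / fact n) \<and>
     \<bar>snd (picard k a b n) t\<bar> \<le> (\<bar>a\<bar> + \<bar>b\<bar>) * (K t ^ n / fact n)"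
  using t
proof (induction n arbitrary: t)
  case (Suc n)
  have \<kappa>: "integrable Leb (\<lambda>x. 1 + \<bar>k x\<bar>)"
    using k integrable_Leb_continuous[of "\<lambda>_. 1"] by (intro Bochner_Integration.integrable_add) auto
  have "continuous_on {0..2*pi} (\<lambda>x. (\<bar>a\<bar> + \<bar>b\<bar>) * (K x ^ n / fact n))"
    unfolding K_def using indefinite_integral_continuous_real[OF \<kappa>]
    by (intro continuous_on_mult continuous_on_divide continuous_on_power continuous_on_const) auto
  note int = integrable_mult_continuous[OF \<kappa> this]
  have t: "t \<le> 2*pi" using Suc.prems by simp
  have K0: "K x \<ge> 0" for x
    unfolding K_def by (intro integral_nonneg_AE) auto
  have eq: "integral\<^sup>L (lebesgue_on {0..t}) (\<lambda>x. (1 + \<bar>k x\<bar>) * ((\<bar>a\<bar> + \<bar>b\<bar>) * (K x ^ n / fact n)))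
     = (\<bar>a\<bar> + \<bar>b\<bar>) * (K t ^ Suc n / fact (Suc n))"
  proof -
    have "integral\<^sup>L (lebesgue_on {0..t}) (\<lambda>x. (1 + \<bar>k x\<bar>) * ((\<bar>a\<bar> + \<bar>b\<bar>) * (K x ^ n / fact n)))
      = integral\<^sup>L (lebesgue_on {0..t}) (\<lambda>x. (\<bar>a\<bar> + \<bar>b\<bar>) * ((1 + \<bar>k x\<bar>) * (K x ^ n / fact n)))"
      by (rule integral_initial_cong) (simp only: mult.left_commute)
    also have "\<dots> = (\<bar>a\<bar> + \<bar>b\<bar>) * integral\<^sup>L (lebesgue_on {0..t}) (\<lambda>x. (1 + \<bar>k x\<bar>) * (K x ^ n / fact n))"
      by (rule integral_mult_right_zero)
    finally show ?thesis
      unfolding K_def integral_power_fact[OF \<kappa> Suc.prems] .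
  qed
  have "\<bar>integral\<^sup>L (lebesgue_on {0..t}) (snd (picard k a b n))\<bar> \<le> integral\<^sup>L (lebesgue_on {0..t}) (\<lambda>x. (1 + \<bar>k x\<bar>) * ((\<bar>a\<bar> + \<bar>b\<bar>) * (K x ^ n / fact n)))"
  proof (rule abs_integral_initial_le[OF _ int t])
    show "integrable Leb (snd (picard k a b n))"
      using picard_continuous[OF k] integrable_Leb_continuous by blast
    fix x assume "x \<in> {0..t}"
    then have *: "\<bar>snd (picard k a b n) x\<bar> \<le> (\<bar>a\<bar> + \<bar>b\<bar>) * (K x ^ n / fact n)"
      using Suc.IH[of x] t by auto
    moreover have "0 \<le> \<bar>k x\<bar> * ((\<bar>a\<bar> + \<bar>b\<bar>) * (K x ^ n / fact n))"
      using K0 by simp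
    ultimately show "\<bar>snd (picard k a b n) x\<bar> \<le> (1 + \<bar>k x\<bar>) * ((\<bar>a\<bar> + \<bar>b\<bar>) * (K x ^ n / fact n))"
      unfolding distrib_right[of 1] by linarith
  qed
  moreover have "\<bar>integral\<^sup>L (lebesgue_on {0..t}) (\<lambda>x. k x * fst (picard k a b n) x)\<bar> \<le> integral\<^sup>L (lebesgue_on {0..t}) (\<lambda>x. (1 + \<bar>k x\<bar>) * ((\<bar>a\<bar> + \<bar>b\<bar>) * (K x ^ n / fact n)))"
  proof (rule abs_integral_initial_le[OF _ int t])
    show "integrable Leb (\<lambda>x. k x * fst (picard k a b n) x)"
      using picard_continuous[OF k] integrable_mult_continuous[OF k] by blast
    fix x assume "x \<in> {0..t}"
    then have *: "\<bar>fst (picard k a b n) x\<bar> \<le> (\<bar>a\<bar> + \<bar>b\<bar>) * (K x ^ n / fact n)"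
      using Suc.IH[of x] t by auto
    then have "\<bar>k x * fst (picard k a b n) x\<bar> \<le> \<bar>k x\<bar> * ((\<bar>a\<bar> + \<bar>b\<bar>) * (K x ^ n / fact n))"
      unfolding abs_mult by (rule mult_left_mono) simp
    moreover have "0 \<le> (\<bar>a\<bar> + \<bar>b\<bar>) * (K x ^ n / fact n)"
      using * by linarith
    ultimately show "\<bar>k x * fst (picard k a b n) x\<bar> \<le> (1 + \<bar>k x\<bar>) * ((\<bar>a\<bar> + \<bar>b\<bar>) * (K x ^ n / fact n))"
      unfolding distrib_right[of 1] by linarith
  qed
  ultimately show ?case
    unfolding eq by simp
qed auto

text \<open>The bound does not depend on N or t and becomes the dominating function when the partial
  sums pass to the limit under the integral.\<close>

lemma picard_partial_bound:
  fixes a b :: real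
  assumes k: "integrable Leb k" and t: "t \<in> {0..2*pi}"
  defines "C \<equiv> (\<bar>a\<bar> + \<bar>b\<bar>) * exp (\<integral>x. 1 + \<bar>k x\<bar> \<partial>Leb)"
  shows "summable (\<lambda>n. fst (picard k a b n) t)" "summable (\<lambda>n. snd (picard k a b n) t)"
    "\<bar>\<Sum>n<N. fst (picard k a b n) t\<bar> \<le> C" "\<bar>\<Sum>n<N. snd (picard k a b n) t\<bar> \<le> C"
proof -
  define K where "K = integral\<^sup>L (lebesgue_on {0..t}) (\<lambda>x. 1 + \<bar>k x\<bar>)"
  have \<kappa>: "integrable Leb (\<lambda>x. 1 + \<bar>k x\<bar>)"
    using k integrable_Leb_continuous[of "\<lambda>_. 1"] by (intro Bochner_Integration.integrable_add) auto
  have K: "0 \<le> K" "K \<le> (\<integral>x. 1 + \<bar>k x\<bar> \<partial>Leb)"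
    using integral_initial_le_Leb[OF \<kappa>] t unfolding K_def by (auto intro!: integral_nonneg_AE)
  have sums: "(\<lambda>n. (\<bar>a\<bar> + \<bar>b\<bar>) * (K ^ n / fact n)) sums ((\<bar>a\<bar> + \<bar>b\<bar>) * exp K)"
    using exp_converges[of K] by (intro sums_mult) (simp add: scaleR_conv_of_real field_simps)
  have main: "summable f \<and> \<bar>\<Sum>n<N. f n\<bar> \<le> C" if f: "\<And>n. \<bar>f n\<bar> \<le> (\<bar>a\<bar> + \<bar>b\<bar>) * (K ^ n / fact n)" for f :: "nat \<Rightarrow> real"
  proof
    show "summable f"
      using f by (intro summable_comparison_test[OF _ sums_summable[OF sums]]) auto
    have "\<bar>\<Sum>n<N. f n\<bar> \<le> (\<Sum>n<N. \<bar>f n\<bar>)"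
      by (rule sum_abs)
    also have "\<dots> \<le> (\<Sum>n<N. (\<bar>a\<bar> + \<bar>b\<bar>) * (K ^ n / fact n))"
      using f by (rule sum_mono)
    also have "\<dots> \<le> (\<bar>a\<bar> + \<bar>b\<bar>) * exp K"
      using sum_le_suminf[OF sums_summable[OF sums], of "{..<N}"] sums_unique[OF sums] K(1) by simp
    also have "\<dots> \<le> C"
      unfolding C_def using K(2) by (intro mult_left_mono) auto
    finally show "\<bar>\<Sum>n<N. f n\<bar> \<le> C" .
  qed
  note pbK = picard_bound[OF k t, of a b, folded K_def]
  show "summable (\<lambda>n. fst (picard k a b n) t)" "summable (\<lambda>n. snd (picard k a b n) t)"
    "\<bar>\<Sum>n<N. fst (picard k a b n) t\<bar> \<le> C" "\<bar>\<Sum>n<N. snd (picard k a b n) t\<bar> \<le> C"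
    using main[OF conjunct1[OF pbK]] main[OF conjunct2[OF pbK]] by blast+
qed

text \<open>The shift of \<open>f (Suc n)\<close> against \<open>g n\<close> is that of partial
  sums: integrating n increments and adding the initial value gives n + 1 of them. Dominated
  convergence carries the integral equation to the limit.\<close>

lemma ac_limit:
  fixes f g :: "nat \<Rightarrow> real \<Rightarrow> real"
  assumes g: "\<And>n. integrable Leb (g n)"
    and f: "\<And>n x. x \<in> {0..2*pi} \<Longrightarrow> f (Suc n) x = c + integral\<^sup>L (lebesgue_on {0..x}) (g n)"
    and fl: "\<And>x. x \<in> {0..2*pi} \<Longrightarrow> (\<lambda>n. f n x) \<longlonglongrightarrow> f' x"
    and gl: "\<And>x. x \<in> {0..2*pi} \<Longrightarrow> (\<lambda>n. g n x) \<longlonglongrightarrow> g' x"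
    and h: "integrable Leb h" "\<And>n x. x \<in> {0..2*pi} \<Longrightarrow> \<bar>g n x\<bar> \<le> h x"
  shows "ac f' g' \<and> f' 0 = c"
proof -
  have meas: "g' \<in> borel_measurable Leb"
  proof (rule borel_measurable_LIMSEQ_real)
    show "(\<lambda>n. g n x) \<longlonglongrightarrow> g' x" if "x \<in> space Leb" for x
      using gl that by simp
    show "g n \<in> borel_measurable Leb" for n
      using g by (rule borel_measurable_integrable)
  qed
  have g': "integrable Leb g'"
  proof (rule integrable_dominated_convergence[OF meas _ h(1)])
    show "g n \<in> borel_measurable Leb" for n
      using g by (rule borel_measurable_integrable)
    show "AE x in Leb. (\<lambda>n. g n x) \<longlonglongrightarrow> g' x"
      using gl by (rule AE_on_intervalI)
    show "AE x in Leb. norm (g n x) \<le> h x" for n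
      using h(2) by (intro AE_on_intervalI) simp
  qed
  have eq: "f' x = c + integral\<^sup>L (lebesgue_on {0..x}) g'" if x: "x \<in> {0..2*pi}" for x
  proof -
    have "(\<lambda>n. integral\<^sup>L (lebesgue_on {0..x}) (g n)) \<longlonglongrightarrow> integral\<^sup>L (lebesgue_on {0..x}) g'"
    proof (rule integral_dominated_convergence)
      show "integrable (lebesgue_on {0..x}) h"
        using integrable_initial[OF h(1), of x] x by auto
      show "g' \<in> borel_measurable (lebesgue_on {0..x})" "g n \<in> borel_measurable (lebesgue_on {0..x})" for n
        using integrable_initial[OF g', of x] integrable_initial[OF g, of x] x by auto
      show "AE t in lebesgue_on {0..x}. (\<lambda>n. g n t) \<longlonglongrightarrow> g' t"
        using gl x by (intro AE_on_intervalI) auto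
      show "AE t in lebesgue_on {0..x}. norm (g n t) \<le> h t" for n
        using h(2) x by (intro AE_on_intervalI) auto
    qed
    then have "(\<lambda>n. f (Suc n) x) \<longlonglongrightarrow> c + integral\<^sup>L (lebesgue_on {0..x}) g'"
      unfolding f[OF x] by (intro tendsto_intros)
    then show ?thesis
      using LIMSEQ_Suc[OF fl[OF x]] LIMSEQ_unique by blast
  qed
  then have "f' 0 = c"
    by (simp add: integral_initial_0 del: atLeastAtMost_singleton)
  with acI[OF g'] eq show ?thesis
    by simp
qed

lemma solves_exists:
  fixes k :: "real \<Rightarrow> real"
  assumes k: "integrable Leb k"
  obtains y z where "solves k y z" "y 0 = a" "z 0 = b"
proof -
  define Y where "Y N t = (\<Sum>n<N. fst (picard k a b n) t)" for N t
  define Z where "Z N t = (\<Sum>n<N. snd (picard k a b n) t)" for N t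
  define y where "y t = (\<Sum>n. fst (picard k a b n) t)" for t
  define z where "z t = (\<Sum>n. snd (picard k a b n) t)" for t
  define C where "C = (\<bar>a\<bar> + \<bar>b\<bar>) * exp (\<integral>x. 1 + \<bar>k x\<bar> \<partial>Leb)"
  note pb = picard_partial_bound[OF k, where a=a and b=b, folded C_def]
  have lim: "(\<lambda>N. Y N t) \<longlonglongrightarrow> y t" "(\<lambda>N. Z N t) \<longlonglongrightarrow> z t" if "t \<in> {0..2*pi}" for t
    using pb(1,2)[OF that] unfolding Y_def Z_def y_def z_def by (auto intro: summable_LIMSEQ)
  have cont: "continuous_on {0..2*pi} (fst (picard k a b n))" "continuous_on {0..2*pi} (snd (picard k a b n))" for n
    using picard_continuous[OF k] by auto
  have cY: "continuous_on {0..2*pi} (Y n)" "continuous_on {0..2*pi} (Z n)" for n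
    unfolding Y_def Z_def using cont by (auto intro: continuous_on_sum)
  have 1: "ac y z \<and> y 0 = a"
  proof (rule ac_limit)
    show "integrable Leb (Z n)" for n
      using cY by (intro integrable_Leb_continuous)
    show "Y (Suc n) x = a + integral\<^sup>L (lebesgue_on {0..x}) (Z n)" if "x \<in> {0..2*pi}" for n x
    proof -
      have "integral\<^sup>L (lebesgue_on {0..x}) (Z n) = (\<Sum>i<n. integral\<^sup>L (lebesgue_on {0..x}) (snd (picard k a b i)))"
        unfolding Z_def using integrable_initial[OF integrable_Leb_continuous[OF cont(2)], of x] that
        by (intro Bochner_Integration.integral_sum) auto
      then show ?thesis
        unfolding Y_def by (subst sum.lessThan_Suc_shift) simp
    qed
    show "integrable Leb (\<lambda>_. C)"
      by (intro integrable_Leb_continuous) auto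
  qed (use lim pb in \<open>auto simp: Z_def\<close>)
  have 2: "ac z (\<lambda>t. k t * y t) \<and> z 0 = b"
  proof (rule ac_limit)
    show i: "integrable Leb (\<lambda>t. k t * Y n t)" for n
      using cY k by (intro integrable_mult_continuous)
    show "Z (Suc n) x = b + integral\<^sup>L (lebesgue_on {0..x}) (\<lambda>t. k t * Y n t)" if "x \<in> {0..2*pi}" for n x
    proof -
      have "integral\<^sup>L (lebesgue_on {0..x}) (\<lambda>t. k t * Y n t) = integral\<^sup>L (lebesgue_on {0..x}) (\<lambda>t. \<Sum>i<n. k t * fst (picard k a b i) t)"
        unfolding Y_def by (simp add: sum_distrib_left)
      also have "\<dots> = (\<Sum>i<n. integral\<^sup>L (lebesgue_on {0..x}) (\<lambda>t. k t * fst (picard k a b i) t))"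
        using integrable_initial[OF integrable_mult_continuous[OF k cont(1)], of x] that
        by (intro Bochner_Integration.integral_sum) auto
      finally show ?thesis
        unfolding Z_def by (subst sum.lessThan_Suc_shift) simp
    qed
    show "integrable Leb (\<lambda>t. \<bar>k t\<bar> * C)"
      using k by simp
    show "(\<lambda>n. k x * Y n x) \<longlonglongrightarrow> k x * y x" if "x \<in> {0..2*pi}" for x
      using lim(1)[OF that] by (intro tendsto_intros)
    show "\<bar>k x * Y n x\<bar> \<le> \<bar>k x\<bar> * C" if "x \<in> {0..2*pi}" for n x
      using pb(3)[OF that] unfolding Y_def abs_mult by (intro mult_left_mono) auto
  qed (use lim in auto)
  show ?thesis
    using that 1 2 by (auto simp: solves_def)
qed

section \<open>Displacement of directions by matrices of determinant one\<close>

lemma mat2_nth [simp]: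
  "mat2 a b c d $ 1 $ 1 = a" "mat2 a b c d $ 1 $ 2 = b"
  "mat2 a b c d $ 2 $ 1 = c" "mat2 a b c d $ 2 $ 2 = d"
  by (simp_all add: mat2_def)

lemma mat2_eqI:
  fixes A B :: "real^2^2"
  assumes "A $ 1 $ 1 = B $ 1 $ 1" "A $ 1 $ 2 = B $ 1 $ 2" "A $ 2 $ 1 = B $ 2 $ 1" "A $ 2 $ 2 = B $ 2 $ 2"
  shows "A = B"
  using assms by (simp add: vec_eq_iff forall_2)

lemma mat2_mult: "mat2 a b c d ** mat2 a' b' c' d' =
    mat2 (a*a' + b*c') (a*b' + b*d') (c*a' + d*c') (c*b' + d*d')"
  by (rule mat2_eqI) (simp_all add: matrix_matrix_mult_def sum_2)

lemma mat_1_mat2: "(mat 1 :: real^2^2) = mat2 1 0 0 1"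
  by (rule mat2_eqI) (simp_all add: mat_def)

lemma trace_2: "trace (A :: real^2^2) = A $ 1 $ 1 + A $ 2 $ 2"
  by (simp add: trace_def sum_2)

lemma SL2_iff: "A \<in> SL2 \<longleftrightarrow> A $ 1 $ 1 * A $ 2 $ 2 - A $ 1 $ 2 * A $ 2 $ 1 = 1"
  by (simp add: SL2_def det_2)

lemma continuous_on_mat2:
  fixes a b c d :: "'a::topological_space \<Rightarrow> real"
  assumes "continuous_on S a" "continuous_on S b" "continuous_on S c" "continuous_on S d"
  shows "continuous_on S (\<lambda>x. mat2 (a x) (b x) (c x) (d x))"
proof -
  have *: "mat2 a b c d = (\<chi> i j. if i = 1 then if j = 1 then a else b else if j = 1 then c else d)" for a b c d
    by (rule mat2_eqI) simp_all
  show ?thesis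
    unfolding *
  proof (intro continuous_on_vec_lambda)
    fix i j :: 2
    show "continuous_on S (\<lambda>x. if i = 1 then if j = 1 then a x else b x else if j = 1 then c x else d x)"
      using assms by (cases "i = 1"; cases "j = 1") simp_all
  qed
qed

text \<open>A 2x2 matrix is a conformal matrix plus a trace-free symmetric one. \<open>trace\<close>
  and \<open>skew\<close> are twice the coordinates of the conformal part, on which rotations act as
  on a complex number.\<close>

definition skew :: "real^2^2 \<Rightarrow> real" where
  "skew A = A $ 1 $ 2 - A $ 2 $ 1"

text \<open>The modulus of the conformal part; on \<open>SL2\<close> it is cosh r in the Cartan
  decomposition.\<close>

definition half_norm :: "real^2^2 \<Rightarrow> real" where
  "half_norm A = sqrt ((trace A)\<^sup>2 + (skew A)\<^sup>2) / 2"

text \<open>The Cartan decomposition with \<open>p\<close> and \<open>r\<close> equal to sinh of the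
  Cartan radius times cosine and sine of \<eta>. Unlike radius and angle they are regular where the
  symmetric factor is the identity; the letter \<open>r\<close> is not the radius.\<close>

definition polar :: "real^2^2 \<Rightarrow> real \<Rightarrow> real \<Rightarrow> real \<Rightarrow> bool" where
  "polar A \<alpha> p r \<longleftrightarrow>
     A = mat2 (cos \<alpha>) (sin \<alpha>) (- sin \<alpha>) (cos \<alpha>) ** mat2 (half_norm A + p) r r (half_norm A - p) \<and>
     (half_norm A)\<^sup>2 = 1 + p\<^sup>2 + r\<^sup>2"

text \<open>\<alpha> is any argument of the complex number with real part \<open>trace A\<close> and
  imaginary part \<open>skew A\<close>; on the universal cover a branch is chosen
  continuously.\<close>

definition angle_of :: "real^2^2 \<Rightarrow> real \<Rightarrow> bool" where
  "angle_of A \<alpha> \<longleftrightarrow> trace A = 2 * half_norm A * cos \<alpha> \<and> skew A = 2 * half_norm A * sin \<alpha>"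

lemma half_norm_ge_1:
  assumes "A \<in> SL2"
  shows "1 \<le> half_norm A"
proof -
  have "(trace A)\<^sup>2 + (skew A)\<^sup>2 = (A$1$1 - A$2$2)\<^sup>2 + (A$1$2 + A$2$1)\<^sup>2 + 4 * (A$1$1 * A$2$2 - A$1$2 * A$2$1)"
    by (simp add: trace_2 skew_def power2_eq_square algebra_simps)
  also have "\<dots> \<ge> 4"
    using assms by (simp add: SL2_iff)
  finally have "2 \<le> sqrt ((trace A)\<^sup>2 + (skew A)\<^sup>2)"
    by (intro real_le_rsqrt) simp
  then show ?thesis
    by (simp add: half_norm_def)
qed

text \<open>Rotating A back by the argument of its conformal part makes that part real, so the rest
  is symmetric: \<open>p\<close> is half the difference of its diagonal entries and \<open>r\<close>
  its off-diagonal entry. Determinant one becomes the relation between \<open>half_norm A\<close>,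
  \<open>p\<close> and \<open>r\<close>.\<close>

lemma angle_of_polar:
  assumes A: "A \<in> SL2" and a: "angle_of A \<alpha>"
  defines "p \<equiv> (cos \<alpha> * (A$1$1 - A$2$2) - sin \<alpha> * (A$1$2 + A$2$1)) / 2"
    and "r \<equiv> cos \<alpha> * A$1$2 - sin \<alpha> * A$2$2"
  shows "polar A \<alpha> p r"
proof -
  define C where "C = half_norm A"
  have *: "A$1$1 + A$2$2 = 2 * C * cos \<alpha>" "A$1$2 - A$2$1 = 2 * C * sin \<alpha>"
    using a by (auto simp: angle_of_def trace_2 skew_def C_def)
  define s where "s = sin \<alpha>"
  define c where "c = cos \<alpha>"
  have cs: "c * c + s * s = 1"
    unfolding c_def s_def by (simp add: power2_eq_square[symmetric])
  define a b x d where "a = A$1$1" and "b = A$1$2" and "x = A$2$1" and "d = A$2$2"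
  note defs = s_def[symmetric] c_def[symmetric] a_def[symmetric] b_def[symmetric] x_def[symmetric] d_def[symmetric]
  have t: "a + d = 2 * C * c" "b - x = 2 * C * s"
    using * by (simp_all add: defs)
  have det: "a * d - b * x = 1"
    using A by (simp add: SL2_iff defs)
  have p: "p = (c * (a - d) - s * (b + x)) / 2" and r: "r = c * b - s * d"
    unfolding p_def r_def defs by simp_all
  have C': "C = (c * (a + d) + s * (b - x)) / 2"
    unfolding t using cs by (simp add: algebra_simps) algebra
  have r': "r = s * a + c * x"
    unfolding r using t cs by algebra
  have Cp: "C + p = c * a - s * x" "C - p = s * b + c * d"
    unfolding C' p by (simp_all add: field_simps)
  have "A = mat2 c s (- s) c ** mat2 (C + p) r r (C - p)"
  proof (rule mat2_eqI)
    have "c * (c * a - s * x) + s * (s * a + c * x) = a" using cs by algebra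
    then show "A$1$1 = (mat2 c s (- s) c ** mat2 (C + p) r r (C - p))$1$1"
      by (simp add: mat2_mult Cp r' defs)
    have "c * (c * b - s * d) + s * (s * b + c * d) = b" using cs by algebra
    then show "A$1$2 = (mat2 c s (- s) c ** mat2 (C + p) r r (C - p))$1$2"
      by (simp add: mat2_mult Cp r defs)
    have "(- s) * (c * a - s * x) + c * (s * a + c * x) = x" using cs by algebra
    then show "A$2$1 = (mat2 c s (- s) c ** mat2 (C + p) r r (C - p))$2$1"
      by (simp add: mat2_mult Cp r' defs)
    have "(- s) * (c * b - s * d) + c * (s * b + c * d) = d" using cs by algebra
    then show "A$2$2 = (mat2 c s (- s) c ** mat2 (C + p) r r (C - p))$2$2"
      by (simp add: mat2_mult Cp r defs)
  qed
  moreover have "C\<^sup>2 = 1 + p\<^sup>2 + r\<^sup>2"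
  proof -
    have "(C + p) * (C - p) - r * r = (c * c + s * s) * (a * d - b * x)"
    proof -
      have "(C + p) * (C - p) - r * r = (c * a - s * x) * (s * b + c * d) - (c * b - s * d) * (s * a + c * x)"
        unfolding Cp using r r' by metis
      then show ?thesis by algebra
    qed
    then show ?thesis
      unfolding cs det by (simp add: power2_eq_square algebra_simps)
  qed
  ultimately show ?thesis
    unfolding polar_def C_def[symmetric] c_def[symmetric] s_def[symmetric] by blast
qed

lemma polar_entries:
  assumes "polar A \<alpha> p r"
  shows "A$1$1 = cos \<alpha> * (half_norm A + p) + sin \<alpha> * r"
    "A$1$2 = cos \<alpha> * r + sin \<alpha> * (half_norm A - p)"
    "A$2$1 = - sin \<alpha> * (half_norm A + p) + cos \<alpha> * r"
    "A$2$2 = - sin \<alpha> * r + cos \<alpha> * (half_norm A - p)"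
    "(half_norm A)\<^sup>2 = 1 + p\<^sup>2 + r\<^sup>2"
proof -
  define C where "C = half_norm A"
  have *: "A = mat2 (cos \<alpha>) (sin \<alpha>) (- sin \<alpha>) (cos \<alpha>) ** mat2 (C + p) r r (C - p)"
    and 5: "C\<^sup>2 = 1 + p\<^sup>2 + r\<^sup>2"
    using assms unfolding polar_def C_def by auto
  show "A$1$1 = cos \<alpha> * (half_norm A + p) + sin \<alpha> * r"
    "A$1$2 = cos \<alpha> * r + sin \<alpha> * (half_norm A - p)"
    "A$2$1 = - sin \<alpha> * (half_norm A + p) + cos \<alpha> * r"
    "A$2$2 = - sin \<alpha> * r + cos \<alpha> * (half_norm A - p)"
    "(half_norm A)\<^sup>2 = 1 + p\<^sup>2 + r\<^sup>2"
    unfolding C_def[symmetric] using 5 arg_cong[OF *, of "\<lambda>X. X$1$1"] arg_cong[OF *, of "\<lambda>X. X$1$2"]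
      arg_cong[OF *, of "\<lambda>X. X$2$1"] arg_cong[OF *, of "\<lambda>X. X$2$2"] by (simp_all add: mat2_mult)
qed

lemma polarI:
  assumes A: "A = mat2 (cos \<alpha>) (sin \<alpha>) (- sin \<alpha>) (cos \<alpha>) ** mat2 (C + p) r r (C - p)"
    and C: "C\<^sup>2 = 1 + p\<^sup>2 + r\<^sup>2" "0 \<le> C"
  shows "A \<in> SL2" "half_norm A = C" "angle_of A \<alpha>" "polar A \<alpha> p r"
proof -
  have e: "A = mat2 (cos \<alpha> * (C + p) + sin \<alpha> * r) (cos \<alpha> * r + sin \<alpha> * (C - p))
     (- sin \<alpha> * (C + p) + cos \<alpha> * r) (- sin \<alpha> * r + cos \<alpha> * (C - p))"
    unfolding A by (simp add: mat2_mult)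
  have cs: "cos \<alpha> * cos \<alpha> + sin \<alpha> * sin \<alpha> = 1"
    by (simp add: power2_eq_square[symmetric])
  have C1: "C * C = 1 + p * p + r * r"
    using C by (simp add: power2_eq_square)
  show "A \<in> SL2"
    unfolding SL2_iff e mat2_nth using cs C1 by algebra
  have t: "trace A = 2 * C * cos \<alpha>" "skew A = 2 * C * sin \<alpha>"
    by (simp_all add: e trace_2 skew_def algebra_simps)
  have "(trace A)\<^sup>2 + (skew A)\<^sup>2 = (2 * C)\<^sup>2"
    unfolding t power2_eq_square using cs by algebra
  then have "half_norm A = sqrt ((2 * C)\<^sup>2) / 2"
    by (simp only: half_norm_def)
  then show h: "half_norm A = C"
    using C(2) by (simp only: real_sqrt_abs)
  show "angle_of A \<alpha>"
    using t by (simp add: angle_of_def h)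
  show "polar A \<alpha> p r"
    unfolding polar_def h using A C(1) by blast
qed

text \<open>The displacement of the direction \<open>(sin \<phi>, cos \<phi>)\<close>, measured clockwise.\<close>

definition disp :: "real \<Rightarrow> real^2^2 \<Rightarrow> real \<Rightarrow> real" where
  "disp \<alpha> A \<phi> = \<alpha> + arctan
     (((A$1$1 * sin \<phi> + A$1$2 * cos \<phi>) * cos (\<phi> + \<alpha>) - (A$2$1 * sin \<phi> + A$2$2 * cos \<phi>) * sin (\<phi> + \<alpha>)) /
      ((A$1$1 * sin \<phi> + A$1$2 * cos \<phi>) * sin (\<phi> + \<alpha>) + (A$2$1 * sin \<phi> + A$2$2 * cos \<phi>) * cos (\<phi> + \<alpha>)))"

text \<open>arctan (sinh r) in Cartan coordinates: the largest angle by which the symmetric factor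
  turns a direction, as \<open>disp_bounds\<close> shows.\<close>

definition spread :: "real^2^2 \<Rightarrow> real" where
  "spread A = arctan (sqrt ((half_norm A)\<^sup>2 - 1))"

text \<open>In the frame turned by \<phi> + \<alpha> the rotation factor cancels and only bilinear
  expressions in the symmetric factor remain, hence the double angles.\<close>

lemma polar_rotated:
  assumes "polar A \<alpha> p r"
  shows "(A$1$1 * sin \<phi> + A$1$2 * cos \<phi>) * cos (\<phi> + \<alpha>) - (A$2$1 * sin \<phi> + A$2$2 * cos \<phi>) * sin (\<phi> + \<alpha>)
      = p * sin (2*\<phi>) + r * cos (2*\<phi>)"
    "(A$1$1 * sin \<phi> + A$1$2 * cos \<phi>) * sin (\<phi> + \<alpha>) + (A$2$1 * sin \<phi> + A$2$2 * cos \<phi>) * cos (\<phi> + \<alpha>)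
      = half_norm A - p * cos (2*\<phi>) + r * sin (2*\<phi>)"
proof -
  have 1: "cos \<alpha> * cos \<alpha> + sin \<alpha> * sin \<alpha> = 1" "cos \<phi> * cos \<phi> + sin \<phi> * sin \<phi> = 1"
    by (simp_all add: power2_eq_square[symmetric])
  have 2: "sin (2*\<phi>) = 2 * sin \<phi> * cos \<phi>" "cos (2*\<phi>) = cos \<phi> * cos \<phi> - sin \<phi> * sin \<phi>"
    by (simp_all add: sin_double cos_double power2_eq_square)
  note e = polar_entries(1-4)[OF assms]
  show "(A$1$1 * sin \<phi> + A$1$2 * cos \<phi>) * cos (\<phi> + \<alpha>) - (A$2$1 * sin \<phi> + A$2$2 * cos \<phi>) * sin (\<phi> + \<alpha>)
      = p * sin (2*\<phi>) + r * cos (2*\<phi>)"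
    unfolding cos_add sin_add 2 e using 1 by algebra
  show "(A$1$1 * sin \<phi> + A$1$2 * cos \<phi>) * sin (\<phi> + \<alpha>) + (A$2$1 * sin \<phi> + A$2$2 * cos \<phi>) * cos (\<phi> + \<alpha>)
      = half_norm A - p * cos (2*\<phi>) + r * sin (2*\<phi>)"
    unfolding cos_add sin_add 2 e using 1 by algebra
qed

text \<open>The symmetric factor is positive definite and so turns every direction by less than a
  right angle. This makes the single arctangent in \<open>disp\<close> the correct branch.\<close>

lemma polar_denominator_pos:
  assumes "polar A \<alpha> p r" "A \<in> SL2"
  shows "half_norm A - p * cos \<psi> + r * sin \<psi> > 0"
proof -
  have "(p * cos \<psi> - r * sin \<psi>)\<^sup>2 + (p * sin \<psi> + r * cos \<psi>)\<^sup>2 = p\<^sup>2 + r\<^sup>2"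
    using sin_cos_squared_add[of \<psi>] by algebra
  then have "(p * cos \<psi> - r * sin \<psi>)\<^sup>2 \<le> p\<^sup>2 + r\<^sup>2"
    by (metis le_add_same_cancel1 zero_le_power2)
  also have "\<dots> < (half_norm A)\<^sup>2"
    using polar_entries(5)[OF assms(1)] by simp
  finally have "\<bar>p * cos \<psi> - r * sin \<psi>\<bar> < half_norm A"
    using half_norm_ge_1[OF assms(2)] by (metis abs_le_square_iff abs_of_pos less_le_trans linorder_not_le zero_less_one)
  then show ?thesis
    by linarith
qed

lemma disp_polar:
  assumes "polar A \<alpha> p r"
  shows "disp \<alpha> A \<phi> = \<alpha> + arctan ((p * sin (2*\<phi>) + r * cos (2*\<phi>)) / (half_norm A - p * cos (2*\<phi>) + r * sin (2*\<phi>)))"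
  unfolding disp_def polar_rotated[OF assms] by simp

text \<open>The factor is positive, so the displaced angle gives the oriented direction of the image
  and not merely its line.\<close>

lemma disp_direction:
  assumes "A \<in> SL2" "angle_of A \<alpha>"
  obtains \<rho> where "\<rho> > 0" "A$1$1 * sin \<phi> + A$1$2 * cos \<phi> = \<rho> * sin (\<phi> + disp \<alpha> A \<phi>)"
    "A$2$1 * sin \<phi> + A$2$2 * cos \<phi> = \<rho> * cos (\<phi> + disp \<alpha> A \<phi>)"
proof -
  obtain p r where pol: "polar A \<alpha> p r"
    using angle_of_polar[OF assms] by blast
  define x where "x = A$1$1 * sin \<phi> + A$1$2 * cos \<phi>"
  define y where "y = A$2$1 * sin \<phi> + A$2$2 * cos \<phi>"
  define \<theta> where "\<theta> = \<phi> + \<alpha>"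
  define X where "X = x * cos \<theta> - y * sin \<theta>"
  define Y where "Y = x * sin \<theta> + y * cos \<theta>"
  have Y: "Y > 0"
    using polar_denominator_pos[OF pol assms(1)] polar_rotated(2)[OF pol, of \<phi>]
    unfolding Y_def x_def y_def \<theta>_def by simp
  define \<rho> where "\<rho> = Y * sqrt (1 + (X/Y)\<^sup>2)"
  have sq: "sqrt (1 + (X/Y)\<^sup>2) > 0"
    by (metis add_pos_nonneg real_sqrt_gt_zero zero_le_power2 zero_less_one)
  then have \<rho>: "\<rho> > 0" "\<rho> * cos (arctan (X/Y)) = Y" "\<rho> * sin (arctan (X/Y)) = X"
    using Y by (simp_all add: \<rho>_def cos_arctan sin_arctan)
  have d: "\<phi> + disp \<alpha> A \<phi> = \<theta> + arctan (X/Y)"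
    by (simp add: disp_def X_def Y_def x_def y_def \<theta>_def)
  have cs: "cos \<theta> * cos \<theta> + sin \<theta> * sin \<theta> = 1"
    by (simp add: power2_eq_square[symmetric])
  have "\<rho> * sin (\<theta> + \<delta>) = sin \<theta> * (\<rho> * cos \<delta>) + cos \<theta> * (\<rho> * sin \<delta>)" for \<delta>
    by (simp add: sin_add algebra_simps)
  then have "\<rho> * sin (\<theta> + arctan (X/Y)) = sin \<theta> * Y + cos \<theta> * X"
    by (simp only: \<rho>)
  also have "\<dots> = x"
    unfolding X_def Y_def using cs by algebra
  finally have 1: "x = \<rho> * sin (\<phi> + disp \<alpha> A \<phi>)"
    by (simp add: d)
  have "\<rho> * cos (\<theta> + \<delta>) = cos \<theta> * (\<rho> * cos \<delta>) - sin \<theta> * (\<rho> * sin \<delta>)" for \<delta>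
    by (simp add: cos_add algebra_simps)
  then have "\<rho> * cos (\<theta> + arctan (X/Y)) = cos \<theta> * Y - sin \<theta> * X"
    by (simp only: \<rho>)
  also have "\<dots> = y"
    unfolding X_def Y_def using cs by algebra
  finally have "y = \<rho> * cos (\<phi> + disp \<alpha> A \<phi>)"
    by (simp add: d)
  with 1 \<rho>(1) that show ?thesis
    by (simp add: x_def y_def)
qed

text \<open>With p = S cos \<eta> and r = S sin \<eta> the tangent of the deviation from \<alpha> is
  S sin \<psi> / (C - S cos \<psi>), where \<psi> = 2 \<phi> + \<eta> and C^2 = 1 + S^2. Its extreme
  values are -S and S, both attained, and arctan S is the spread.\<close>

lemma disp_bounds:
  assumes "A \<in> SL2" "angle_of A \<alpha>"
  shows "\<alpha> - spread A \<le> disp \<alpha> A \<phi>" "disp \<alpha> A \<phi> \<le> \<alpha> + spread A"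
    "\<exists>\<phi>. disp \<alpha> A \<phi> = \<alpha> - spread A" "\<exists>\<phi>. disp \<alpha> A \<phi> = \<alpha> + spread A"
proof -
  obtain p r where pol: "polar A \<alpha> p r"
    using angle_of_polar[OF assms] by blast
  define C where "C = half_norm A"
  define S where "S = sqrt (C\<^sup>2 - 1)"
  have C1: "C \<ge> 1" and CC: "C\<^sup>2 = 1 + p\<^sup>2 + r\<^sup>2"
    using half_norm_ge_1[OF assms(1)] polar_entries(5)[OF pol] by (auto simp: C_def)
  have S: "S \<ge> 0" "S\<^sup>2 = p\<^sup>2 + r\<^sup>2" "C\<^sup>2 = 1 + S\<^sup>2"
    using CC by (auto simp: S_def)
  obtain \<eta> where \<eta>: "p = S * cos \<eta>" "r = S * sin \<eta>"
  proof (cases "S = 0")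
    case True
    then show ?thesis using S that by (simp add: sum_power2_eq_zero_iff)
  next
    case False
    have "(p/S)\<^sup>2 + (r/S)\<^sup>2 = (p\<^sup>2 + r\<^sup>2) / S\<^sup>2"
      by (simp add: power_divide add_divide_distrib)
    also have "\<dots> = 1"
      unfolding S(2)[symmetric] using False by simp
    finally have "(p/S)\<^sup>2 + (r/S)\<^sup>2 = 1" .
    then obtain \<eta> where "p/S = cos \<eta>" "r/S = sin \<eta>"
      using sincos_total_2pi by metis
    then show ?thesis using False that[of \<eta>] by (simp add: field_simps)
  qed
  have XY: "disp \<alpha> A \<phi> = \<alpha> + arctan (S * sin (2*\<phi> + \<eta>) / (C - S * cos (2*\<phi> + \<eta>)))" for \<phi>
    unfolding disp_polar[OF pol] C_def[symmetric] \<eta> sin_add cos_add by (simp add: algebra_simps)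
  have Y: "C - S * cos \<psi> > 0" for \<psi>
  proof -
    have "p * cos (\<psi> - \<eta>) - r * sin (\<psi> - \<eta>) = S * cos (\<eta> + (\<psi> - \<eta>))"
      unfolding \<eta> cos_add by (simp add: algebra_simps)
    then show ?thesis
      using polar_denominator_pos[OF pol assms(1), of "\<psi> - \<eta>"] by (simp add: C_def)
  qed
  have spread: "spread A = arctan S"
    by (simp add: spread_def S_def C_def)
  \<comment> \<open>Cauchy-Schwarz for (1, S), of length C, and (|sin \<psi>|, cos \<psi>).
    Multiplied by S it bounds the quotient by S.\<close>
  have key: "\<bar>sin \<psi>\<bar> + S * cos \<psi> \<le> C" for \<psi>
  proof -
    have "(a + S * c)\<^sup>2 + (S * a - c)\<^sup>2 = (1 + S\<^sup>2) * (a\<^sup>2 + c\<^sup>2)" for a c :: real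
      by (simp add: power2_eq_square algebra_simps)
    from this[of "\<bar>sin \<psi>\<bar>" "cos \<psi>"]
    have "(\<bar>sin \<psi>\<bar> + S * cos \<psi>)\<^sup>2 + (S * \<bar>sin \<psi>\<bar> - cos \<psi>)\<^sup>2 = C\<^sup>2"
      unfolding S(3) by simp
    then have "(\<bar>sin \<psi>\<bar> + S * cos \<psi>)\<^sup>2 \<le> C\<^sup>2"
      by (metis le_add_same_cancel1 zero_le_power2)
    then show ?thesis
      using C1 by (simp add: power2_le_iff_abs_le)
  qed
  have bd: "\<bar>S * sin \<psi> / (C - S * cos \<psi>)\<bar> \<le> S" for \<psi>
  proof -
    have "S * \<bar>sin \<psi>\<bar> \<le> S * (C - S * cos \<psi>)"
      using key[of \<psi>] S by (intro mult_left_mono) auto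
    then show ?thesis
      using Y[of \<psi>] S by (simp add: abs_mult pos_divide_le_eq)
  qed
  have "arctan (S * sin \<psi> / (C - S * cos \<psi>)) \<le> arctan S" "arctan (- S) \<le> arctan (S * sin \<psi> / (C - S * cos \<psi>))" for \<psi>
    using bd[of \<psi>] by (auto simp only: arctan_le_iff abs_le_iff)
  then show "\<alpha> - spread A \<le> disp \<alpha> A \<phi>" "disp \<alpha> A \<phi> \<le> \<alpha> + spread A"
    unfolding XY spread by (simp_all add: arctan_minus)
  \<comment> \<open>Equality in Cauchy-Schwarz holds at cos \<psi> = S/C and sin \<psi> = 1/C or
    -1/C.\<close>
  have "(S/C)\<^sup>2 + (1/C)\<^sup>2 = 1" "(S/C)\<^sup>2 + (-1/C)\<^sup>2 = 1"
  proof -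
    have "(S/C)\<^sup>2 + (1/C)\<^sup>2 = (1 + S\<^sup>2) / C\<^sup>2"
      by (simp add: power_divide add_divide_distrib)
    then show "(S/C)\<^sup>2 + (1/C)\<^sup>2 = 1"
      unfolding S(3)[symmetric] using C1 by simp
    then show "(S/C)\<^sup>2 + (-1/C)\<^sup>2 = 1"
      by simp
  qed
  then obtain \<psi>1 \<psi>2 where \<psi>: "S/C = cos \<psi>1" "1/C = sin \<psi>1" "S/C = cos \<psi>2" "-1/C = sin \<psi>2"
    using sincos_total_2pi by metis
  have CS: "C - S * S / C = 1 / C"
    using C1 S(3) by (simp add: field_simps power2_eq_square)
  have arg: "2 * ((\<psi> - \<eta>) / 2) + \<eta> = \<psi>" for \<psi>
    by (simp add: field_simps)
  have "disp \<alpha> A ((\<psi>1 - \<eta>)/2) = \<alpha> + spread A"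
    unfolding XY spread arg using C1 by (simp add: \<psi>[symmetric] CS)
  then show "\<exists>\<phi>. disp \<alpha> A \<phi> = \<alpha> + spread A" ..
  have "disp \<alpha> A ((\<psi>2 - \<eta>)/2) = \<alpha> - spread A"
    unfolding XY spread arg using C1 by (simp add: \<psi>[symmetric] CS arctan_minus)
  then show "\<exists>\<phi>. disp \<alpha> A \<phi> = \<alpha> - spread A" ..
qed

lemma continuous_on_disp:
  fixes \<alpha> :: "'a::t2_space \<Rightarrow> real"
  assumes "continuous_on T \<alpha>" "continuous_on T A" "\<And>x. x \<in> T \<Longrightarrow> A x \<in> SL2" "\<And>x. x \<in> T \<Longrightarrow> angle_of (A x) (\<alpha> x)"
  shows "continuous_on T (\<lambda>x. disp (\<alpha> x) (A x) \<phi>)"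
proof -
  have sc: "continuous_on T (\<lambda>x. sin (\<phi> + \<alpha> x))" "continuous_on T (\<lambda>x. cos (\<phi> + \<alpha> x))"
    using assms(1) by (auto intro!: continuous_intros)
  show ?thesis
    unfolding disp_def
  proof (intro continuous_on_add continuous_on_arctan continuous_on_divide continuous_on_diff
      continuous_on_mult sc continuous_on_const continuous_on_component assms(1,2) ballI)
    fix x assume "x \<in> T"
    then obtain p r where "polar (A x) (\<alpha> x) p r"
      using angle_of_polar assms by blast
    from polar_rotated(2)[OF this] polar_denominator_pos[OF this] \<open>x \<in> T\<close> assms(3)
    show "(A x $ 1 $ 1 * sin \<phi> + A x $ 1 $ 2 * cos \<phi>) * sin (\<phi> + \<alpha> x) +
        (A x $ 2 $ 1 * sin \<phi> + A x $ 2 $ 2 * cos \<phi>) * cos (\<phi> + \<alpha> x) \<noteq> 0"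
      by (metis less_irrefl)
  qed
qed

lemma spread_range:
  assumes "A \<in> SL2"
  shows "0 \<le> spread A" "spread A < pi/2" "cos (spread A) = 1 / half_norm A"
proof -
  have "1 \<le> (half_norm A)\<^sup>2"
    using half_norm_ge_1[OF assms] by simp
  then show "0 \<le> spread A" "cos (spread A) = 1 / half_norm A"
    using half_norm_ge_1[OF assms] by (auto simp: spread_def cos_arctan)
  show "spread A < pi/2"
    unfolding spread_def by (rule arctan_ubound)
qed

section \<open>Trace two in terms of the extreme displacements\<close>

lemma trace_eq_2_iff:
  assumes "A \<in> SL2" "angle_of A \<alpha>"
  shows "trace A = 2 \<longleftrightarrow> cos \<alpha> = cos (spread A)"
  using half_norm_ge_1[OF assms(1)] assms(2) by (auto simp: spread_range[OF assms(1)] angle_of_def field_simps)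

lemma cos_shift_int: "cos (x - 2 * of_int k * pi) = cos x"
  using cos_add[of x "- (2 * of_int k * pi)"] cos_int_2pin[of k] sin_int_2pin[of k] by (simp add: mult_ac)

text \<open>At trace 2 the angle \<alpha> is the spread up to sign and multiples of 2 pi. As the
  spread is below pi/2, the window, closed at the apex 2 k pi, singles out sign and multiple because
  cosine is injective on [0, pi].\<close>

lemma upper_sheet_iff:
  assumes "A \<in> SL2" "angle_of A \<alpha>"
  shows "\<alpha> - spread A = 2 * of_int k * pi \<longleftrightarrow>
    trace A = 2 \<and> 2 * of_int k * pi \<le> \<alpha> \<and> \<alpha> < 2 * of_int k * pi + pi/2"
proof
  assume *: "\<alpha> - spread A = 2 * of_int k * pi"
  then have "cos \<alpha> = cos (spread A)"
  proof -
    have "\<alpha> - 2 * of_int k * pi = spread A"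
      using * by linarith
    then show ?thesis
      using cos_shift_int[of \<alpha> k] by metis
  qed
  then show "trace A = 2 \<and> 2 * of_int k * pi \<le> \<alpha> \<and> \<alpha> < 2 * of_int k * pi + pi/2"
    using * trace_eq_2_iff[OF assms] spread_range[OF assms(1)] by linarith
next
  assume *: "trace A = 2 \<and> 2 * of_int k * pi \<le> \<alpha> \<and> \<alpha> < 2 * of_int k * pi + pi/2"
  then have "cos (\<alpha> - 2 * of_int k * pi) = cos (spread A)"
    using trace_eq_2_iff[OF assms] by (simp add: cos_shift_int)
  moreover have "0 \<le> \<alpha> - 2 * of_int k * pi" "\<alpha> - 2 * of_int k * pi \<le> pi"
    using * pi_ge_zero by auto
  moreover have "spread A \<le> pi"
    using spread_range(2)[OF assms(1)] pi_ge_zero by linarith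
  ultimately have "\<alpha> - 2 * of_int k * pi = spread A"
    using cos_inj_pi spread_range(1)[OF assms(1)] by blast
  then show "\<alpha> - spread A = 2 * of_int k * pi"
    by simp
qed

lemma lower_sheet_iff:
  assumes "A \<in> SL2" "angle_of A \<alpha>"
  shows "\<alpha> + spread A = 2 * of_int k * pi \<longleftrightarrow>
    trace A = 2 \<and> \<alpha> \<le> 2 * of_int k * pi \<and> 2 * of_int k * pi - pi/2 < \<alpha>"
proof
  assume *: "\<alpha> + spread A = 2 * of_int k * pi"
  then have "cos \<alpha> = cos (spread A)"
  proof -
    have "\<alpha> - 2 * of_int k * pi = - spread A"
      using * by linarith
    then show ?thesis
      using cos_shift_int[of \<alpha> k] cos_minus[of "spread A"] by metis
  qed
  then show "trace A = 2 \<and> \<alpha> \<le> 2 * of_int k * pi \<and> 2 * of_int k * pi - pi/2 < \<alpha>"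
    using * trace_eq_2_iff[OF assms] spread_range[OF assms(1)] by linarith
next
  assume *: "trace A = 2 \<and> \<alpha> \<le> 2 * of_int k * pi \<and> 2 * of_int k * pi - pi/2 < \<alpha>"
  then have "cos (2 * of_int k * pi - \<alpha>) = cos (spread A)"
    using trace_eq_2_iff[OF assms] cos_shift_int[of \<alpha> k] cos_minus[of "\<alpha> - 2 * of_int k * pi"] by simp
  moreover have "0 \<le> 2 * of_int k * pi - \<alpha>" "2 * of_int k * pi - \<alpha> \<le> pi"
    using * pi_ge_zero by auto
  moreover have "spread A \<le> pi"
    using spread_range(2)[OF assms(1)] pi_ge_zero by linarith
  ultimately have "2 * of_int k * pi - \<alpha> = spread A"
    using cos_inj_pi spread_range(1)[OF assms(1)] by blast
  then show "\<alpha> + spread A = 2 * of_int k * pi"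
    by simp
qed

text \<open>Zero spread means that A is a rotation. This recognizes the apexes, where two sheets
  meet and the eigenvalue is double, from the matrix alone.\<close>

lemma identity_iff:
  assumes "A \<in> SL2" "angle_of A \<alpha>"
  shows "A = mat 1 \<longleftrightarrow> spread A = 0 \<and> cos \<alpha> = 1"
proof
  assume A: "A = mat 1"
  then have "half_norm A = 1"
    by (simp add: half_norm_def trace_2 skew_def mat_1_mat2)
  moreover have "trace A = 2"
    using A by (simp add: trace_2 mat_1_mat2)
  ultimately show "spread A = 0 \<and> cos \<alpha> = 1"
    using assms(2) by (simp add: spread_def angle_of_def)
next
  assume *: "spread A = 0 \<and> cos \<alpha> = 1"
  then have "half_norm A = 1"
    using spread_range(3)[OF assms(1)] by simp
  obtain p r where pol: "polar A \<alpha> p r"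
    using angle_of_polar[OF assms] by blast
  have "p\<^sup>2 + r\<^sup>2 = 0"
    using polar_entries(5)[OF pol] \<open>half_norm A = 1\<close> by simp
  then have "p = 0" "r = 0"
    by (simp_all add: sum_power2_eq_zero_iff)
  moreover have "sin \<alpha> = 0"
    using * sin_cos_squared_add[of \<alpha>] by simp
  ultimately show "A = mat 1"
    using polar_entries[OF pol] * \<open>half_norm A = 1\<close> unfolding mat_1_mat2 by (intro mat2_eqI) simp_all
qed

section \<open>Square integrable potentials and fundamental matrices\<close>

lemma L2_rel_rep: "L2_rel (rep_L2 q) (rep_L2 q)"
  using Quotient3_rep_reflp[OF Quotient3_L2] .

lemma square_integrable_rep: "square_integrable (rep_L2 q)"
  using L2_rel_rep by (simp add: L2_rel_def)

lemma abs_rep_L2: "abs_L2 (rep_L2 q) = q"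
  using Quotient3_abs_rep[OF Quotient3_L2] .

lemma L2_rel_refl: "square_integrable f \<Longrightarrow> L2_rel f f"
  by (simp add: L2_rel_def)

lemma rep_abs_L2:
  assumes "square_integrable f"
  shows "AE x in Leb. rep_L2 (abs_L2 f) x = f x"
  using Quotient3_rel[OF Quotient3_L2, of "rep_L2 (abs_L2 f)" f] assms square_integrable_rep
  by (simp add: L2_rel_def abs_rep_L2)

lemma abs_L2_eq_iff:
  assumes "square_integrable f" "square_integrable g"
  shows "abs_L2 f = abs_L2 g \<longleftrightarrow> (AE x in Leb. f x = g x)"
  using Quotient3_rel[OF Quotient3_L2, of f g] assms by (simp add: L2_rel_def)

lemma abs_L2_add:
  "square_integrable f \<Longrightarrow> square_integrable g \<Longrightarrow> abs_L2 f + abs_L2 g = abs_L2 (\<lambda>x. f x + g x)"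
  by (intro plus_L2.abs_eq L2_rel_refl)

lemma abs_L2_scale:
  "square_integrable f \<Longrightarrow> c *\<^sub>R abs_L2 f = abs_L2 (\<lambda>x. c * f x)"
  by (intro scaleR_L2.abs_eq L2_rel_refl)

lemma square_integrable_lincomb:
  "square_integrable f \<Longrightarrow> square_integrable g \<Longrightarrow> square_integrable (\<lambda>x. f x - c * g x)"
  using square_integrable_add[OF _ square_integrable_scale, of f g "- c"] by simp

lemma abs_L2_lincomb:
  assumes "square_integrable f" "square_integrable g"
  shows "abs_L2 f - c *\<^sub>R abs_L2 g = abs_L2 (\<lambda>x. f x - c * g x)"
proof -
  have "abs_L2 f - c *\<^sub>R abs_L2 g = abs_L2 f + (- c) *\<^sub>R abs_L2 g"
    by simp
  also have "\<dots> = abs_L2 (\<lambda>x. f x + (- c) * g x)"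
    unfolding abs_L2_scale[OF assms(2)] by (rule abs_L2_add[OF assms(1) square_integrable_scale[OF assms(2)]])
  finally show ?thesis by simp
qed

lemma rep_L2_lincomb: "AE x in Leb. rep_L2 (q - c *\<^sub>R w) x = rep_L2 q x - c * rep_L2 w x"
proof -
  have "q - c *\<^sub>R w = abs_L2 (\<lambda>x. rep_L2 q x - c * rep_L2 w x)"
    using abs_L2_lincomb[OF square_integrable_rep square_integrable_rep, of q c w] by (simp only: abs_rep_L2)
  then show ?thesis
    using rep_abs_L2[OF square_integrable_lincomb[OF square_integrable_rep square_integrable_rep]] by metis
qed

lemma square_integrable_continuous:
  assumes "continuous_on {0..2*pi} f"
  shows "square_integrable f"
  unfolding square_integrable_def
  using assms by (intro conjI measurable_Leb_continuous integrable_Leb_continuous continuous_on_power)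

lemma square_integrable_imp_integrable:
  assumes "square_integrable f"
  shows "integrable Leb f"
  using square_integrable_mult[OF assms square_integrable_continuous[of "\<lambda>_. 1"]] by simp

lemma integrable_rep: "integrable Leb (rep_L2 q)"
  by (intro square_integrable_imp_integrable square_integrable_rep)

lemma square_integrable_mult_continuous:
  assumes "square_integrable f" "continuous_on {0..2*pi} g"
  shows "square_integrable (\<lambda>x. f x * g x)"
proof -
  have "integrable Leb (\<lambda>x. (f x)\<^sup>2 * (g x)\<^sup>2)"
    using assms by (intro integrable_mult_continuous continuous_on_power) (auto simp: square_integrable_def)
  moreover have "f \<in> borel_measurable Leb" "g \<in> borel_measurable Leb"
    using assms measurable_Leb_continuous by (auto simp: square_integrable_def)
  ultimately show ?thesis
    by (auto simp: square_integrable_def power_mult_distrib)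
qed

lemma square_integrable_cong_AE:
  assumes "square_integrable f" "g \<in> borel_measurable Leb" "AE x in Leb. f x = g x"
  shows "square_integrable g"
proof -
  have "AE x in Leb. (f x)\<^sup>2 = (g x)\<^sup>2"
    using assms(3) by eventually_elim simp
  then have "integrable Leb (\<lambda>x. (g x)\<^sup>2)"
    using assms by (subst integrable_cong_AE[symmetric]) (auto simp: square_integrable_def)
  with assms(2) show ?thesis
    by (simp add: square_integrable_def)
qed

definition fund :: "(real \<Rightarrow> real) \<Rightarrow> (real \<Rightarrow> real^2^2) \<Rightarrow> bool" where
  "fund k \<Phi> \<longleftrightarrow> solves k (\<lambda>t. \<Phi> t $ 1 $ 1) (\<lambda>t. \<Phi> t $ 2 $ 1) \<and>
     solves k (\<lambda>t. \<Phi> t $ 1 $ 2) (\<lambda>t. \<Phi> t $ 2 $ 2) \<and> \<Phi> 0 = mat 1"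

lemma fund_solves:
  assumes "fund k \<Phi>"
  shows "solves k (\<lambda>t. a * \<Phi> t $ 1 $ 1 + b * \<Phi> t $ 1 $ 2) (\<lambda>t. a * \<Phi> t $ 2 $ 1 + b * \<Phi> t $ 2 $ 2)"
  using assms solves_lincomb[of k "\<lambda>t. \<Phi> t $ 1 $ 1" "\<lambda>t. \<Phi> t $ 2 $ 1" "\<lambda>t. \<Phi> t $ 1 $ 2" "\<lambda>t. \<Phi> t $ 2 $ 2" a b]
  by (simp add: fund_def)

lemma fund_0:
  assumes "fund k \<Phi>"
  shows "\<Phi> 0 $ 1 $ 1 = 1" "\<Phi> 0 $ 1 $ 2 = 0" "\<Phi> 0 $ 2 $ 1 = 0" "\<Phi> 0 $ 2 $ 2 = 1"
  using assms by (simp_all add: fund_def mat_1_mat2)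

lemma fund_solution_eq:
  fixes k :: "real \<Rightarrow> real"
  assumes "fund k \<Phi>" "solves k y z" "integrable Leb k" "t \<in> {0..2*pi}"
  shows "y t = y 0 * \<Phi> t $ 1 $ 1 + z 0 * \<Phi> t $ 1 $ 2" "z t = y 0 * \<Phi> t $ 2 $ 1 + z 0 * \<Phi> t $ 2 $ 2"
  using solves_unique[OF assms(2) fund_solves[OF assms(1), of "y 0" "z 0"] assms(3) _ _ assms(4)]
  by (simp_all add: fund_0[OF assms(1)])

lemma fund_unique:
  fixes k :: "real \<Rightarrow> real"
  assumes "fund k \<Phi>" "fund k \<Psi>" "integrable Leb k" "t \<in> {0..2*pi}"
  shows "\<Phi> t = \<Psi> t"
  using fund_solution_eq[OF assms(1) fund_solves[OF assms(2), of 1 0] assms(3,4)]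
    fund_solution_eq[OF assms(1) fund_solves[OF assms(2), of 0 1] assms(3,4)]
  by (intro mat2_eqI) (simp_all add: fund_0[OF assms(2)])

lemma fund_exists:
  fixes k :: "real \<Rightarrow> real"
  assumes "integrable Leb k"
  obtains \<Phi> where "fund k \<Phi>"
proof -
  obtain y z where 1: "solves k y z" "y 0 = 1" "z 0 = 0"
    using solves_exists[OF assms] by blast
  obtain v w where 2: "solves k v w" "v 0 = 0" "w 0 = 1"
    using solves_exists[OF assms] by blast
  have "fund k (\<lambda>t. mat2 (y t) (v t) (z t) (w t))"
    using 1 2 by (simp add: fund_def mat_1_mat2)
  then show ?thesis
    using that by blast
qed

lemma fund_continuous:
  assumes "fund k \<Phi>"
  shows "continuous_on {0..2*pi} \<Phi>"
proof -
  have eq: "\<Phi> = (\<lambda>t. mat2 (\<Phi> t $ 1 $ 1) (\<Phi> t $ 1 $ 2) (\<Phi> t $ 2 $ 1) (\<Phi> t $ 2 $ 2))"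
    by (rule ext, rule mat2_eqI) simp_all
  show ?thesis
    by (subst eq, intro continuous_on_mat2) (use assms solvesD(3,4) in \<open>unfold fund_def, blast+\<close>)
qed

lemma fund_SL2:
  assumes "fund k \<Phi>" "t \<in> {0..2*pi}"
  shows "\<Phi> t \<in> SL2"
proof -
  have "ac (\<lambda>t. \<Phi> t $ 1 $ 1 * \<Phi> t $ 2 $ 2 - \<Phi> t $ 2 $ 1 * \<Phi> t $ 1 $ 2) (\<lambda>t. (k t - k t) * \<Phi> t $ 1 $ 1 * \<Phi> t $ 1 $ 2)"
    using assms wronskian[of k "\<lambda>t. \<Phi> t $ 1 $ 2" "\<lambda>t. \<Phi> t $ 2 $ 2" k "\<lambda>t. \<Phi> t $ 1 $ 1" "\<lambda>t. \<Phi> t $ 2 $ 1"]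
    by (simp add: fund_def)
  from acD(2)[OF this assms(2)] show ?thesis
    by (simp add: SL2_iff fund_0[OF assms(1)] mult.commute)
qed

lemma fund_cong_AE:
  "fund k \<Phi> \<Longrightarrow> AE t in Leb. k t = l t \<Longrightarrow> integrable Leb l \<Longrightarrow> fund l \<Phi>"
  unfolding fund_def using solves_cong_AE by blast

lemma integral_mat2:
  fixes a b c d :: "real \<Rightarrow> real"
  assumes "integrable M a" "integrable M b" "integrable M c" "integrable M d"
  shows "integral\<^sup>L M (\<lambda>x. mat2 (a x) (b x) (c x) (d x)) =
    mat2 (integral\<^sup>L M a) (integral\<^sup>L M b) (integral\<^sup>L M c) (integral\<^sup>L M d)"
proof -
  have split: "mat2 a b c d = a *\<^sub>R mat2 1 0 0 0 + b *\<^sub>R mat2 0 1 0 0 + c *\<^sub>R mat2 0 0 1 0 + d *\<^sub>R mat2 0 0 0 1" for a b c d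
    by (rule mat2_eqI) simp_all
  have "integral\<^sup>L M (\<lambda>x. mat2 (a x) (b x) (c x) (d x)) =
    integral\<^sup>L M (\<lambda>x. a x *\<^sub>R mat2 1 0 0 0 + b x *\<^sub>R mat2 0 1 0 0 + c x *\<^sub>R mat2 0 0 1 0 + d x *\<^sub>R mat2 0 0 0 1)"
    by (subst split) (rule refl)
  also have "\<dots> = integral\<^sup>L M a *\<^sub>R mat2 1 0 0 0 + integral\<^sup>L M b *\<^sub>R mat2 0 1 0 0 + integral\<^sup>L M c *\<^sub>R mat2 0 0 1 0 + integral\<^sup>L M d *\<^sub>R mat2 0 0 0 1"
    using assms by simp
  also have "\<dots> = mat2 (integral\<^sup>L M a) (integral\<^sup>L M b) (integral\<^sup>L M c) (integral\<^sup>L M d)"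
    by (rule split[symmetric])
  finally show ?thesis .
qed

lemma fundamental_integral:
  fixes k :: "real \<Rightarrow> real"
  assumes "continuous_on {0..2*pi} \<Phi>" "integrable Leb k" "t \<in> {0..2*pi}"
  shows "integral\<^sup>L (lebesgue_on {0..t}) (\<lambda>x. mat2 0 1 (k x) 0 ** \<Phi> x) =
    mat2 (integral\<^sup>L (lebesgue_on {0..t}) (\<lambda>x. \<Phi> x $ 2 $ 1)) (integral\<^sup>L (lebesgue_on {0..t}) (\<lambda>x. \<Phi> x $ 2 $ 2))
      (integral\<^sup>L (lebesgue_on {0..t}) (\<lambda>x. k x * \<Phi> x $ 1 $ 1)) (integral\<^sup>L (lebesgue_on {0..t}) (\<lambda>x. k x * \<Phi> x $ 1 $ 2))"
proof -
  have eq: "mat2 0 1 (k x) 0 ** \<Phi> x = mat2 (\<Phi> x $ 2 $ 1) (\<Phi> x $ 2 $ 2) (k x * \<Phi> x $ 1 $ 1) (k x * \<Phi> x $ 1 $ 2)" for x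
    by (rule mat2_eqI) (simp_all add: matrix_matrix_mult_def sum_2)
  have c: "continuous_on {0..2*pi} (\<lambda>x. \<Phi> x $ i $ j)" for i j
    using assms(1) by (intro continuous_on_component)
  have t: "t \<le> 2*pi"
    using assms(3) by simp
  show ?thesis
    unfolding eq
    by (intro integral_mat2 integrable_initial[OF integrable_Leb_continuous[OF c] t]
        integrable_initial[OF integrable_mult_continuous[OF assms(2) c] t])
qed

lemma fundamental_solution_iff: "fundamental_solution q \<Phi> \<longleftrightarrow> fund (rep_L2 q) \<Phi>"
proof
  let ?k = "rep_L2 q"
  assume f: "fundamental_solution q \<Phi>"
  then have cont: "continuous_on {0..2*pi} \<Phi>" by (simp add: fundamental_solution_def)
  have c: "continuous_on {0..2*pi} (\<lambda>x. \<Phi> x $ i $ j)" for i j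
    using cont by (intro continuous_on_component)
  have eq: "\<Phi> t = mat 1 + mat2 (integral\<^sup>L (lebesgue_on {0..t}) (\<lambda>x. \<Phi> x $ 2 $ 1)) (integral\<^sup>L (lebesgue_on {0..t}) (\<lambda>x. \<Phi> x $ 2 $ 2))
      (integral\<^sup>L (lebesgue_on {0..t}) (\<lambda>x. ?k x * \<Phi> x $ 1 $ 1)) (integral\<^sup>L (lebesgue_on {0..t}) (\<lambda>x. ?k x * \<Phi> x $ 1 $ 2))"
    if "t \<in> {0..2*pi}" for t
    using f that unfolding fundamental_integral[OF cont integrable_rep that, symmetric] fundamental_solution_def by blast
  have e: "\<Phi> t $ 1 $ 1 = 1 + integral\<^sup>L (lebesgue_on {0..t}) (\<lambda>x. \<Phi> x $ 2 $ 1)"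
    "\<Phi> t $ 1 $ 2 = integral\<^sup>L (lebesgue_on {0..t}) (\<lambda>x. \<Phi> x $ 2 $ 2)"
    "\<Phi> t $ 2 $ 1 = integral\<^sup>L (lebesgue_on {0..t}) (\<lambda>x. ?k x * \<Phi> x $ 1 $ 1)"
    "\<Phi> t $ 2 $ 2 = 1 + integral\<^sup>L (lebesgue_on {0..t}) (\<lambda>x. ?k x * \<Phi> x $ 1 $ 2)"
    if "t \<in> {0..2*pi}" for t
    using arg_cong[OF eq[OF that], of "\<lambda>X. X $ 1 $ 1"] arg_cong[OF eq[OF that], of "\<lambda>X. X $ 1 $ 2"]
      arg_cong[OF eq[OF that], of "\<lambda>X. X $ 2 $ 1"] arg_cong[OF eq[OF that], of "\<lambda>X. X $ 2 $ 2"]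
    unfolding mat_1_mat2 vector_add_component mat2_nth by linarith+
  have z: "0 \<in> {0..2*pi}" by simp
  have e0: "\<Phi> 0 $ 1 $ 1 = 1" "\<Phi> 0 $ 1 $ 2 = 0" "\<Phi> 0 $ 2 $ 1 = 0" "\<Phi> 0 $ 2 $ 2 = 1"
    using e[OF z] unfolding integral_initial_0 by linarith+
  show "fund ?k \<Phi>"
    unfolding fund_def solves_def
  proof (intro conjI)
    show "\<Phi> 0 = mat 1"
      unfolding mat_1_mat2 by (rule mat2_eqI) (simp_all add: e0)
    show "ac (\<lambda>t. \<Phi> t $ 1 $ 1) (\<lambda>t. \<Phi> t $ 2 $ 1)" "ac (\<lambda>t. \<Phi> t $ 1 $ 2) (\<lambda>t. \<Phi> t $ 2 $ 2)"
      unfolding ac_def e0 using e by (auto intro!: integrable_Leb_continuous c)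
    show "ac (\<lambda>t. \<Phi> t $ 2 $ 1) (\<lambda>t. ?k t * \<Phi> t $ 1 $ 1)" "ac (\<lambda>t. \<Phi> t $ 2 $ 2) (\<lambda>t. ?k t * \<Phi> t $ 1 $ 2)"
      unfolding ac_def e0 using e by (auto intro!: integrable_mult_continuous[OF integrable_rep c])
  qed
next
  let ?k = "rep_L2 q"
  assume f: "fund ?k \<Phi>"
  have cont: "continuous_on {0..2*pi} \<Phi>"
    using f by (rule fund_continuous)
  have "\<Phi> t = mat 1 + integral\<^sup>L (lebesgue_on {0..t}) (\<lambda>x. mat2 0 1 (?k x) 0 ** \<Phi> x)" if t: "t \<in> {0..2*pi}" for t
  proof -
    have s: "solves ?k (\<lambda>t. \<Phi> t $ 1 $ 1) (\<lambda>t. \<Phi> t $ 2 $ 1)" "solves ?k (\<lambda>t. \<Phi> t $ 1 $ 2) (\<lambda>t. \<Phi> t $ 2 $ 2)"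
      using f by (auto simp: fund_def)
    show ?thesis
      unfolding fundamental_integral[OF cont integrable_rep t] mat_1_mat2
      using acD(2)[OF solvesD(1)[OF s(1)] t] acD(2)[OF solvesD(2)[OF s(1)] t]
        acD(2)[OF solvesD(1)[OF s(2)] t] acD(2)[OF solvesD(2)[OF s(2)] t]
      by (intro mat2_eqI) (simp_all only: vector_add_component mat2_nth fund_0[OF f])
  qed
  with cont show "fundamental_solution q \<Phi>"
    by (simp add: fundamental_solution_def)
qed

section \<open>Dependence of the fundamental matrix on the coefficient\<close>

lemma fund_entry_close:
  fixes k l :: "real \<Rightarrow> real"
  assumes \<Phi>: "fund k \<Phi>" and \<Psi>: "fund l \<Psi>" and k: "integrable Leb k" and l: "integrable Leb l"
    and B: "\<And>t j. t \<in> {0..2*pi} \<Longrightarrow> \<bar>\<Phi> t $ 1 $ j\<bar> \<le> B" and t: "t \<in> {0..2*pi}"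
  shows "\<bar>\<Phi> t $ i $ j - \<Psi> t $ i $ j\<bar> \<le> B * (\<integral>x. \<bar>k x - l x\<bar> \<partial>Leb) * exp (2*pi + (\<integral>x. \<bar>l x\<bar> \<partial>Leb))"
proof -
  have s: "solves k (\<lambda>t. \<Phi> t $ 1 $ j) (\<lambda>t. \<Phi> t $ 2 $ j)" "solves l (\<lambda>t. \<Psi> t $ 1 $ j) (\<lambda>t. \<Psi> t $ 2 $ j)"
    using \<Phi> \<Psi> exhaust_2[of j] by (auto simp: fund_def)
  have "\<Phi> 0 = \<Psi> 0"
    using \<Phi> \<Psi> by (simp add: fund_def)
  then have "\<bar>\<Phi> t $ 1 $ j - \<Psi> t $ 1 $ j\<bar> + \<bar>\<Phi> t $ 2 $ j - \<Psi> t $ 2 $ j\<bar>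
     \<le> B * (\<integral>x. \<bar>k x - l x\<bar> \<partial>Leb) * exp (2*pi + (\<integral>x. \<bar>l x\<bar> \<partial>Leb))"
    by (intro solves_close[OF s k l _ _ B t]) auto
  then show ?thesis
    using exhaust_2[of i] by auto
qed

lemma fund_bound:
  assumes "fund k \<Phi>"
  obtains B where "B > 0" "\<And>t i j. t \<in> {0..2*pi} \<Longrightarrow> \<bar>\<Phi> t $ i $ j\<bar> \<le> B"
proof -
  have "compact (\<Phi> ` {0..2*pi})"
    using fund_continuous[OF assms] by (intro compact_continuous_image) auto
  then obtain B where B: "B > 0" "\<And>x. x \<in> \<Phi> ` {0..2*pi} \<Longrightarrow> norm x \<le> B"
    using bounded_pos compact_imp_bounded by metis
  have "\<bar>\<Phi> t $ i $ j\<bar> \<le> B" if "t \<in> {0..2*pi}" for t i j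
  proof -
    have "norm (\<Phi> t $ i $ j) \<le> norm (\<Phi> t $ i)"
      by (rule Finite_Cartesian_Product.norm_nth_le)
    then have "\<bar>\<Phi> t $ i $ j\<bar> \<le> norm (\<Phi> t $ i)"
      by simp
    also have "\<dots> \<le> norm (\<Phi> t)"
      by (rule Finite_Cartesian_Product.norm_nth_le)
    also have "\<dots> \<le> B"
      using B(2) that by blast
    finally show ?thesis .
  qed
  with B(1) that show ?thesis by blast
qed

text \<open>Only the solution at \<open>s0\<close> has to be bounded beforehand, and for |s - s0|
  \<le> 1 the exponential in \<open>solves_close\<close> is bounded, so one constant serves all
  t.\<close>

lemma fund_lipschitz:
  fixes q w :: "real \<Rightarrow> real"
  assumes \<Phi>: "\<And>s. fund (\<lambda>t. q t - s * w t) (\<Phi> s)" and q: "integrable Leb q" and w: "integrable Leb w"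
  obtains C where "C > 0" "\<And>s t i j. \<bar>s - s0\<bar> \<le> 1 \<Longrightarrow> t \<in> {0..2*pi} \<Longrightarrow> \<bar>\<Phi> s t $ i $ j - \<Phi> s0 t $ i $ j\<bar> \<le> C * \<bar>s - s0\<bar>"
proof -
  obtain B where B: "B > 0" "\<And>t i j. t \<in> {0..2*pi} \<Longrightarrow> \<bar>\<Phi> s0 t $ i $ j\<bar> \<le> B"
    using fund_bound[OF \<Phi>[of s0]] by blast
  define Q where "Q = (\<integral>x. \<bar>q x\<bar> \<partial>Leb)"
  define W where "W = (\<integral>x. \<bar>w x\<bar> \<partial>Leb)"
  have W: "W \<ge> 0"
    unfolding W_def by simp
  have int: "integrable Leb (\<lambda>t. q t - s * w t)" for s
    using q w by simp
  define E where "E = exp (2*pi + Q + (\<bar>s0\<bar> + 1) * W)"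
  \<comment> \<open>The added 1 keeps the constant positive even if w vanishes almost
    everywhere.\<close>
  have "\<bar>\<Phi> s t $ i $ j - \<Phi> s0 t $ i $ j\<bar> \<le> (B * W * E + 1) * \<bar>s - s0\<bar>" if s: "\<bar>s - s0\<bar> \<le> 1" and t: "t \<in> {0..2*pi}" for s t i j
  proof -
    have "\<bar>\<Phi> s0 t $ i $ j - \<Phi> s t $ i $ j\<bar> \<le> B * (\<integral>x. \<bar>(q x - s0 * w x) - (q x - s * w x)\<bar> \<partial>Leb) * exp (2*pi + (\<integral>x. \<bar>q x - s * w x\<bar> \<partial>Leb))"
      using B(2) by (intro fund_entry_close[OF \<Phi> \<Phi> int int _ t])
    also have "(\<integral>x. \<bar>(q x - s0 * w x) - (q x - s * w x)\<bar> \<partial>Leb) = (\<integral>x. \<bar>s - s0\<bar> * \<bar>w x\<bar> \<partial>Leb)"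
      by (rule Bochner_Integration.integral_cong) (simp_all add: abs_mult[symmetric] left_diff_distrib)
    also have "\<dots> = \<bar>s - s0\<bar> * W"
      by (simp add: W_def)
    also have "B * (\<bar>s - s0\<bar> * W) * exp (2*pi + (\<integral>x. \<bar>q x - s * w x\<bar> \<partial>Leb)) \<le> B * (\<bar>s - s0\<bar> * W) * E"
    proof -
      have "(\<integral>x. \<bar>q x - s * w x\<bar> \<partial>Leb) \<le> (\<integral>x. \<bar>q x\<bar> + \<bar>s\<bar> * \<bar>w x\<bar> \<partial>Leb)"
      proof (rule integral_mono)
        show "integrable Leb (\<lambda>x. \<bar>q x - s * w x\<bar>)" "integrable Leb (\<lambda>x. \<bar>q x\<bar> + \<bar>s\<bar> * \<bar>w x\<bar>)"
          using q w by simp_all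
        show "\<bar>q x - s * w x\<bar> \<le> \<bar>q x\<bar> + \<bar>s\<bar> * \<bar>w x\<bar>" for x
          using abs_triangle_ineq4[of "q x" "s * w x"] by (simp add: abs_mult)
      qed
      also have "\<dots> = Q + \<bar>s\<bar> * W"
        using q w by (simp add: Q_def W_def)
      also have "\<dots> \<le> Q + (\<bar>s0\<bar> + 1) * W"
        using s W by (intro add_left_mono mult_right_mono) auto
      finally have "exp (2*pi + (\<integral>x. \<bar>q x - s * w x\<bar> \<partial>Leb)) \<le> E"
        by (simp add: E_def)
      then show ?thesis
        using B(1) W by (intro mult_left_mono) auto
    qed
    also have "\<dots> \<le> (B * W * E + 1) * \<bar>s - s0\<bar>"
      by (simp add: algebra_simps)
    finally show ?thesis
      by (simp add: abs_minus_commute)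
  qed
  moreover have "B * W * E + 1 > 0"
    using B(1) W by (simp add: E_def add_nonneg_pos)
  ultimately show ?thesis
    using that by blast
qed

text \<open>Joint continuity is what allows the whole family of fundamental matrices to be lifted at
  once. The bound uniform in t reduces it to continuity in t at the fixed parameter
  \<open>s0\<close>.\<close>

lemma continuous_on_parameter:
  fixes f :: "real \<Rightarrow> real \<Rightarrow> real"
  assumes "\<And>s. continuous_on T (f s)"
    and "\<And>s0. \<exists>C. \<forall>s t. \<bar>s - s0\<bar> \<le> 1 \<longrightarrow> t \<in> T \<longrightarrow> \<bar>f s t - f s0 t\<bar> \<le> C * \<bar>s - s0\<bar>"
  shows "continuous_on (UNIV \<times> T) (\<lambda>x. f (fst x) (snd x))"
  unfolding continuous_on_def
proof
  fix x :: "real \<times> real" assume x: "x \<in> UNIV \<times> T"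
  define s0 where "s0 = fst x"
  define F where "F = at x within UNIV \<times> T"
  obtain C where C: "\<And>s t. \<bar>s - s0\<bar> \<le> 1 \<Longrightarrow> t \<in> T \<Longrightarrow> \<bar>f s t - f s0 t\<bar> \<le> C * \<bar>s - s0\<bar>"
    using assms(2)[of s0] by blast
  have fst: "((\<lambda>y. fst y) \<longlongrightarrow> s0) F"
    unfolding s0_def F_def by (intro tendsto_fst tendsto_ident_at)
  have "\<forall>\<^sub>F y in F. \<bar>fst y - s0\<bar> < 1"
    using tendstoD[OF fst, of 1] by (simp add: dist_real_def)
  moreover have "\<forall>\<^sub>F y in F. snd y \<in> T"
    unfolding F_def eventually_at_filter by (intro always_eventually) auto
  ultimately have "\<forall>\<^sub>F y in F. norm (f (fst y) (snd y) - f s0 (snd y)) \<le> C * \<bar>fst y - s0\<bar>"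
    by eventually_elim (use C in auto)
  moreover have "((\<lambda>y. C * \<bar>fst y - s0\<bar>) \<longlongrightarrow> 0) F"
    using tendsto_mult[OF tendsto_const[of C] tendsto_rabs[OF tendsto_diff[OF fst tendsto_const[of s0]]]] by simp
  ultimately have "((\<lambda>y. f (fst y) (snd y) - f s0 (snd y)) \<longlongrightarrow> 0) F"
    by (rule Lim_null_comparison)
  moreover have "((\<lambda>y. f s0 (snd y)) \<longlongrightarrow> f s0 (snd x)) F"
  proof -
    have "continuous_on (UNIV \<times> T) (\<lambda>y. f s0 (snd y))"
      by (rule continuous_on_compose2[OF assms(1) continuous_on_snd[OF continuous_on_id]]) auto
    then show ?thesis
      using x unfolding continuous_on_def F_def by blast
  qed
  ultimately have "((\<lambda>y. (f (fst y) (snd y) - f s0 (snd y)) + f s0 (snd y)) \<longlongrightarrow> 0 + f s0 (snd x)) F"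
    by (rule tendsto_add)
  then show "((\<lambda>x. f (fst x) (snd x)) \<longlongrightarrow> f (fst x) (snd x)) (at x within UNIV \<times> T)"
    by (simp add: F_def s0_def)
qed

lemma continuous_AE_zero:
  assumes c: "continuous_on {0..2*pi} f" and ae: "AE x in Leb. f x = (0::real)" and x: "x \<in> {0..2*pi}"
  shows "f x = 0"
proof -
  have cy: "continuous_on {0..2*pi} (\<lambda>x. (f x)\<^sup>2)"
    using c by (intro continuous_on_power)
  have "AE x in Leb. (f x)\<^sup>2 = 0"
    using ae by eventually_elim simp
  then have "integral\<^sup>L Leb (\<lambda>x. (f x)\<^sup>2) = 0"
    by (rule integral_eq_zero_AE)
  then have "integral {0..2*pi} (\<lambda>x. (f x)\<^sup>2) = 0"
    using lebesgue_integral_eq_integral[OF integrable_Leb_continuous[OF cy]] by simp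
  then show ?thesis
    using integral_eq_0_iff[OF cy] x by auto
qed

text \<open>A vanishing integral makes y zero almost everywhere, hence everywhere by continuity.
  Then z is constant, and its integral over the period is y (2 pi) - y 0 = 0, so both initial values
  vanish.\<close>

lemma solves_integral_pos:
  fixes w k :: "real \<Rightarrow> real"
  assumes s: "solves k y z" and nz: "y 0 \<noteq> 0 \<or> z 0 \<noteq> 0" and w: "integrable Leb w" "AE x in Leb. 0 < w x"
  shows "0 < (\<integral>x. w x * (y x)\<^sup>2 \<partial>Leb)"
proof (rule ccontr)
  assume neg: "\<not> ?thesis"
  have int: "integrable Leb (\<lambda>x. w x * (y x)\<^sup>2)"
    using w solvesD(3)[OF s] by (intro integrable_mult_continuous continuous_on_power)
  have nonneg: "AE x in Leb. 0 \<le> w x * (y x)\<^sup>2"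
    using w(2) by eventually_elim simp
  have "(\<integral>x. w x * (y x)\<^sup>2 \<partial>Leb) = 0"
    using integral_nonneg_AE[OF nonneg] neg by simp
  then have "AE x in Leb. w x * (y x)\<^sup>2 = 0"
    using integral_nonneg_eq_0_iff_AE[OF int nonneg] by simp
  then have "AE x in Leb. (y x)\<^sup>2 = 0"
    using w(2) by eventually_elim simp
  then have "AE x in Leb. y x = 0"
    by eventually_elim simp
  then have y0: "y x = 0" if "x \<in> {0..2*pi}" for x
    by (rule continuous_AE_zero[OF solvesD(3)[OF s] _ that])
  have z: "z t = z 0" if t: "t \<in> {0..2*pi}" for t
  proof -
    have "integral\<^sup>L (lebesgue_on {0..t}) (\<lambda>t. k t * y t) = integral\<^sup>L (lebesgue_on {0..t}) (\<lambda>t. 0)"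
    proof (rule integral_initial_cong)
      fix x assume "x \<in> {0..t}"
      then have "x \<in> {0..2*pi}" using t by simp
      then show "k x * y x = 0" using y0 by simp
    qed
    then show ?thesis
      using acD(2)[OF solvesD(2)[OF s] t] by simp
  qed
  have p: "2*pi \<in> {0..2*pi}" by simp
  have "integral\<^sup>L Leb z = integral\<^sup>L Leb (\<lambda>_. z 0)"
    using z by (rule integral_initial_cong)
  also have "\<dots> = 2 * pi * z 0"
    by (simp add: measure_restrict_space)
  finally have "2 * pi * z 0 = 0"
    using acD(2)[OF solvesD(1)[OF s] p] y0[of 0] y0[OF p] by simp
  then have "z 0 = 0" by simp
  with nz y0[of 0] show False by simp
qed

section \<open>Periodic Sobolev functions and eigenspaces\<close>

text \<open>Extended by zero, g integrates to 0 over every half line. The finite measures with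
  densities the positive and the negative part then agree on half lines, hence are equal, and so are
  their densities.\<close>

lemma AE_zero_of_initial_integrals:
  fixes g :: "real \<Rightarrow> real"
  assumes g: "integrable Leb g" and zero: "\<And>x. x \<in> {0..2*pi} \<Longrightarrow> integral\<^sup>L (lebesgue_on {0..x}) g = 0"
  shows "AE x in Leb. g x = 0"
proof -
  define f where "f x = indicator {0..2*pi} x *\<^sub>R g x" for x
  have f: "integrable lebesgue f"
    using g unfolding f_def by (simp add: integrable_restrict_space)
  \<comment> \<open>Half lines determine measures on the Borel sets, so g is first replaced by a
    Borel version.\<close>
  then obtain g' where g': "g' \<in> borel_measurable lborel" and ae: "AE x in lborel. f x = g' x"
    using completion_ex_borel_measurable_real[of f lborel] borel_measurable_integrable by blast
  have ae': "AE x in lebesgue. f x = g' x"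
    using ae by (rule AE_completion)
  have g'm: "g' \<in> borel_measurable lebesgue"
    using g' by (rule measurable_completion)
  have "integrable lebesgue g'"
    using f integrable_cong_AE[OF borel_measurable_integrable[OF f] g'm ae'] by simp
  then have g'i: "integrable lborel g'"
    using integrable_completion[OF g'] by simp
  have le0: "(\<integral>t. indicator {..x} t *\<^sub>R f t \<partial>lebesgue) = 0" for x
  proof -
    define b where "b = min x (2*pi)"
    have "(\<integral>t. indicator {..x} t *\<^sub>R f t \<partial>lebesgue) = (\<integral>t. indicator {0..b} t *\<^sub>R g t \<partial>lebesgue)"
      unfolding f_def b_def by (rule Bochner_Integration.integral_cong) (auto simp: indicator_def)
    also have "\<dots> = integral\<^sup>L (lebesgue_on {0..b}) g"
      by (simp add: integral_restrict_space)
    also have "\<dots> = 0"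
    proof (cases "0 \<le> b")
      case True
      then show ?thesis
        by (intro zero) (auto simp: b_def)
    next
      case False
      then have "{0..b} = {}" by simp
      then show ?thesis
        by (intro integral_eq_zero_AE) (simp add: AE_restrict_space_iff)
    qed
    finally show ?thesis .
  qed
  have gt0: "(\<integral>t. indicator {x<..} t *\<^sub>R g' t \<partial>lborel) = 0" for x
  proof -
    have "(\<integral>t. indicator {x<..} t *\<^sub>R g' t \<partial>lborel) = (\<integral>t. indicator {x<..} t *\<^sub>R g' t \<partial>lebesgue)"
      using g' by (intro integral_completion[symmetric] borel_measurable_scaleR borel_measurable_indicator) auto
    also have "\<dots> = (\<integral>t. indicator {x<..} t *\<^sub>R f t \<partial>lebesgue)"
    proof (rule integral_cong_AE)
      show "AE t in lebesgue. indicator {x<..} t *\<^sub>R g' t = indicator {x<..} t *\<^sub>R f t"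
        using ae' by eventually_elim simp
      show "(\<lambda>t. indicator {x<..} t *\<^sub>R g' t) \<in> borel_measurable lebesgue"
        using g'm by (intro borel_measurable_scaleR borel_measurable_indicator) auto
      show "(\<lambda>t. indicator {x<..} t *\<^sub>R f t) \<in> borel_measurable lebesgue"
        using borel_measurable_integrable[OF f] by (intro borel_measurable_scaleR borel_measurable_indicator) auto
    qed
    also have "\<dots> = (\<integral>t. indicator {..2*pi} t *\<^sub>R f t - indicator {..min x (2*pi)} t *\<^sub>R f t \<partial>lebesgue)"
      by (rule Bochner_Integration.integral_cong) (auto simp: f_def indicator_def)
    also have "\<dots> = (\<integral>t. indicator {..2*pi} t *\<^sub>R f t \<partial>lebesgue) - (\<integral>t. indicator {..min x (2*pi)} t *\<^sub>R f t \<partial>lebesgue)"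
      using f by (intro Bochner_Integration.integral_diff integrable_mult_indicator) auto
    finally show ?thesis
      by (simp only: le0 diff_self)
  qed
  define P where "P = density lborel (\<lambda>t. ennreal (max 0 (g' t)))"
  define N where "N = density lborel (\<lambda>t. ennreal (max 0 (- g' t)))"
  have iP: "integrable lborel (\<lambda>t. max 0 (g' t))" and iN: "integrable lborel (\<lambda>t. max 0 (- g' t))"
    using g'i by (auto intro!: Bochner_Integration.integrable_max)
  have em: "emeasure (density lborel (\<lambda>t. ennreal (h t))) {x<..} = ennreal (\<integral>t. indicator {x<..} t *\<^sub>R h t \<partial>lborel)"
    if h: "integrable lborel h" "\<And>t. 0 \<le> h t" for h :: "real \<Rightarrow> real" and x
  proof -
    have hm: "h \<in> borel_measurable lborel"
      using h(1) by (rule borel_measurable_integrable)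
    have "emeasure (density lborel (\<lambda>t. ennreal (h t))) {x<..} = (\<integral>\<^sup>+t. ennreal (h t) * indicator {x<..} t \<partial>lborel)"
      using hm by (intro emeasure_density) auto
    also have "\<dots> = (\<integral>\<^sup>+t. ennreal (indicator {x<..} t *\<^sub>R h t) \<partial>lborel)"
      by (rule nn_integral_cong) (auto simp: indicator_def)
    also have "\<dots> = ennreal (\<integral>t. indicator {x<..} t *\<^sub>R h t \<partial>lborel)"
      using h by (intro nn_integral_eq_integral integrable_mult_indicator) auto
    finally show ?thesis .
  qed
  have "P = N"
  proof (rule measure_eqI_lessThan)
    show "sets P = sets borel" "sets N = sets borel"
      by (simp_all add: P_def N_def)
    fix x
    show "emeasure P {x<..} < \<infinity>"
      unfolding P_def using em[OF iP] by (simp add: less_top[symmetric])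
    have "(\<integral>t. indicator {x<..} t *\<^sub>R max 0 (g' t) \<partial>lborel) - (\<integral>t. indicator {x<..} t *\<^sub>R max 0 (- g' t) \<partial>lborel)
       = (\<integral>t. indicator {x<..} t *\<^sub>R max 0 (g' t) - indicator {x<..} t *\<^sub>R max 0 (- g' t) \<partial>lborel)"
      using iP iN by (intro Bochner_Integration.integral_diff[symmetric] integrable_mult_indicator) auto
    also have "\<dots> = (\<integral>t. indicator {x<..} t *\<^sub>R g' t \<partial>lborel)"
      by (rule Bochner_Integration.integral_cong) (auto simp: max_def indicator_def)
    finally show "emeasure P {x<..} = emeasure N {x<..}"
      unfolding P_def N_def using em[OF iP] em[OF iN] gt0[of x] by simp
  qed
  then have "AE t in lborel. ennreal (max 0 (g' t)) = ennreal (max 0 (- g' t))"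
    unfolding P_def N_def using g' by (intro sigma_finite_measure.density_unique[OF sigma_finite_lborel]) auto
  then have "AE t in lborel. g' t = 0"
    by eventually_elim (auto simp: max_def split: if_splits)
  then have "AE t in lebesgue. g' t = 0"
    by (rule AE_completion)
  with ae' have "AE t in lebesgue. f t = 0"
    by eventually_elim simp
  then show ?thesis
    by (auto simp: AE_restrict_space_iff f_def indicator_def elim!: eventually_mono)
qed

lemma ac_zero:
  assumes f: "ac f g" and z: "\<And>x. x \<in> {0..2*pi} \<Longrightarrow> f x = 0"
  shows "AE x in Leb. g x = 0"
proof (rule AE_zero_of_initial_integrals[OF acD(1)[OF f]])
  fix x :: real assume x: "x \<in> {0..2*pi}"
  have "f 0 = 0" by (rule z) simp
  then show "integral\<^sup>L (lebesgue_on {0..x}) g = 0"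
    using acD(2)[OF f x] z[OF x] by linarith
qed

lemma ac_cong_AE:
  assumes f: "ac f g" and eq: "AE x in Leb. g x = h x" and h: "integrable Leb h"
  shows "ac f h"
proof (rule acI[OF h])
  fix x :: real assume x: "x \<in> {0..2*pi}"
  have "integral\<^sup>L (lebesgue_on {0..x}) g = integral\<^sup>L (lebesgue_on {0..x}) h"
    using x acD(1)[OF f] h by (intro integral_initial_cong_AE[OF eq]) auto
  then show "f x = f 0 + integral\<^sup>L (lebesgue_on {0..x}) h"
    using acD(2)[OF f x] by simp
qed

lemma sobolev_jet_iff:
  "sobolev_jet p u f \<longleftrightarrow> (\<forall>j\<le>p. square_integrable (f j)) \<and> abs_L2 (f 0) = u \<and> (\<forall>j<p. ac (f j) (f (Suc j)))"
  unfolding sobolev_jet_def ac_def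
  by (auto simp: Suc_le_eq intro: square_integrable_imp_integrable)

text \<open>The definite description needs uniqueness of weak derivatives: two jets of one class
  agree almost everywhere at order 0, everywhere by continuity, so their derivatives agree almost
  everywhere, and the argument repeats once more.\<close>

lemma sobolev_deriv_2:
  assumes f: "sobolev_jet 2 u f"
  shows "sobolev_deriv 2 u = abs_L2 (f 2)"
  unfolding sobolev_deriv_def
proof (rule the_equality)
  show "\<exists>g. sobolev_jet 2 u g \<and> abs_L2 (f 2) = abs_L2 (g 2)"
    using f by blast
  fix w assume "\<exists>g. sobolev_jet 2 u g \<and> w = abs_L2 (g 2)"
  then obtain g where g: "sobolev_jet 2 u g" "w = abs_L2 (g 2)"
    by blast
  have j: "ac (h 0) (h 1)" "ac (h 1) (h 2)" "square_integrable (h 0)" "square_integrable (h 2)" "abs_L2 (h 0) = u"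
    if "sobolev_jet 2 u h" for h
    using that by (auto simp: sobolev_jet_iff numeral_2_eq_2 All_less_Suc)
  note jf = j[OF f] and jg = j[OF g(1)]
  have d0: "ac (\<lambda>x. f 0 x - g 0 x) (\<lambda>x. f 1 x - g 1 x)" and d1: "ac (\<lambda>x. f 1 x - g 1 x) (\<lambda>x. f 2 x - g 2 x)"
    using ac_diff jf jg by blast+
  have "AE x in Leb. f 0 x = g 0 x"
    using abs_L2_eq_iff[OF jf(3) jg(3)] jf(5) jg(5) by simp
  then have "AE x in Leb. f 0 x - g 0 x = 0"
    by eventually_elim simp
  then have "\<And>x. x \<in> {0..2*pi} \<Longrightarrow> f 0 x - g 0 x = 0"
    by (rule continuous_AE_zero[OF ac_continuous[OF d0]])
  then have "AE x in Leb. f 1 x - g 1 x = 0"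
    by (rule ac_zero[OF d0])
  then have "\<And>x. x \<in> {0..2*pi} \<Longrightarrow> f 1 x - g 1 x = 0"
    by (rule continuous_AE_zero[OF ac_continuous[OF d1]])
  then have "AE x in Leb. f 2 x - g 2 x = 0"
    by (rule ac_zero[OF d1])
  then have "AE x in Leb. g 2 x = f 2 x"
    by eventually_elim simp
  then show "w = abs_L2 (f 2)"
    using abs_L2_eq_iff[OF jg(4) jf(4)] g(2) by simp
qed

text \<open>Representatives of the elements of \<open>Hp_circle p\<close>, described by recursion so
  that products and bootstrapping become inductions. The top derivative carries no boundary
  condition.\<close>

fun per :: "nat \<Rightarrow> (real \<Rightarrow> real) \<Rightarrow> bool" where
  "per 0 f \<longleftrightarrow> square_integrable f"
| "per (Suc p) f \<longleftrightarrow> (\<exists>g. ac f g \<and> f 0 = f (2*pi) \<and> per p g)"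

lemma per_square_integrable: "per p f \<Longrightarrow> square_integrable f"
  by (cases p) (auto intro: square_integrable_continuous ac_continuous)

lemma per_SucD: "per (Suc p) f \<Longrightarrow> per p f"
proof (induction p arbitrary: f)
  case 0
  then show ?case
    using per_square_integrable by fastforce
next
  case (Suc p)
  then obtain g where "ac f g" "f 0 = f (2*pi)" "per (Suc p) g"
    by auto
  then show ?case
    using Suc.IH[of g] by auto
qed

lemma per_le: "per p f \<Longrightarrow> j \<le> p \<Longrightarrow> per j f"
  by (induction p) (auto simp: le_Suc_eq dest: per_SucD simp del: per.simps(2))

lemma per_const: "per p (\<lambda>_. c)"
proof (induction p arbitrary: c)
  case 0
  then show ?case by (simp add: square_integrable_continuous)
next
  case (Suc p)
  then show ?case using ac_const by auto
qed

lemma per_lincomb: "per p f \<Longrightarrow> per p g \<Longrightarrow> per p (\<lambda>x. f x - c * g x)"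
proof (induction p arbitrary: f g)
  case 0
  then show ?case by (simp add: square_integrable_lincomb)
next
  case (Suc p)
  then obtain f' g' where *: "ac f f'" "f 0 = f (2*pi)" "per p f'" "ac g g'" "g 0 = g (2*pi)" "per p g'"
    by auto
  have "ac (\<lambda>x. f x - c * g x) (\<lambda>x. f' x - c * g' x)"
    using * by (intro ac_diff ac_scale)
  then show ?case
    using Suc.IH[OF *(3,6)] *(2,5) by auto
qed

lemma per_add: "per p f \<Longrightarrow> per p g \<Longrightarrow> per p (\<lambda>x. f x + g x)"
  using per_lincomb[of p f g "-1"] by simp

text \<open>The second factor is one order smoother so that at order 0 a square integrable function
  is multiplied by a continuous one. The bootstrap for eigenfunctions supplies exactly this
  surplus.\<close>

lemma per_mult: "per p f \<Longrightarrow> per (Suc p) g \<Longrightarrow> per p (\<lambda>x. f x * g x)"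
proof (induction p arbitrary: f g)
  case 0
  then show ?case
    using square_integrable_mult_continuous ac_continuous by auto
next
  case (Suc p)
  then obtain f' g' where *: "ac f f'" "f 0 = f (2*pi)" "per p f'" "ac g g'" "g 0 = g (2*pi)" "per (Suc p) g'"
    by (metis per.simps(2))
  have "per p (\<lambda>x. f' x * g x)"
    using Suc.IH[OF *(3)] per_SucD[OF Suc.prems(2)] by blast
  moreover have "per p (\<lambda>x. f x * g' x)"
    using Suc.IH[OF per_SucD[OF Suc.prems(1)] *(6)] .
  ultimately have "per p (\<lambda>x. f' x * g x + f x * g' x)"
    by (rule per_add)
  moreover have "ac (\<lambda>x. f x * g x) (\<lambda>x. f' x * g x + f x * g' x)"
    using *(1,4) by (rule ac_mult)
  ultimately show ?case
    using *(2,5) by auto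
qed

lemma per_jet:
  "per p h \<Longrightarrow> \<exists>f. f 0 = h \<and> (\<forall>j\<le>p. square_integrable (f j)) \<and> (\<forall>j<p. ac (f j) (f (Suc j)) \<and> f j 0 = f j (2*pi))"
proof (induction p arbitrary: h)
  case 0
  then show ?case by (intro exI[of _ "\<lambda>_. h"]) simp
next
  case (Suc p)
  then obtain g where g: "ac h g" "h 0 = h (2*pi)" "per p g"
    by auto
  obtain f where f: "f 0 = g" "\<forall>j\<le>p. square_integrable (f j)" "\<forall>j<p. ac (f j) (f (Suc j)) \<and> f j 0 = f j (2*pi)"
    using Suc.IH[OF g(3)] by blast
  define F where "F = case_nat h f"
  have F: "F 0 = h" "F (Suc j) = f j" for j
    by (simp_all add: F_def)
  have "square_integrable (F j)" if "j \<le> Suc p" for j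
    using that f(2) per_square_integrable[OF Suc.prems] by (cases j) (auto simp: F)
  moreover have "ac (F j) (F (Suc j)) \<and> F j 0 = F j (2*pi)" if "j < Suc p" for j
    using that f(1,3) g(1,2) by (cases j) (auto simp: F)
  ultimately show ?case
    using F(1) by blast
qed

lemma jet_per:
  "square_integrable (f p) \<Longrightarrow> (\<forall>j<p. ac (f j) (f (Suc j)) \<and> f j 0 = f j (2*pi)) \<Longrightarrow> per p (f 0)"
proof (induction p arbitrary: f)
  case (Suc p)
  have "per p (f (Suc 0))"
    using Suc.IH[of "\<lambda>j. f (Suc j)"] Suc.prems by auto
  then show ?case
    using Suc.prems(2) by auto
qed simp

lemma Hp_circle_iff: "u \<in> Hp_circle p \<longleftrightarrow> (\<exists>h. per p h \<and> u = abs_L2 h)"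
proof
  assume "u \<in> Hp_circle p"
  then obtain f where f: "sobolev_jet p u f" "\<forall>j<p. f j 0 = f j (2*pi)"
    by (auto simp: Hp_circle_def)
  then have "per p (f 0)"
    by (intro jet_per) (auto simp: sobolev_jet_iff)
  then show "\<exists>h. per p h \<and> u = abs_L2 h"
    using f(1) by (auto simp: sobolev_jet_iff)
next
  assume "\<exists>h. per p h \<and> u = abs_L2 h"
  then obtain h where "per p h" "u = abs_L2 h" by blast
  then obtain f where "f 0 = h" "\<forall>j\<le>p. square_integrable (f j)" "\<forall>j<p. ac (f j) (f (Suc j)) \<and> f j 0 = f j (2*pi)"
    using per_jet by blast
  then show "u \<in> Hp_circle p"
    using \<open>u = abs_L2 h\<close> unfolding Hp_circle_def sobolev_jet_iff by (intro CollectI exI[of _ f]) auto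
qed

lemma Hp_circle_lincomb:
  assumes "q \<in> Hp_circle p" "w \<in> Hp_circle p"
  shows "q - s *\<^sub>R w \<in> Hp_circle p"
proof -
  obtain f g where "per p f" "q = abs_L2 f" "per p g" "w = abs_L2 g"
    using assms unfolding Hp_circle_iff by blast
  then show ?thesis
    using abs_L2_lincomb[of f g s] per_square_integrable per_lincomb[of p f g s] unfolding Hp_circle_iff by blast
qed

text \<open>Subtracting multiples of the constant potential shifts the spectral parameter, so the
  eigenvalues are governed by the same line argument with w = 1.\<close>

definition one_L2 :: L2 where
  "one_L2 = abs_L2 (\<lambda>_. 1)"

lemma one_L2_Hp: "one_L2 \<in> Hp_circle p"
  unfolding Hp_circle_iff one_L2_def using per_const by blast

lemma rep_one_L2: "AE x in Leb. rep_L2 one_L2 x = 1"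
  unfolding one_L2_def by (rule rep_abs_L2) (simp add: square_integrable_continuous)

lemma rep_one_L2_pos: "AE x in Leb. 0 < rep_L2 one_L2 x"
  using rep_one_L2 by eventually_elim simp

section \<open>Eigenspaces as fixed vectors of the monodromy matrix\<close>

definition periodic_solution :: "L2 \<Rightarrow> real \<Rightarrow> (real \<Rightarrow> real) \<Rightarrow> (real \<Rightarrow> real) \<Rightarrow> bool" where
  "periodic_solution q c y z \<longleftrightarrow> solves (\<lambda>t. rep_L2 q t - c) y z \<and> y 0 = y (2*pi) \<and> z 0 = z (2*pi)"

text \<open>Bootstrap: if y has order j + 2, then k y has order j + 1, so z has order j + 2 and y
  has order j + 3, as long as the potential has order j + 1. The equation alone gives order 2, while
  eigenfunctions are required to have order p + 2.\<close>

lemma periodic_solution_per: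
  assumes q: "q \<in> Hp_circle p" and s: "periodic_solution q c y z"
  shows "per (p + 2) y"
proof -
  obtain h where h: "per p h" "q = abs_L2 h"
    using q unfolding Hp_circle_iff by blast
  define k where "k t = h t - c" for t
  have k: "per p k"
    using per_lincomb[OF h(1) per_const[of p c], of 1] by (simp add: k_def[abs_def])
  have "AE t in Leb. rep_L2 q t - c = k t"
    using rep_abs_L2[OF per_square_integrable[OF h(1)]] unfolding h(2) by eventually_elim (simp add: k_def)
  then have yz: "solves k y z" and b: "y 0 = y (2*pi)" "z 0 = z (2*pi)"
    using s square_integrable_imp_integrable[OF per_square_integrable[OF k]] solves_cong_AE
    unfolding periodic_solution_def by blast+
  have "per (j + 2) y" if "j \<le> p" for j
    using that
  proof (induction j)
    case 0
    have "square_integrable (\<lambda>t. k t * y t)"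
      using per_square_integrable[OF k] solvesD(3)[OF yz] by (rule square_integrable_mult_continuous)
    then show ?case
      using solvesD(1,2)[OF yz] b by (auto simp: numeral_2_eq_2)
  next
    case (Suc j)
    have "per (Suc j) (\<lambda>t. k t * y t)"
      using per_mult[OF per_le[OF k, of "Suc j"], of y] Suc by simp
    then have "per (Suc (Suc j)) z"
      using solvesD(2)[OF yz] b(2) unfolding per.simps(2)[of "Suc j"] by blast
    then have "per (Suc (Suc (Suc j))) y"
      using solvesD(1)[OF yz] b(1) unfolding per.simps(2)[of "Suc (Suc j)"] by blast
    then show ?case by simp
  qed
  then show ?thesis by blast
qed

lemma L2_mult_abs:
  assumes "continuous_on {0..2*pi} y"
  shows "L2_mult q (abs_L2 y) = abs_L2 (\<lambda>t. rep_L2 q t * y t)"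
proof -
  have y: "square_integrable y"
    using assms by (rule square_integrable_continuous)
  have sq: "square_integrable (\<lambda>t. rep_L2 q t * y t)"
    using square_integrable_rep assms by (rule square_integrable_mult_continuous)
  have ae: "AE t in Leb. rep_L2 q t * y t = rep_L2 q t * rep_L2 (abs_L2 y) t"
    using rep_abs_L2[OF y] by eventually_elim simp
  have "(\<lambda>t. rep_L2 q t * rep_L2 (abs_L2 y) t) \<in> borel_measurable Leb"
    using square_integrable_rep by (intro borel_measurable_times) (auto simp: square_integrable_def)
  from square_integrable_cong_AE[OF sq this ae] have "abs_L2 (\<lambda>t. rep_L2 q t * y t) = abs_L2 (\<lambda>t. rep_L2 q t * rep_L2 (abs_L2 y) t)"
    using abs_L2_eq_iff[OF sq] ae by blast
  then show ?thesis
    by (simp add: L2_mult_def)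
qed

lemma eigenspace_iff:
  assumes q: "q \<in> Hp_circle p"
  shows "v \<in> eigenspace p q c \<longleftrightarrow> (\<exists>y z. periodic_solution q c y z \<and> v = abs_L2 y)"
proof
  let ?k = "\<lambda>t. rep_L2 q t - c"
  assume "v \<in> eigenspace p q c"
  then have v: "v \<in> Hp_circle (p + 2)" and eq: "- sobolev_deriv 2 v + L2_mult q v = c *\<^sub>R v"
    by (auto simp: eigenspace_def schroedinger_def)
  obtain f where f: "sobolev_jet (p + 2) v f" "\<forall>j<p + 2. f j 0 = f j (2*pi)"
    using v by (auto simp: Hp_circle_def)
  have jet: "sobolev_jet 2 v f"
    using f(1) by (auto simp: sobolev_jet_iff)
  have ac: "ac (f 0) (f 1)" "ac (f 1) (f 2)" "square_integrable (f 0)" "square_integrable (f 2)" "abs_L2 (f 0) = v"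
    using jet by (auto simp: sobolev_jet_iff numeral_2_eq_2 All_less_Suc)
  have per: "f 0 0 = f 0 (2*pi)" "f 1 0 = f 1 (2*pi)"
    using f(2) by auto
  have sq: "square_integrable (\<lambda>t. rep_L2 q t * f 0 t)"
    using square_integrable_rep ac_continuous[OF ac(1)] by (rule square_integrable_mult_continuous)
  have "- abs_L2 (f 2) + abs_L2 (\<lambda>t. rep_L2 q t * f 0 t) = c *\<^sub>R abs_L2 (f 0)"
    using eq sobolev_deriv_2[OF jet] L2_mult_abs[OF ac_continuous[OF ac(1)], of q] ac(5) by simp
  then have "abs_L2 (f 2) = abs_L2 (\<lambda>t. rep_L2 q t * f 0 t) - c *\<^sub>R abs_L2 (f 0)"
    by (simp add: algebra_simps)
  also have "\<dots> = abs_L2 (\<lambda>t. rep_L2 q t * f 0 t - c * f 0 t)"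
    by (rule abs_L2_lincomb[OF sq ac(3)])
  finally have "AE t in Leb. f 2 t = rep_L2 q t * f 0 t - c * f 0 t"
    using abs_L2_eq_iff[OF ac(4) square_integrable_lincomb[OF sq ac(3)]] by simp
  then have ae: "AE t in Leb. f 2 t = ?k t * f 0 t"
    by eventually_elim (simp add: algebra_simps)
  have "integrable Leb (\<lambda>t. ?k t * f 0 t)"
  proof -
    have "(\<lambda>t. ?k t * f 0 t) = (\<lambda>t. rep_L2 q t * f 0 t - c * f 0 t)"
      by (simp add: algebra_simps)
    then show ?thesis
      using square_integrable_imp_integrable[OF square_integrable_lincomb[OF sq ac(3), of c]] by simp
  qed
  then have "ac (f 1) (\<lambda>t. ?k t * f 0 t)"
    using ac_cong_AE[OF ac(2) ae] by blast
  then have "periodic_solution q c (f 0) (f 1)"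
    using ac(1) per by (simp add: periodic_solution_def solves_def)
  then show "\<exists>y z. periodic_solution q c y z \<and> v = abs_L2 y"
    using ac(5) by blast
next
  let ?k = "\<lambda>t. rep_L2 q t - c"
  assume "\<exists>y z. periodic_solution q c y z \<and> v = abs_L2 y"
  then obtain y z where s: "periodic_solution q c y z" and v: "v = abs_L2 y"
    by blast
  have sol: "solves ?k y z"
    using s by (simp add: periodic_solution_def)
  have cy: "continuous_on {0..2*pi} y"
    using solvesD(3)[OF sol] .
  have sqy: "square_integrable y"
    using cy by (rule square_integrable_continuous)
  have sq: "square_integrable (\<lambda>t. rep_L2 q t * y t)"
    using square_integrable_rep cy by (rule square_integrable_mult_continuous)
  have eqk: "(\<lambda>t. ?k t * y t) = (\<lambda>t. rep_L2 q t * y t - c * y t)"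
    by (simp add: algebra_simps)
  have sqk: "square_integrable (\<lambda>t. ?k t * y t)"
    unfolding eqk using sq sqy by (rule square_integrable_lincomb)
  define f where "f = (\<lambda>j::nat. if j = 0 then y else if j = 1 then z else (\<lambda>t. ?k t * y t))"
  have "sobolev_jet 2 v f"
    unfolding sobolev_jet_iff
  proof (intro conjI allI impI)
    show "abs_L2 (f 0) = v"
      by (simp add: f_def v)
    show "square_integrable (f j)" for j
      unfolding f_def using sqy sqk square_integrable_continuous[OF solvesD(4)[OF sol]] by simp
    show "ac (f j) (f (Suc j))" if "j < 2" for j
    proof (cases "j = 0")
      case True
      then show ?thesis using solvesD(1)[OF sol] by (simp add: f_def)
    next
      case False
      then have "j = 1" using that by simp
      then show ?thesis using solvesD(2)[OF sol] by (simp add: f_def)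
    qed
  qed
  from sobolev_deriv_2[OF this] have "sobolev_deriv 2 v = abs_L2 (\<lambda>t. rep_L2 q t * y t - c * y t)"
    unfolding eqk[symmetric] by (simp add: f_def)
  also have "\<dots> = abs_L2 (\<lambda>t. rep_L2 q t * y t) - c *\<^sub>R abs_L2 y"
    by (rule abs_L2_lincomb[OF sq sqy, symmetric])
  finally have "schroedinger q v = c *\<^sub>R v"
    by (simp add: schroedinger_def v L2_mult_abs[OF cy])
  moreover have "v \<in> Hp_circle (p + 2)"
    unfolding Hp_circle_iff using periodic_solution_per[OF q s] v by blast
  ultimately show "v \<in> eigenspace p q c"
    by (simp add: eigenspace_def)
qed

text \<open>A solution is determined by its initial vector, and periodicity says that the monodromy
  matrix fixes this vector. Independence of the two basis solutions is
  \<open>solves_integral_pos\<close> with weight 1.\<close>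

lemma eigenspace_fund:
  assumes q: "q \<in> Hp_circle p" and \<Phi>: "fund (\<lambda>t. rep_L2 q t - c) \<Phi>"
  defines "e1 \<equiv> abs_L2 (\<lambda>t. \<Phi> t $ 1 $ 1)" and "e2 \<equiv> abs_L2 (\<lambda>t. \<Phi> t $ 1 $ 2)" and "M \<equiv> \<Phi> (2*pi)"
  shows "eigenspace p q c = {a *\<^sub>R e1 + b *\<^sub>R e2 | a b. M$1$1 * a + M$1$2 * b = a \<and> M$2$1 * a + M$2$2 * b = b}"
    and "a *\<^sub>R e1 + b *\<^sub>R e2 = 0 \<Longrightarrow> a = 0 \<and> b = 0"
proof -
  let ?k = "\<lambda>t. rep_L2 q t - c"
  have k: "integrable Leb ?k"
    using integrable_rep[of q] integrable_Leb_continuous[of "\<lambda>_. c"] by simp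
  have c1: "continuous_on {0..2*pi} (\<lambda>t. \<Phi> t $ 1 $ j)" for j
    using fund_continuous[OF \<Phi>] by (intro continuous_on_component)
  have sq: "square_integrable (\<lambda>t. \<Phi> t $ 1 $ j)" for j
    using c1 by (rule square_integrable_continuous)
  have comb: "a *\<^sub>R e1 + b *\<^sub>R e2 = abs_L2 (\<lambda>t. a * \<Phi> t $ 1 $ 1 + b * \<Phi> t $ 1 $ 2)" for a b
    unfolding e1_def e2_def abs_L2_scale[OF sq]
    by (rule abs_L2_add[OF square_integrable_scale[OF sq] square_integrable_scale[OF sq]])
  note sol = fund_solves[OF \<Phi>]
  have p: "2*pi \<in> {0..2*pi}" by simp
  show "eigenspace p q c = {a *\<^sub>R e1 + b *\<^sub>R e2 | a b. M$1$1 * a + M$1$2 * b = a \<and> M$2$1 * a + M$2$2 * b = b}" (is "_ = ?R")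
  proof (intro equalityI subsetI)
    fix v assume "v \<in> eigenspace p q c"
    then obtain y z where s: "periodic_solution q c y z" and v: "v = abs_L2 y"
      unfolding eigenspace_iff[OF q] by blast
    have yz: "solves ?k y z" and b: "y 0 = y (2*pi)" "z 0 = z (2*pi)"
      using s by (auto simp: periodic_solution_def)
    note e = fund_solution_eq[OF \<Phi> yz k]
    have sy: "square_integrable y"
      using solvesD(3)[OF yz] by (rule square_integrable_continuous)
    have "AE t in Leb. y t = y 0 * \<Phi> t $ 1 $ 1 + z 0 * \<Phi> t $ 1 $ 2"
      using e(1) by (rule AE_on_intervalI)
    then have "abs_L2 y = y 0 *\<^sub>R e1 + z 0 *\<^sub>R e2"
      unfolding comb
      using abs_L2_eq_iff[OF sy square_integrable_add[OF square_integrable_scale[OF sq] square_integrable_scale[OF sq]]] by blast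
    moreover have "M$1$1 * y 0 + M$1$2 * z 0 = y 0" "M$2$1 * y 0 + M$2$2 * z 0 = z 0"
      using e[OF p] b unfolding M_def by (simp_all add: mult.commute)
    ultimately show "v \<in> ?R"
      unfolding v by blast
  next
    fix v assume "v \<in> ?R"
    then obtain a b where v: "v = a *\<^sub>R e1 + b *\<^sub>R e2" and f: "M$1$1 * a + M$1$2 * b = a" "M$2$1 * a + M$2$2 * b = b"
      by blast
    have "periodic_solution q c (\<lambda>t. a * \<Phi> t $ 1 $ 1 + b * \<Phi> t $ 1 $ 2) (\<lambda>t. a * \<Phi> t $ 2 $ 1 + b * \<Phi> t $ 2 $ 2)"
      using sol f by (simp add: periodic_solution_def fund_0[OF \<Phi>] M_def mult.commute)
    then show "v \<in> eigenspace p q c"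
      unfolding eigenspace_iff[OF q] v comb by blast
  qed
  assume "a *\<^sub>R e1 + b *\<^sub>R e2 = 0"
  then have "abs_L2 (\<lambda>t. a * \<Phi> t $ 1 $ 1 + b * \<Phi> t $ 1 $ 2) = abs_L2 (\<lambda>_. 0)"
    by (simp add: comb zero_L2_def)
  then have ae: "AE t in Leb. a * \<Phi> t $ 1 $ 1 + b * \<Phi> t $ 1 $ 2 = 0"
    using abs_L2_eq_iff[OF square_integrable_add[OF square_integrable_scale[OF sq] square_integrable_scale[OF sq]] square_integrable_zero] by blast
  have zero: "(\<integral>t. 1 * (a * \<Phi> t $ 1 $ 1 + b * \<Phi> t $ 1 $ 2)\<^sup>2 \<partial>Leb) = 0"
  proof (rule integral_eq_zero_AE)
    show "AE t in Leb. 1 * (a * \<Phi> t $ 1 $ 1 + b * \<Phi> t $ 1 $ 2)\<^sup>2 = 0"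
      using ae by eventually_elim simp
  qed
  have one: "integrable Leb (\<lambda>_. 1::real)"
    by (intro integrable_Leb_continuous continuous_on_const)
  show "a = 0 \<and> b = 0"
  proof (rule ccontr)
    assume "\<not> (a = 0 \<and> b = 0)"
    then have "a * \<Phi> 0 $ 1 $ 1 + b * \<Phi> 0 $ 1 $ 2 \<noteq> 0 \<or> a * \<Phi> 0 $ 2 $ 1 + b * \<Phi> 0 $ 2 $ 2 \<noteq> 0"
      by (simp add: fund_0[OF \<Phi>])
    from solves_integral_pos[OF sol this one] zero show False
      by simp
  qed
qed

text \<open>On \<open>SL2\<close> the determinant of M - 1 is 2 - trace M, so nonzero fixed vectors
  exist exactly at trace 2 and form a line (with 0) unless M - 1 vanishes.\<close>

lemma fixed_vectors:
  fixes M :: "real^2^2"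
  assumes M: "M \<in> SL2"
  defines "F \<equiv> {(a, b). M$1$1 * a + M$1$2 * b = a \<and> M$2$1 * a + M$2$2 * b = b}"
  shows "trace M \<noteq> 2 \<Longrightarrow> F = {(0, 0)}"
    "trace M = 2 \<Longrightarrow> M \<noteq> mat 1 \<Longrightarrow> \<exists>a b. (a, b) \<noteq> (0, 0) \<and> F = {(r * a, r * b) | r. True}"
    "M = mat 1 \<Longrightarrow> F = UNIV"
proof -
  define A B C D where "A = M$1$1 - 1" and "B = M$1$2" and "C = M$2$1" and "D = M$2$2 - 1"
  have e: "M$1$1 = A + 1" "M$1$2 = B" "M$2$1 = C" "M$2$2 = D + 1"
    by (simp_all add: A_def B_def C_def D_def)
  have F: "F = {(a, b). A * a + B * b = 0 \<and> C * a + D * b = 0}"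
    unfolding F_def e by (auto simp: algebra_simps)
  have det: "A * D - B * C = 2 - trace M"
    using M by (simp add: SL2_iff trace_2 e algebra_simps)
  show "F = {(0, 0)}" if "trace M \<noteq> 2"
  proof -
    have nz: "A * D - B * C \<noteq> 0"
      using det that by simp
    have z: "a = 0 \<and> b = 0" if "A * a + B * b = 0" "C * a + D * b = 0" for a b
    proof -
      have "(A * D - B * C) * a = D * (A * a + B * b) - B * (C * a + D * b)"
        "(A * D - B * C) * b = A * (C * a + D * b) - C * (A * a + B * b)"
        by (simp_all add: algebra_simps)
      then have "(A * D - B * C) * a = 0" "(A * D - B * C) * b = 0"
        unfolding that by (simp_all only: mult_zero_right diff_self)
      then show ?thesis
        using nz unfolding mult_eq_0_iff by blast
    qed
    show ?thesis
    proof (intro equalityI subsetI)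
      fix x assume x: "x \<in> F"
      obtain a b where ab: "x = (a, b)" by (cases x)
      have "A * a + B * b = 0" "C * a + D * b = 0"
        using x unfolding F ab by blast+
      then show "x \<in> {(0, 0)}"
        using z[of a b] unfolding ab by blast
    qed (simp add: F)
  qed
  show "F = UNIV" if "M = mat 1"
    unfolding F_def that mat_1_mat2 by auto
  assume tr: "trace M = 2" and ne: "M \<noteq> mat 1"
  have det0: "A * D = B * C"
    using det tr by simp
  have "\<not> (A = 0 \<and> B = 0 \<and> C = 0 \<and> D = 0)"
    using ne unfolding mat_1_mat2 by (auto intro!: mat2_eqI simp: e)
  \<comment> \<open>A nonzero row (r, s) of M - 1. Since the determinant vanishes, the other row is
    a multiple of it, and (-s, r) spans the kernel.\<close>
  then obtain r s where rs: "(r, s) \<noteq> (0, 0)" "(r = A \<and> s = B) \<or> (r = C \<and> s = D)"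
    by (cases "A = 0 \<and> B = 0") auto
  have n: "r\<^sup>2 + s\<^sup>2 \<noteq> 0"
    using rs(1) by (simp add: sum_power2_eq_zero_iff)
  have "F = {(t * (- s), t * r) | t. True}"
  proof (intro equalityI subsetI)
    fix x assume x: "x \<in> F"
    obtain a b where ab: "x = (a, b)" by (cases x)
    have z: "r * a + s * b = 0"
      using x rs(2) by (auto simp: F ab)
    define t where "t = (r * b - s * a) / (r\<^sup>2 + s\<^sup>2)"
    have "(r\<^sup>2 + s\<^sup>2) * a = - s * (r * b - s * a) + r * (r * a + s * b)"
      "(r\<^sup>2 + s\<^sup>2) * b = r * (r * b - s * a) + s * (r * a + s * b)"
      by (simp_all add: algebra_simps power2_eq_square)
    then have "a = t * (- s)" "b = t * r"
      unfolding z t_def using n by (simp_all add: field_simps)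
    then show "x \<in> {(t * (- s), t * r) | t. True}"
      unfolding ab by blast
  next
    fix x assume "x \<in> {(t * (- s), t * r) | t. True}"
    then obtain t where t: "x = (t * (- s), t * r)" by blast
    have "A * (t * (- s)) + B * (t * r) = t * (B * r - A * s)" "C * (t * (- s)) + D * (t * r) = t * (D * r - C * s)"
      by (simp_all add: algebra_simps)
    moreover have "B * r - A * s = 0" "D * r - C * s = 0"
      using rs(2) det0 by (auto simp: mult.commute)
    ultimately show "x \<in> F"
      unfolding F t by simp
  qed
  moreover have "(- s, r) \<noteq> (0, 0)"
    using rs(1) by auto
  ultimately show "\<exists>a b. (a, b) \<noteq> (0, 0) \<and> F = {(r * a, r * b) | r. True}"
    by blast
qed

lemma eigenspace_dim:
  assumes q: "q \<in> Hp_circle p" and \<Phi>: "fund (\<lambda>t. rep_L2 q t - c) \<Phi>"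
  defines "M \<equiv> \<Phi> (2*pi)"
  shows "dim (eigenspace p q c) = (if M = mat 1 then 2 else if trace M = 2 then 1 else 0)"
    and "trace M = 2 \<Longrightarrow> \<exists>v\<in>eigenspace p q c. v \<noteq> 0"
proof -
  define e1 where "e1 = abs_L2 (\<lambda>t. \<Phi> t $ 1 $ 1)"
  define e2 where "e2 = abs_L2 (\<lambda>t. \<Phi> t $ 1 $ 2)"
  define F where "F = {(a, b). M$1$1 * a + M$1$2 * b = a \<and> M$2$1 * a + M$2$2 * b = b}"
  have M: "M \<in> SL2"
    unfolding M_def by (rule fund_SL2[OF \<Phi>]) simp
  note fv = fixed_vectors[OF M, folded F_def]
  have E: "eigenspace p q c = (\<lambda>(a, b). a *\<^sub>R e1 + b *\<^sub>R e2) ` F"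
    unfolding eigenspace_fund(1)[OF q \<Phi>] F_def e1_def[symmetric] e2_def[symmetric] M_def[symmetric] by auto
  have ind: "a = 0 \<and> b = 0" if "a *\<^sub>R e1 + b *\<^sub>R e2 = 0" for a b
    using eigenspace_fund(2)[OF q \<Phi>, of a b] that by (simp add: e1_def e2_def)
  have tr1: "trace (mat 1 :: real^2^2) = 2"
    by (simp add: trace_2 mat_1_mat2)
  have one: "dim (eigenspace p q c) = 1 \<and> (\<exists>v\<in>eigenspace p q c. v \<noteq> 0)" if tr: "trace M = 2" and ne: "M \<noteq> mat 1"
  proof -
    obtain a b where ab: "(a, b) \<noteq> (0, 0)" "F = {(r * a, r * b) | r. True}"
      using fv(2)[OF tr ne] by blast
    define v where "v = a *\<^sub>R e1 + b *\<^sub>R e2"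
    have v: "v \<noteq> 0"
      using ind[of a b] ab(1) unfolding v_def by auto
    have "eigenspace p q c = range (\<lambda>r. r *\<^sub>R v)"
      unfolding E ab(2) v_def by (auto simp: scaleR_add_right image_iff)
    also have "\<dots> = span {v}"
      by (simp add: span_singleton)
    finally have sp: "eigenspace p q c = span {v}" .
    have "dim (span {v}) = card {v}"
      using v by (intro dim_span_eq_card_independent) simp
    moreover have "v \<in> span {v}"
      by (simp add: span_base)
    ultimately show ?thesis
      using v sp by auto
  qed
  have two: "dim (eigenspace p q c) = 2 \<and> (\<exists>v\<in>eigenspace p q c. v \<noteq> 0)" if "M = mat 1"
  proof -
    have ne2: "e2 \<noteq> 0"
      using ind[of 0 1] by auto
    have ni: "e1 \<notin> span {e2}"
    proof
      assume "e1 \<in> span {e2}"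
      then obtain r where "e1 = r *\<^sub>R e2"
        by (auto simp: span_singleton)
      then show False
        using ind[of 1 "- r"] by simp
    qed
    then have ne: "e1 \<noteq> e2"
      by (auto simp: span_base)
    have indep: "independent {e1, e2}"
      using ni ne2 ne by (simp add: independent_insert)
    have "eigenspace p q c = span {e1, e2}"
    proof (intro equalityI subsetI)
      fix v assume "v \<in> eigenspace p q c"
      then obtain a b where v: "v = a *\<^sub>R e1 + b *\<^sub>R e2"
        unfolding E by auto
      show "v \<in> span {e1, e2}"
        unfolding v by (intro span_add span_scale span_base) simp_all
    next
      fix v assume "v \<in> span {e1, e2}"
      then obtain a where "v - a *\<^sub>R e1 \<in> span {e2}"
        unfolding span_insert by blast
      then obtain b where "v - a *\<^sub>R e1 = b *\<^sub>R e2"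
        by (auto simp: span_singleton)
      then have "v = a *\<^sub>R e1 + b *\<^sub>R e2"
        by (simp add: algebra_simps)
      then show "v \<in> eigenspace p q c"
        unfolding E fv(3)[OF that] by auto
    qed
    moreover have "dim (span {e1, e2}) = card {e1, e2}"
      using indep by (rule dim_span_eq_card_independent)
    moreover have "e2 \<in> span {e1, e2}"
      by (simp add: span_base)
    ultimately show ?thesis
      using ne ne2 by auto
  qed
  have zero: "dim (eigenspace p q c) = 0" if "trace M \<noteq> 2"
  proof -
    have "eigenspace p q c = span {}"
      unfolding E fv(1)[OF that] by simp
    moreover have "dim (span ({} :: L2 set)) = card ({} :: L2 set)"
      by (intro dim_span_eq_card_independent independent_empty)
    ultimately show ?thesis by simp
  qed
  show "dim (eigenspace p q c) = (if M = mat 1 then 2 else if trace M = 2 then 1 else 0)"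
    using one two zero by auto
  show "trace M = 2 \<Longrightarrow> \<exists>v\<in>eigenspace p q c. v \<noteq> 0"
    using one two by blast
qed

text \<open>At the first disagreement the smaller value is taken there by one sequence, while the
  other, being monotone, has already passed it and takes it less often.\<close>

lemma mono_enumeration_unique:
  fixes f g :: "nat \<Rightarrow> real"
  assumes f: "mono f" "\<And>c. finite {n. f n = c}" and g: "mono g" "\<And>c. finite {n. g n = c}"
    and card: "\<And>c. card {n. f n = c} = card {n. g n = c}"
  shows "f = g"
proof
  have step: "\<not> u n < v n" if eq: "\<And>i. i < n \<Longrightarrow> u i = v i" and fin: "\<And>c. finite {n. u n = c}"
    and mono: "mono v" and card: "\<And>c. card {n. u n = c} = card {n. v n = c}" for u v :: "nat \<Rightarrow> real" and n
  proof
    assume less: "u n < v n"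
    have "{i. v i = u n} \<subset> {i. u i = u n}"
    proof
      show "{i. v i = u n} \<subseteq> {i. u i = u n}"
      proof
        fix i assume "i \<in> {i. v i = u n}"
        then have i: "v i = u n" by simp
        then have "i < n"
          using less monoD[OF mono, of n i] by (metis linorder_not_less)
        then show "i \<in> {i. u i = u n}"
          using eq i by simp
      qed
      show "{i. v i = u n} \<noteq> {i. u i = u n}"
        using less by force
    qed
    then have "card {i. v i = u n} < card {i. u i = u n}"
      using fin by (intro psubset_card_mono)
    then show False
      using card by simp
  qed
  fix n
  show "f n = g n"
  proof (induction n rule: less_induct)
    case (less n)
    then show ?case
      using step[of n f g] step[of n g f] f g card by (metis linorder_neqE)
  qed
qed

section \<open>The Cartan chart\<close>

text \<open>To leave the interval the angle would have to pass a zero of the cosine. Branches on the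
  universal cover are pinned down in this way throughout.\<close>

lemma angle_stays_acute:
  fixes f :: "'a::topological_space \<Rightarrow> real"
  assumes "connected T" "continuous_on T f" "\<And>x. x \<in> T \<Longrightarrow> 0 < cos (f x)"
    and "x0 \<in> T" "\<bar>f x0\<bar> < pi/2" "x \<in> T"
  shows "\<bar>f x\<bar> < pi/2"
proof (rule ccontr)
  assume "\<not> \<bar>f x\<bar> < pi/2"
  then have *: "f x \<le> - (pi/2) \<or> pi/2 \<le> f x"
    by linarith
  have conn: "connected (f ` T)"
    using assms by (intro connected_continuous_image)
  have sub: "{f x..f x0} \<subseteq> f ` T" "{f x0..f x} \<subseteq> f ` T"
    using connected_contains_Icc[OF conn] assms(4,6) by blast+
  from * have "- (pi/2) \<in> f ` T \<or> pi/2 \<in> f ` T"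
    using sub assms(5) by (auto simp: subset_iff)
  then obtain y where "y \<in> T" "f y = - (pi/2) \<or> f y = pi/2"
    by auto
  then have "cos (f y) = 0"
    by (metis cos_minus cos_pi_half)
  then show False
    using assms(3)[OF \<open>y \<in> T\<close>] by simp
qed

lemma angle_stays_zero:
  fixes f :: "'a::topological_space \<Rightarrow> real"
  assumes "connected T" "continuous_on T f" "\<And>x. x \<in> T \<Longrightarrow> cos (f x) = 1"
    and "x0 \<in> T" "f x0 = 0" "x \<in> T"
  shows "f x = 0"
proof -
  have "\<bar>f x\<bar> < pi/2"
  proof (rule angle_stays_acute[OF assms(1,2) _ assms(4) _ assms(6)])
    show "0 < cos (f x)" if "x \<in> T" for x
      using assms(3)[OF that] by simp
    show "\<bar>f x0\<bar> < pi/2"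
      using assms(5) by simp
  qed
  then have "\<bar>f x\<bar> \<le> pi"
    using pi_ge_zero by linarith
  moreover have "cos \<bar>f x\<bar> = cos 0"
    using assms(3)[OF assms(6)] by (simp add: abs_if)
  ultimately have "\<bar>f x\<bar> = 0"
    by (intro cos_inj_pi[of "\<bar>f x\<bar>" 0]) simp_all
  then show ?thesis by simp
qed

text \<open>Keeps the direction of v and changes its length from norm v to h (norm v), when this is
  nonnegative; the value at the origin is 0. It replaces the polar angle, which is undefined
  there.\<close>

definition radial :: "(real \<Rightarrow> real) \<Rightarrow> real \<times> real \<Rightarrow> real \<times> real" where
  "radial h v = (h (norm v) / norm v) *\<^sub>R v"

lemma norm_radial:
  assumes "h 0 = 0"
  shows "norm (radial h v) = \<bar>h (norm v)\<bar>"
  using assms by (cases "v = 0") (auto simp: radial_def)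

lemma radial_0 [simp]: "radial h 0 = 0"
  by (simp add: radial_def)

lemma continuous_on_radial:
  assumes h: "continuous_on UNIV h" and h0: "h 0 = 0"
  shows "continuous_on UNIV (radial h)"
proof (rule continuous_at_imp_continuous_on, rule ballI)
  fix v :: "real \<times> real"
  have "continuous_on UNIV (\<lambda>v::real\<times>real. h (norm v))"
    by (rule continuous_on_compose2[OF h continuous_on_norm[OF continuous_on_id]]) simp
  then have hn: "isCont (\<lambda>v::real\<times>real. h (norm v)) v" for v
    by (simp only: continuous_on_eq_continuous_at[OF open_UNIV]) blast
  show "isCont (radial h) v"
  proof (cases "v = 0")
    case True
    have "isCont (\<lambda>v::real\<times>real. \<bar>h (norm v)\<bar>) 0"
      using hn by (rule isCont_rabs)
    then have "((\<lambda>v. \<bar>h (norm v)\<bar>) \<longlongrightarrow> 0) (at (0::real\<times>real))"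
      using h0 by (auto simp: isCont_def)
    then have "((\<lambda>v. norm (radial h v)) \<longlongrightarrow> 0) (at 0)"
      by (simp add: norm_radial[of h, OF h0])
    then show ?thesis
      using True by (simp add: isCont_def tendsto_norm_zero_iff)
  next
    case False
    have lim: "((\<lambda>v. h (norm v)) \<longlongrightarrow> h (norm v)) (at v)"
      using hn[of v] unfolding isCont_def .
    have "norm v \<noteq> 0"
      using False by simp
    from tendsto_scaleR[OF tendsto_divide[OF lim tendsto_norm[OF tendsto_ident_at] this] tendsto_ident_at]
    show ?thesis
      unfolding isCont_def radial_def .
  qed
qed

lemma radial_sinh_arsinh [simp]: "radial sinh (radial arsinh v) = v"
proof (cases "v = 0")
  case False
  then have pos: "arsinh (norm v) > 0"
    by simp
  then have "norm (radial arsinh v) = arsinh (norm v)"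
    using norm_radial[of arsinh v] by (simp only: arsinh_0 abs_of_pos)
  then have "radial sinh (radial arsinh v) = (norm v / arsinh (norm v)) *\<^sub>R ((arsinh (norm v) / norm v) *\<^sub>R v)"
    unfolding radial_def[of sinh] by (simp only: sinh_arsinh_real) (simp only: radial_def)
  then show ?thesis
    using False pos by simp
qed simp

text \<open>The matrix of the Cartan chart with the angle \<eta> eliminated: for v = (r cos \<eta>,
  r sin \<eta>), \<open>radial sinh v\<close> is (sinh r cos \<eta>, sinh r sin \<eta>). In this
  form it is visibly a continuous function of v.\<close>

definition cartan_mat :: "real \<Rightarrow> real \<times> real \<Rightarrow> real^2^2" where
  "cartan_mat \<alpha> v = mat2 (cos \<alpha>) (sin \<alpha>) (- sin \<alpha>) (cos \<alpha>) **
     mat2 (cosh (norm v) + fst (radial sinh v)) (snd (radial sinh v))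
       (snd (radial sinh v)) (cosh (norm v) - fst (radial sinh v))"

lemma cartan_mat:
  "cartan_mat \<alpha> v \<in> SL2" "half_norm (cartan_mat \<alpha> v) = cosh (norm v)" "angle_of (cartan_mat \<alpha> v) \<alpha>"
proof -
  have "(fst (radial sinh v))\<^sup>2 + (snd (radial sinh v))\<^sup>2 = (norm (radial sinh v))\<^sup>2"
    by (cases "radial sinh v") (simp add: norm_Pair)
  also have "\<dots> = (sinh (norm v))\<^sup>2"
    by (simp add: norm_radial)
  finally have "(cosh (norm v))\<^sup>2 = 1 + (fst (radial sinh v))\<^sup>2 + (snd (radial sinh v))\<^sup>2"
    by (simp add: cosh_square_eq)
  from polarI[OF cartan_mat_def this] show "cartan_mat \<alpha> v \<in> SL2" "half_norm (cartan_mat \<alpha> v) = cosh (norm v)" "angle_of (cartan_mat \<alpha> v) \<alpha>"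
    by auto
qed

lemma spread_cartan_mat: "spread (cartan_mat \<alpha> v) = arctan (sinh (norm v))"
  by (simp add: spread_def cartan_mat cosh_square_eq)

lemma norm_polar_coordinates: "norm (r * cos \<eta>, r * sin \<eta>) = \<bar>r\<bar>"
proof -
  have "(r * cos \<eta>)\<^sup>2 + (r * sin \<eta>)\<^sup>2 = r\<^sup>2"
    by (simp add: power_mult_distrib flip: distrib_left)
  then show ?thesis
    by (simp add: norm_Pair)
qed

lemma polar_coordinates:
  fixes v :: "real \<times> real"
  obtains r \<eta> where "0 \<le> r" "v = (r * cos \<eta>, r * sin \<eta>)"
proof -
  obtain x y where v: "v = (x, y)" by (cases v)
  obtain r a where "x = r * cos a" "y = r * sin a"
    using polar_Ex[of x y] by blast
  show ?thesis
  proof (cases "0 \<le> r")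
    case True
    then show ?thesis using that v \<open>x = r * cos a\<close> \<open>y = r * sin a\<close> by blast
  next
    case False
    then show ?thesis
      using that[of "- r" "a + pi"] v \<open>x = r * cos a\<close> \<open>y = r * sin a\<close> by (simp add: cos_add sin_add)
  qed
qed

lemma cartan_mat_polar_coordinates:
  "cartan_mat \<alpha> (r * cos \<eta>, r * sin \<eta>) =
     mat2 (cos \<alpha>) (sin \<alpha>) (- sin \<alpha>) (cos \<alpha>) **
     mat2 (cosh r + sinh r * cos \<eta>) (sinh r * sin \<eta>) (sinh r * sin \<eta>) (cosh r - sinh r * cos \<eta>)"
proof -
  have "radial sinh (r * cos \<eta>, r * sin \<eta>) = (sinh r * cos \<eta>, sinh r * sin \<eta>)"
    by (cases "r = 0") (auto simp: radial_def norm_polar_coordinates abs_if zero_prod_def[symmetric])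
  then show ?thesis
    by (simp add: cartan_mat_def norm_polar_coordinates abs_if)
qed

lemma continuous_on_cartan_mat:
  fixes \<alpha> :: "'a::t2_space \<Rightarrow> real"
  assumes "continuous_on T \<alpha>" "continuous_on T v"
  shows "continuous_on T (\<lambda>x. cartan_mat (\<alpha> x) (v x))"
proof -
  have r: "continuous_on T (\<lambda>x. radial sinh (v x))"
    using continuous_on_compose2[OF continuous_on_radial assms(2), of sinh] by (simp add: continuous_on_sinh)
  define p where "p x = fst (radial sinh (v x))" for x
  define q where "q x = snd (radial sinh (v x))" for x
  have pq: "continuous_on T p" "continuous_on T q"
    unfolding p_def q_def using r by (auto intro: continuous_on_fst continuous_on_snd)
  have c: "continuous_on T (\<lambda>x. cosh (norm (v x)))"
    using assms by (intro continuous_on_cosh continuous_on_norm)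
  show ?thesis
    unfolding cartan_mat_def mat2_mult p_def[symmetric] q_def[symmetric]
    using pq c assms(1)
    by (intro continuous_on_mat2 continuous_on_add continuous_on_mult continuous_on_diff continuous_on_cos
       continuous_on_sin continuous_on_minus)
qed

text \<open>The inverse of the Cartan chart once the angle is known: the pair (p, r) of
  \<open>angle_of_polar\<close> with its length sinh of the radius pulled back by arsinh.\<close>

definition cartan_vec :: "real^2^2 \<Rightarrow> real \<Rightarrow> real \<times> real" where
  "cartan_vec A \<alpha> = radial arsinh ((cos \<alpha> * (A$1$1 - A$2$2) - sin \<alpha> * (A$1$2 + A$2$1)) / 2,
     cos \<alpha> * A$1$2 - sin \<alpha> * A$2$2)"

lemma cartan_mat_vec:
  assumes "A \<in> SL2" "angle_of A \<alpha>"
  shows "cartan_mat \<alpha> (cartan_vec A \<alpha>) = A"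
proof -
  define p where "p = (cos \<alpha> * (A$1$1 - A$2$2) - sin \<alpha> * (A$1$2 + A$2$1)) / 2"
  define r where "r = cos \<alpha> * A$1$2 - sin \<alpha> * A$2$2"
  have pol: "polar A \<alpha> p r"
    using angle_of_polar[OF assms] unfolding p_def r_def .
  have v: "cartan_vec A \<alpha> = radial arsinh (p, r)"
    by (simp add: cartan_vec_def p_def r_def)
  have "(cosh (norm (cartan_vec A \<alpha>)))\<^sup>2 = 1 + (sinh (norm (cartan_vec A \<alpha>)))\<^sup>2"
    by (simp add: cosh_square_eq)
  also have "(sinh (norm (cartan_vec A \<alpha>)))\<^sup>2 = (norm (radial sinh (cartan_vec A \<alpha>)))\<^sup>2"
    by (simp add: norm_radial)
  also have "\<dots> = p\<^sup>2 + r\<^sup>2"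
    unfolding v by (simp add: norm_Pair)
  finally have "(cosh (norm (cartan_vec A \<alpha>)))\<^sup>2 = (half_norm A)\<^sup>2"
    unfolding polar_entries(5)[OF pol] by (simp only: add.assoc)
  then have "cosh (norm (cartan_vec A \<alpha>)) = half_norm A"
  proof (rule power2_eq_imp_eq)
    show "0 \<le> cosh (norm (cartan_vec A \<alpha>))" by simp
    show "0 \<le> half_norm A" using half_norm_ge_1[OF assms(1)] by linarith
  qed
  then show ?thesis
    using pol unfolding cartan_mat_def polar_def v by simp
qed

lemma continuous_on_cartan_vec:
  fixes \<alpha> :: "'a::t2_space \<Rightarrow> real"
  assumes "continuous_on T A" "continuous_on T \<alpha>"
  shows "continuous_on T (\<lambda>x. cartan_vec (A x) (\<alpha> x))"
proof -
  have "continuous_on UNIV (radial arsinh)"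
    by (intro continuous_on_radial continuous_on_arsinh continuous_on_id) (simp add: arsinh_real_def)
  then show ?thesis
    unfolding cartan_vec_def
    by (rule continuous_on_compose2) (use assms in \<open>auto intro!: continuous_intros\<close>)
qed

text \<open>Dividing by the square root of the determinant retracts an open set of matrices onto
  \<open>SL2\<close>. The property passes to the cover, where the continuous logarithm defining the
  angle requires it.\<close>

lemma locally_path_connected_SL2: "locally path_connected SL2"
proof (rule retract_of_locally_path_connected)
  let ?U = "{A :: real^2^2. det A > 0}"
  have contdet: "continuous_on UNIV (det :: real^2^2 \<Rightarrow> real)"
    unfolding det_2[abs_def] by (intro continuous_intros)
  have "open ?U"
    by (rule open_Collect_less[OF continuous_on_const contdet])
  then show "locally path_connected ?U"
    by (rule open_imp_locally_path_connected)
  show "SL2 retract_of ?U"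
    unfolding retract_of_def retraction_def
  proof (intro exI conjI)
    show "continuous_on ?U (\<lambda>A. (1 / sqrt (det A)) *\<^sub>R A)"
      using contdet by (intro continuous_on_scaleR continuous_on_divide continuous_on_real_sqrt
        continuous_on_const continuous_on_id) (auto intro: continuous_on_subset)
    show "(\<lambda>A. (1 / sqrt (det A)) *\<^sub>R A) \<in> ?U \<rightarrow> SL2"
    proof
      fix A :: "real^2^2" assume "A \<in> ?U"
      then have "det A > 0" by simp
      have "det (c *\<^sub>R A) = c\<^sup>2 * det A" for c
        by (simp add: det_2 power2_eq_square algebra_simps)
      then have "det ((1 / sqrt (det A)) *\<^sub>R A) = (1 / sqrt (det A))\<^sup>2 * det A" .
      also have "\<dots> = 1"
        using \<open>det A > 0\<close> by (simp add: power_divide)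
      finally show "(1 / sqrt (det A)) *\<^sub>R A \<in> SL2"
        by (simp add: SL2_def)
    qed
    show "\<forall>A\<in>SL2. (1 / sqrt (det A)) *\<^sub>R A = A"
      by (simp add: SL2_def)
  qed (auto simp: SL2_def)
qed

section \<open>Coordinates on the universal cover\<close>

locale SL2_cover =
  fixes G :: "('g::real_normed_vector, 'm) monoid_scheme" and pr :: "'g \<Rightarrow> real^2^2"
  assumes cover: "universal_cover_SL2 G pr"
begin

lemma group_G: "group G"
  and continuous_mult: "continuous_on (carrier G \<times> carrier G) (\<lambda>(x, y). x \<otimes>\<^bsub>G\<^esub> y)"
  and pr_mult: "\<And>x y. x \<in> carrier G \<Longrightarrow> y \<in> carrier G \<Longrightarrow> pr (x \<otimes>\<^bsub>G\<^esub> y) = pr x ** pr y"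
  and covering: "covering_space (carrier G) pr SL2"
  and simply_connected_G: "simply_connected (carrier G)"
  using cover unfolding universal_cover_SL2_def by blast+

sublocale group G
  by (rule group_G)

lemma continuous_pr: "continuous_on (carrier G) pr"
  using covering by (rule covering_space_imp_continuous)

lemma pr_SL2: "g \<in> carrier G \<Longrightarrow> pr g \<in> SL2"
  using covering_space_imp_surjective[OF covering] by blast

text \<open>Multiplicativity makes the image of the unit idempotent, and it is invertible, having
  determinant one.\<close>

lemma pr_one: "pr \<one>\<^bsub>G\<^esub> = mat 1"
proof -
  have idem: "pr \<one>\<^bsub>G\<^esub> ** pr \<one>\<^bsub>G\<^esub> = pr \<one>\<^bsub>G\<^esub>"
    using pr_mult[OF one_closed one_closed] l_one[OF one_closed] by simp
  have "det (pr \<one>\<^bsub>G\<^esub>) \<noteq> 0"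
    using pr_SL2[OF one_closed] by (simp add: SL2_def)
  then obtain B where B: "B ** pr \<one>\<^bsub>G\<^esub> = mat 1"
    using invertible_det_nz invertible_def by metis
  have "mat 1 = B ** (pr \<one>\<^bsub>G\<^esub> ** pr \<one>\<^bsub>G\<^esub>)"
    unfolding idem B ..
  also have "\<dots> = pr \<one>\<^bsub>G\<^esub>"
    unfolding matrix_mul_assoc B by simp
  finally show ?thesis ..
qed

lemma unique_lift:
  fixes f1 :: "'a::topological_space \<Rightarrow> 'g"
  assumes "connected T" "continuous_on T f1" "\<And>x. x \<in> T \<Longrightarrow> f1 x \<in> carrier G"
    "continuous_on T f2" "\<And>x. x \<in> T \<Longrightarrow> f2 x \<in> carrier G"
    "\<And>x. x \<in> T \<Longrightarrow> pr (f1 x) = pr (f2 x)" "a \<in> T" "f1 a = f2 a" "x \<in> T"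
  shows "f1 x = f2 x"
proof (rule covering_space_lift_unique[OF covering, of f1 a f2 T "\<lambda>x. pr (f1 x)" x])
  show "continuous_on T (\<lambda>x. pr (f1 x))"
    using assms(3) by (intro continuous_on_compose2[OF continuous_pr assms(2)]) blast
qed (use assms pr_SL2 in \<open>blast+\<close>)

lemma lift_exists:
  fixes f :: "'c::real_normed_vector \<Rightarrow> real^2^2"
  assumes "convex U" "z \<in> U" "continuous_on U f" "\<And>x. x \<in> U \<Longrightarrow> f x \<in> SL2" "f z = mat 1"
  obtains g where "continuous_on U g" "\<And>x. x \<in> U \<Longrightarrow> g x \<in> carrier G" "g z = \<one>\<^bsub>G\<^esub>"
    "\<And>x. x \<in> U \<Longrightarrow> pr (g x) = f x"
proof (rule covering_space_lift_strong[OF covering one_closed assms(2)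
      convex_imp_simply_connected[OF assms(1)] convex_imp_locally_path_connected[OF assms(1)] assms(3)])
  show "f \<in> U \<rightarrow> SL2"
    using assms(4) by blast
  show "f z = pr \<one>\<^bsub>G\<^esub>"
    using assms(5) pr_one by simp
  fix g assume "continuous_on U g" "g \<in> U \<rightarrow> carrier G" "g z = \<one>\<^bsub>G\<^esub>" "\<And>x. x \<in> U \<Longrightarrow> pr (g x) = f x"
  then show thesis
    by (intro that[of g]) blast+
qed

definition ang :: "'g \<Rightarrow> real" where
  "ang = (SOME f. continuous_on (carrier G) f \<and> f \<one>\<^bsub>G\<^esub> = 0 \<and> (\<forall>g\<in>carrier G. angle_of (pr g) (f g)))"

text \<open>The complex number formed from \<open>trace\<close> and \<open>skew\<close> has modulus
  at least 2, so on the simply connected cover it has a continuous logarithm. The imaginary part,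
  shifted to vanish at the unit, is the angle.\<close>

lemma ang_spec: "continuous_on (carrier G) ang \<and> ang \<one>\<^bsub>G\<^esub> = 0 \<and> (\<forall>g\<in>carrier G. angle_of (pr g) (ang g))"
proof -
  have cc: "continuous_on (carrier G) (\<lambda>g. pr g $ i $ j)" for i j
    using continuous_pr by (intro continuous_on_component)
  have cont: "continuous_on (carrier G) (\<lambda>g. Complex (trace (pr g)) (skew (pr g)))"
    unfolding trace_2 skew_def Complex_eq
    by (intro continuous_on_add continuous_on_mult continuous_on_of_real continuous_on_diff continuous_on_const cc)
  have lpc: "locally path_connected (carrier G)"
    using covering_space_locally_path_connected_eq[OF covering] locally_path_connected_SL2 by blast
  have norm: "norm (Complex (trace (pr g)) (skew (pr g))) = 2 * half_norm (pr g)" for g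
    by (simp add: half_norm_def cmod_def)
  have nz: "Complex (trace (pr g)) (skew (pr g)) \<noteq> 0" if "g \<in> carrier G" for g
    using half_norm_ge_1[OF pr_SL2[OF that]] norm[of g] by auto
  obtain l where l: "continuous_on (carrier G) l" "\<And>g. g \<in> carrier G \<Longrightarrow> Complex (trace (pr g)) (skew (pr g)) = exp (l g)"
    using continuous_logarithm_on_simply_connected[OF cont simply_connected_G lpc nz] by blast
  have parts: "trace (pr g) = 2 * half_norm (pr g) * cos (Im (l g))" "skew (pr g) = 2 * half_norm (pr g) * sin (Im (l g))"
    if "g \<in> carrier G" for g
  proof -
    have "2 * half_norm (pr g) = exp (Re (l g))"
      using norm[of g] l(2)[OF that] by (simp add: norm_exp_eq_Re)
    then show "trace (pr g) = 2 * half_norm (pr g) * cos (Im (l g))" "skew (pr g) = 2 * half_norm (pr g) * sin (Im (l g))"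
      using arg_cong[OF l(2)[OF that], of Re] arg_cong[OF l(2)[OF that], of Im] by (simp_all add: Re_exp Im_exp)
  qed
  have h1: "half_norm (pr \<one>\<^bsub>G\<^esub>) = 1"
    unfolding pr_one mat_1_mat2 by (simp add: half_norm_def trace_2 skew_def)
  have c1: "cos (Im (l \<one>\<^bsub>G\<^esub>)) = 1" "sin (Im (l \<one>\<^bsub>G\<^esub>)) = 0"
    using parts[OF one_closed] unfolding h1 unfolding pr_one mat_1_mat2 by (simp_all add: trace_2 skew_def)
  define f where "f g = Im (l g) - Im (l \<one>\<^bsub>G\<^esub>)" for g
  have "continuous_on (carrier G) f"
    unfolding f_def using l(1) by (intro continuous_on_diff continuous_on_Im continuous_on_const)
  moreover have "angle_of (pr g) (f g)" if "g \<in> carrier G" for g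
    using parts[OF that] by (simp add: angle_of_def f_def cos_diff sin_diff c1)
  ultimately have "continuous_on (carrier G) f \<and> f \<one>\<^bsub>G\<^esub> = 0 \<and> (\<forall>g\<in>carrier G. angle_of (pr g) (f g))"
    by (simp add: f_def)
  then have "\<exists>f. continuous_on (carrier G) f \<and> f \<one>\<^bsub>G\<^esub> = 0 \<and> (\<forall>g\<in>carrier G. angle_of (pr g) (f g))"
    by blast
  then show ?thesis
    unfolding ang_def by (rule someI_ex)
qed

lemma ang_one: "ang \<one>\<^bsub>G\<^esub> = 0"
  and continuous_ang: "continuous_on (carrier G) ang"
  and angle_ang: "\<And>g. g \<in> carrier G \<Longrightarrow> angle_of (pr g) (ang g)"
  using ang_spec by blast+

lemma continuous_pr_comp:
  assumes "continuous_on T h" "\<And>x. x \<in> T \<Longrightarrow> h x \<in> carrier G"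
  shows "continuous_on T (\<lambda>x. pr (h x))" "continuous_on T (\<lambda>x. ang (h x))"
  using assms(2) continuous_on_compose2[OF continuous_pr assms(1)] continuous_on_compose2[OF continuous_ang assms(1)]
  by blast+

text \<open>The expression assumed positive is 2 \<open>half_norm\<close> times cos (ang -
  \<theta>), so the angle can never drift a right angle away from \<theta>. This finds the branch
  from approximate knowledge of the matrices.\<close>

lemma ang_close:
  fixes h :: "'a::t2_space \<Rightarrow> 'g"
  assumes "connected T" "continuous_on T h" "\<And>x. x \<in> T \<Longrightarrow> h x \<in> carrier G" "continuous_on T \<theta>"
    "\<And>x. x \<in> T \<Longrightarrow> 0 < trace (pr (h x)) * cos (\<theta> x) + skew (pr (h x)) * sin (\<theta> x)"
    "x0 \<in> T" "\<bar>ang (h x0) - \<theta> x0\<bar> < pi/2" "x \<in> T"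
  shows "\<bar>ang (h x) - \<theta> x\<bar> < pi/2"
proof (rule angle_stays_acute[of T "\<lambda>x. ang (h x) - \<theta> x", OF assms(1) _ _ assms(6,7,8)])
  show "continuous_on T (\<lambda>x. ang (h x) - \<theta> x)"
    using continuous_pr_comp[OF assms(2,3)] assms(4) by (intro continuous_on_diff)
  fix x assume x: "x \<in> T"
  have "trace (pr (h x)) * cos (\<theta> x) + skew (pr (h x)) * sin (\<theta> x) = 2 * half_norm (pr (h x)) * cos (ang (h x) - \<theta> x)"
    using angle_ang[OF assms(3)[OF x]] by (simp add: angle_of_def cos_diff algebra_simps)
  then have "0 < (2 * half_norm (pr (h x))) * cos (ang (h x) - \<theta> x)"
    using assms(5)[OF x] by simp
  moreover have "0 < 2 * half_norm (pr (h x))"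
    using half_norm_ge_1[OF pr_SL2[OF assms(3)[OF x]]] by simp
  ultimately show "0 < cos (ang (h x) - \<theta> x)"
    by (simp only: zero_less_mult_pos)
qed

lemma angle_of_unique:
  assumes "A \<in> SL2" "angle_of A \<alpha>" "angle_of A \<beta>"
  shows "cos \<alpha> = cos \<beta>" "sin \<alpha> = sin \<beta>"
  using assms(2,3) half_norm_ge_1[OF assms(1)] by (simp_all add: angle_of_def)

lemma ang_unique:
  fixes h :: "'a::t2_space \<Rightarrow> 'g"
  assumes "connected T" "continuous_on T h" "\<And>x. x \<in> T \<Longrightarrow> h x \<in> carrier G" "continuous_on T \<theta>"
    "\<And>x. x \<in> T \<Longrightarrow> angle_of (pr (h x)) (\<theta> x)" "x0 \<in> T" "ang (h x0) = \<theta> x0" "x \<in> T"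
  shows "ang (h x) = \<theta> x"
proof -
  have "ang (h x) - \<theta> x = 0"
  proof (rule angle_stays_zero[OF assms(1) _ _ assms(6) _ assms(8)])
    show "continuous_on T (\<lambda>x. ang (h x) - \<theta> x)"
      using continuous_pr_comp[OF assms(2,3)] assms(4) by (intro continuous_on_diff)
    show "ang (h x0) - \<theta> x0 = 0"
      using assms(7) by simp
    fix x assume x: "x \<in> T"
    show "cos (ang (h x) - \<theta> x) = 1"
      unfolding cos_diff using angle_of_unique[OF pr_SL2[OF assms(3)[OF x]] angle_ang[OF assms(3)[OF x]] assms(5)[OF x]]
        sin_cos_squared_add3[of "\<theta> x"] by simp
  qed
  then show ?thesis by simp
qed

text \<open>\<open>phiC\<close> is a definite description in polar coordinates. Existence comes from
  lifting \<open>cartan_mat\<close>, which has no polar angle, and uniqueness from uniqueness of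
  lifts, as every v has polar coordinates.\<close>

lemma phiC_spec:
  "continuous_on UNIV (phiC G pr) \<and> range (phiC G pr) \<subseteq> carrier G \<and> phiC G pr (0, 0, 0) = \<one>\<^bsub>G\<^esub> \<and>
   (\<forall>\<alpha> r \<eta>. pr (phiC G pr (\<alpha>, r * cos \<eta>, r * sin \<eta>)) = cartan_mat \<alpha> (r * cos \<eta>, r * sin \<eta>))"
proof -
  let ?P = "\<lambda>\<phi> :: real \<times> real \<times> real \<Rightarrow> 'g. continuous_on UNIV \<phi> \<and> range \<phi> \<subseteq> carrier G \<and> \<phi> (0, 0, 0) = \<one>\<^bsub>G\<^esub> \<and>
   (\<forall>\<alpha> r \<eta>. pr (\<phi> (\<alpha>, r * cos \<eta>, r * sin \<eta>)) = cartan_mat \<alpha> (r * cos \<eta>, r * sin \<eta>))"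
  have eq: "phiC G pr = (THE \<phi>. ?P \<phi>)"
    unfolding phiC_def cartan_mat_polar_coordinates ..
  have all: "pr (\<phi> a) = cartan_mat (fst a) (snd a)" if "?P \<phi>" for \<phi> a
  proof -
    obtain r \<eta> where "snd a = (r * cos \<eta>, r * sin \<eta>)"
      using polar_coordinates[of "snd a"] by blast
    then have "a = (fst a, r * cos \<eta>, r * sin \<eta>)"
      by (metis prod.collapse)
    with that \<open>snd a = (r * cos \<eta>, r * sin \<eta>)\<close> show ?thesis
      by metis
  qed
  have "\<exists>\<phi>. ?P \<phi>"
  proof -
    have z: "cartan_mat (fst (0, 0, 0::real)) (snd (0::real, 0, 0)) = mat 1"
    proof -
      have "(0::real, 0::real) = 0" by (simp add: zero_prod_def)
      then show ?thesis
        by (simp add: cartan_mat_def mat2_mult mat_1_mat2)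
    qed
    obtain \<phi> :: "real \<times> real \<times> real \<Rightarrow> 'g" where "continuous_on UNIV \<phi>" "\<And>x. x \<in> UNIV \<Longrightarrow> \<phi> x \<in> carrier G"
        "\<phi> (0, 0, 0) = \<one>\<^bsub>G\<^esub>" "\<And>x. x \<in> UNIV \<Longrightarrow> pr (\<phi> x) = cartan_mat (fst x) (snd x)"
      using lift_exists[of UNIV "(0,0,0)" "\<lambda>a. cartan_mat (fst a) (snd a)", OF convex_UNIV UNIV_I
         continuous_on_cartan_mat[OF continuous_on_fst[OF continuous_on_id] continuous_on_snd[OF continuous_on_id]]
         cartan_mat(1) z] by blast
    then have "?P \<phi>"
      by auto
    then show ?thesis
      by (intro exI[of _ \<phi>])
  qed
  then obtain \<phi> where \<phi>: "?P \<phi>" by blast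
  have "?P (THE \<phi>. ?P \<phi>)"
  proof (rule theI[of ?P, OF \<phi>])
    fix \<psi> assume \<psi>: "?P \<psi>"
    show "\<psi> = \<phi>"
    proof
      fix a
      show "\<psi> a = \<phi> a"
      proof (rule unique_lift[of UNIV \<psi> \<phi> "(0, 0, 0)" a])
        show "pr (\<psi> x) = pr (\<phi> x)" for x
          using all[OF \<phi>] all[OF \<psi>] by simp
        show "\<psi> (0,0,0) = \<phi> (0,0,0)"
          using \<phi> \<psi> by simp
      qed (use \<phi> \<psi> in auto)
    qed
  qed
  then show ?thesis
    unfolding eq .
qed

lemma continuous_phiC: "continuous_on UNIV (phiC G pr)"
  and phiC_carrier [simp]: "phiC G pr a \<in> carrier G"
  and phiC_0: "phiC G pr (0, 0, 0) = \<one>\<^bsub>G\<^esub>"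
  using phiC_spec by blast+

lemma pr_phiC: "pr (phiC G pr (\<alpha>, v)) = cartan_mat \<alpha> v"
proof -
  obtain r \<eta> where "v = (r * cos \<eta>, r * sin \<eta>)"
    using polar_coordinates[of v] by blast
  then show ?thesis
    using phiC_spec by blast
qed

lemma ang_phiC: "ang (phiC G pr (\<alpha>, v)) = \<alpha>"
proof -
  have "ang (phiC G pr (\<alpha>, v)) = fst (\<alpha>, v)"
  proof (rule ang_unique[of UNIV "phiC G pr" fst "(0,0,0)"])
    show "angle_of (pr (phiC G pr x)) (fst x)" for x
      using pr_phiC[of "fst x" "snd x"] cartan_mat(3)[of "fst x" "snd x"] by simp
    show "ang (phiC G pr (0, 0, 0)) = fst (0, 0, 0::real)"
      by (simp add: phiC_0 ang_one)
  qed (auto intro: continuous_phiC continuous_on_fst continuous_on_id)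
  then show ?thesis by simp
qed

text \<open>Along a path from the unit to g, the path itself and the chart applied to its angle and
  Cartan vector are two lifts of the same matrix path with the same start, so they end at the same
  point.\<close>

lemma phiC_surj:
  assumes "g \<in> carrier G"
  shows "g = phiC G pr (ang g, cartan_vec (pr g) (ang g))"
proof -
  have "path_connected (carrier G)"
    using simply_connected_G by (rule simply_connected_imp_path_connected)
  then obtain \<gamma> where \<gamma>: "path \<gamma>" "path_image \<gamma> \<subseteq> carrier G" "pathstart \<gamma> = \<one>\<^bsub>G\<^esub>" "pathfinish \<gamma> = g"
    using assms one_closed unfolding path_connected_def by blast
  have cont: "continuous_on {0..1} \<gamma>" and car: "\<And>t. t \<in> {0..1} \<Longrightarrow> \<gamma> t \<in> carrier G"
    using \<gamma> by (auto simp: path_def path_image_def)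
  note c = continuous_pr_comp[OF cont car]
  have "phiC G pr (ang (\<gamma> 1), cartan_vec (pr (\<gamma> 1)) (ang (\<gamma> 1))) = \<gamma> 1"
  proof (rule unique_lift[of "{0..1}" _ \<gamma> 0])
    show "continuous_on {0..1} (\<lambda>t. phiC G pr (ang (\<gamma> t), cartan_vec (pr (\<gamma> t)) (ang (\<gamma> t))))"
      by (rule continuous_on_compose2[OF continuous_phiC continuous_on_Pair[OF c(2) continuous_on_cartan_vec[OF c]]]) auto
    show "pr (phiC G pr (ang (\<gamma> t), cartan_vec (pr (\<gamma> t)) (ang (\<gamma> t)))) = pr (\<gamma> t)" if "t \<in> {0..1}" for t
      unfolding pr_phiC using cartan_mat_vec[OF pr_SL2 angle_ang] car[OF that] by blast
    have "\<gamma> 0 = \<one>\<^bsub>G\<^esub>"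
      using \<gamma>(3) by (simp add: pathstart_def)
    moreover have "cartan_vec (mat 1) 0 = (0, 0)"
      unfolding mat_1_mat2 cartan_vec_def by (simp add: zero_prod_def[symmetric])
    ultimately show "phiC G pr (ang (\<gamma> 0), cartan_vec (pr (\<gamma> 0)) (ang (\<gamma> 0))) = \<gamma> 0"
      by (simp add: ang_one pr_one phiC_0)
  qed (use cont car in auto)
  then show ?thesis
    using \<gamma>(4) by (simp add: pathfinish_def)
qed

lemma pr_ang_inj:
  assumes "g \<in> carrier G" "h \<in> carrier G" "pr g = pr h" "ang g = ang h"
  shows "g = h"
  using phiC_surj[OF assms(1)] phiC_surj[OF assms(2)] assms(3,4) by simp

lemma cartan_strip_iff:
  assumes "g \<in> carrier G"
  shows "g \<in> cartan_strip G pr n \<longleftrightarrow> of_int n * pi - pi/2 < ang g \<and> ang g < of_int n * pi + pi/2"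
proof
  assume "g \<in> cartan_strip G pr n"
  then show "of_int n * pi - pi/2 < ang g \<and> ang g < of_int n * pi + pi/2"
    by (auto simp: cartan_strip_def ang_phiC)
next
  assume *: "of_int n * pi - pi/2 < ang g \<and> ang g < of_int n * pi + pi/2"
  show "g \<in> cartan_strip G pr n"
    unfolding cartan_strip_def by (subst phiC_surj[OF assms], rule imageI) (use * in auto)
qed

text \<open>As functions of \<theta> both sides lift the rotation by k \<theta>, and they agree at
  \<theta> = 0.\<close>

lemma phiC_rotation_pow: "phiC G pr (\<theta>, 0, 0) [^]\<^bsub>G\<^esub> k = phiC G pr (real k * \<theta>, 0, 0)"
proof -
  have rot: "cartan_mat \<alpha> (0, 0) = mat2 (cos \<alpha>) (sin \<alpha>) (- sin \<alpha>) (cos \<alpha>)" for \<alpha>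
  proof -
    have "(0::real, 0::real) = 0" by (simp add: zero_prod_def)
    then show ?thesis
      by (simp add: cartan_mat_def mat2_mult)
  qed
  have c: "continuous_on UNIV (\<lambda>t::real. phiC G pr (t, 0, 0))"
    by (rule continuous_on_compose2[OF continuous_phiC, of _ "\<lambda>t. (t, 0, 0)"]) (auto intro!: continuous_intros)
  have cont: "continuous_on UNIV (\<lambda>t::real. phiC G pr (t, 0, 0) [^]\<^bsub>G\<^esub> k)" for k :: nat
  proof (induction k)
    case (Suc k)
    have "continuous_on UNIV (\<lambda>t. (\<lambda>(x, y). x \<otimes>\<^bsub>G\<^esub> y) (phiC G pr (t, 0, 0) [^]\<^bsub>G\<^esub> k, phiC G pr (t, 0, 0)))"
      by (rule continuous_on_compose2[OF continuous_mult continuous_on_Pair[OF Suc c]]) auto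
    then show ?case by simp
  qed simp
  have prk: "pr (phiC G pr (t, 0, 0) [^]\<^bsub>G\<^esub> k) = mat2 (cos (real k * t)) (sin (real k * t)) (- sin (real k * t)) (cos (real k * t))" for k :: nat and t
  proof (induction k)
    case 0
    then show ?case by (simp add: pr_one mat_1_mat2)
  next
    case (Suc k)
    have "pr (phiC G pr (t, 0, 0) [^]\<^bsub>G\<^esub> Suc k) = pr (phiC G pr (t, 0, 0) [^]\<^bsub>G\<^esub> k) ** cartan_mat t (0, 0)"
      using pr_mult[of "phiC G pr (t, 0, 0) [^]\<^bsub>G\<^esub> k" "phiC G pr (t, 0, 0)"] by (simp add: pr_phiC)
    also have "\<dots> = mat2 (cos (real k * t + t)) (sin (real k * t + t)) (- sin (real k * t + t)) (cos (real k * t + t))"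
      unfolding Suc rot mat2_mult cos_add sin_add by (simp add: algebra_simps)
    finally show ?case
      by (simp add: algebra_simps)
  qed
  show ?thesis
  proof (rule unique_lift[of UNIV "\<lambda>\<theta>. phiC G pr (\<theta>, 0, 0) [^]\<^bsub>G\<^esub> k" "\<lambda>\<theta>. phiC G pr (real k * \<theta>, 0, 0)" 0])
    show "continuous_on UNIV (\<lambda>\<theta>. phiC G pr (real k * \<theta>, 0, 0))"
      by (rule continuous_on_compose2[OF continuous_phiC, of _ "\<lambda>t. (real k * t, 0, 0)"]) (auto intro!: continuous_intros)
    show "pr (phiC G pr (\<theta>, 0, 0) [^]\<^bsub>G\<^esub> k) = pr (phiC G pr (real k * \<theta>, 0, 0))" for \<theta>
      unfolding prk pr_phiC rot ..
  qed (use cont in \<open>auto simp: phiC_0\<close>)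
qed

lemma iota_pow: "iota G pr [^]\<^bsub>G\<^esub> k = phiC G pr (real k * pi, 0, 0)"
  unfolding iota_def by (rule phiC_rotation_pow)

end

section \<open>Extreme displacements and the sheets of trace two\<close>

context SL2_cover
begin

definition dsp :: "'g \<Rightarrow> real \<Rightarrow> real" where
  "dsp g \<phi> = disp (ang g) (pr g) \<phi>"

definition lo :: "'g \<Rightarrow> real" where
  "lo g = ang g - spread (pr g)"

definition hi :: "'g \<Rightarrow> real" where
  "hi g = ang g + spread (pr g)"

lemma dsp_bounds:
  assumes "g \<in> carrier G"
  shows "lo g \<le> dsp g \<phi>" "dsp g \<phi> \<le> hi g" "\<exists>\<phi>. dsp g \<phi> = lo g" "\<exists>\<phi>. dsp g \<phi> = hi g"
  using disp_bounds[OF pr_SL2[OF assms] angle_ang[OF assms]] unfolding lo_def hi_def dsp_def by blast+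

lemma dsp_direction:
  assumes "g \<in> carrier G"
  obtains \<rho> where "\<rho> > 0" "pr g$1$1 * sin \<phi> + pr g$1$2 * cos \<phi> = \<rho> * sin (\<phi> + dsp g \<phi>)"
    "pr g$2$1 * sin \<phi> + pr g$2$2 * cos \<phi> = \<rho> * cos (\<phi> + dsp g \<phi>)"
  using disp_direction[OF pr_SL2[OF assms] angle_ang[OF assms]] unfolding dsp_def by blast

lemma lo_hi:
  assumes "g \<in> carrier G"
  shows "lo g \<le> hi g" "hi g < lo g + pi" "lo g = hi g \<Longrightarrow> lo g = ang g"
  using spread_range[OF pr_SL2[OF assms]] unfolding lo_def hi_def by linarith+

lemma continuous_half_norm:
  fixes A :: "'a::t2_space \<Rightarrow> real^2^2"
  assumes "continuous_on T A"
  shows "continuous_on T (\<lambda>x. half_norm (A x))"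
  unfolding half_norm_def trace_2 skew_def
  by (intro continuous_on_divide continuous_on_real_sqrt continuous_on_add continuous_on_power
     continuous_on_diff continuous_on_component continuous_on_const assms) simp

lemma continuous_lo_hi:
  fixes h :: "'a::t2_space \<Rightarrow> 'g"
  assumes "continuous_on T h" "\<And>x. x \<in> T \<Longrightarrow> h x \<in> carrier G"
  shows "continuous_on T (\<lambda>x. lo (h x))" "continuous_on T (\<lambda>x. hi (h x))" "continuous_on T (\<lambda>x. dsp (h x) \<phi>)"
proof -
  note c = continuous_pr_comp[OF assms]
  have "continuous_on T (\<lambda>x. spread (pr (h x)))"
    unfolding spread_def
    by (intro continuous_on_arctan continuous_on_real_sqrt continuous_on_diff continuous_on_power
       continuous_half_norm continuous_on_const c(1))
  then show "continuous_on T (\<lambda>x. lo (h x))" "continuous_on T (\<lambda>x. hi (h x))"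
    unfolding lo_def hi_def using c(2) by (auto intro: continuous_on_diff continuous_on_add)
  show "continuous_on T (\<lambda>x. dsp (h x) \<phi>)"
    unfolding dsp_def using c(2,1)
    by (rule continuous_on_disp) (use assms(2) pr_SL2 angle_ang in blast)+
qed

lemma lo_iff:
  assumes "g \<in> carrier G"
  shows "lo g = 2 * of_int k * pi \<longleftrightarrow> g \<in> trace_level G pr 2 \<inter> cartan_strip G pr (2 * k) \<and> 2 * of_int k * pi \<le> ang g"
  using upper_sheet_iff[OF pr_SL2[OF assms] angle_ang[OF assms], of k] assms pi_gt_zero
  by (auto simp: trace_level_def cartan_strip_iff lo_def)

lemma hi_iff:
  assumes "g \<in> carrier G"
  shows "hi g = 2 * of_int k * pi \<longleftrightarrow> g \<in> trace_level G pr 2 \<inter> cartan_strip G pr (2 * k) \<and> ang g \<le> 2 * of_int k * pi"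
  using lower_sheet_iff[OF pr_SL2[OF assms] angle_ang[OF assms], of k] assms pi_gt_zero
  by (auto simp: trace_level_def cartan_strip_iff hi_def)

lemma trace_2_imp_lo_hi:
  assumes "g \<in> carrier G" "trace (pr g) = 2"
  obtains k :: int where "lo g = 2 * of_int k * pi \<or> hi g = 2 * of_int k * pi"
proof -
  have "cos (ang g) = cos (spread (pr g))"
    using trace_eq_2_iff[OF pr_SL2[OF assms(1)] angle_ang[OF assms(1)]] assms(2) by simp
  then obtain k where "k \<in> \<int>" "ang g = spread (pr g) + 2 * k * pi \<or> ang g = - spread (pr g) + 2 * k * pi"
    unfolding cos_eq by blast
  moreover from this(1) obtain z where "k = of_int z"
    by (elim Ints_cases)
  ultimately have "lo g = 2 * of_int z * pi \<or> hi g = 2 * of_int z * pi"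
    unfolding lo_def hi_def by auto
  then show ?thesis
    using that by blast
qed

text \<open>One formula for both sheets: the spread is arctan |sinh r|, so \<open>lo\<close> is
  constant for nonnegative r and \<open>hi\<close> for nonpositive r, with the apex at r = 0. A
  signed radius makes the double cone a single continuous image.\<close>

definition sheet_point :: "int \<Rightarrow> real \<Rightarrow> real \<Rightarrow> 'g" where
  "sheet_point k r \<eta> = phiC G pr (2 * of_int k * pi + arctan (sinh r), r * cos \<eta>, r * sin \<eta>)"

lemma sheet_point:
  "sheet_point k r \<eta> \<in> carrier G" "ang (sheet_point k r \<eta>) = 2 * of_int k * pi + arctan (sinh r)"
  "spread (pr (sheet_point k r \<eta>)) = arctan \<bar>sinh r\<bar>"
  by (simp_all add: sheet_point_def ang_phiC pr_phiC spread_cartan_mat norm_polar_coordinates)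

lemma continuous_sheet_point:
  fixes r \<eta> :: "'a::t2_space \<Rightarrow> real"
  assumes "continuous_on T r" "continuous_on T \<eta>"
  shows "continuous_on T (\<lambda>x. sheet_point k (r x) (\<eta> x))"
  unfolding sheet_point_def
  by (rule continuous_on_compose2[OF continuous_phiC])
    (intro continuous_on_Pair continuous_on_add continuous_on_const continuous_on_arctan continuous_on_sinh
      continuous_on_mult continuous_on_cos continuous_on_sin assms, simp)

lemma lo_hi_sheet_point:
  "0 \<le> r \<Longrightarrow> lo (sheet_point k r \<eta>) = 2 * of_int k * pi"
  "r \<le> 0 \<Longrightarrow> hi (sheet_point k r \<eta>) = 2 * of_int k * pi"
  by (auto simp: lo_def hi_def sheet_point abs_if arctan_minus)

lemma lo_sheet:
  assumes "g \<in> carrier G" "lo g = 2 * of_int k * pi"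
  obtains r \<eta> where "0 \<le> r" "g = sheet_point k r \<eta>"
proof -
  obtain r \<eta> where r: "0 \<le> r" and v: "cartan_vec (pr g) (ang g) = (r * cos \<eta>, r * sin \<eta>)"
    using polar_coordinates by blast
  have g: "g = phiC G pr (ang g, r * cos \<eta>, r * sin \<eta>)"
    using phiC_surj[OF assms(1)] v by simp
  have "pr g = cartan_mat (ang g) (r * cos \<eta>, r * sin \<eta>)"
    by (subst g) (rule pr_phiC)
  then have "spread (pr g) = arctan (sinh r)"
    using r by (simp add: spread_cartan_mat norm_polar_coordinates)
  then have "ang g = 2 * of_int k * pi + arctan (sinh r)"
    using assms(2) by (simp add: lo_def)
  then have "g = sheet_point k r \<eta>"
    using g by (simp add: sheet_point_def)
  with r that show ?thesis by blast
qed

lemma hi_sheet: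
  assumes "g \<in> carrier G" "hi g = 2 * of_int k * pi"
  obtains r \<eta> where "r \<le> 0" "g = sheet_point k r \<eta>"
proof -
  obtain r \<eta> where r: "0 \<le> r" and v: "cartan_vec (pr g) (ang g) = (r * cos \<eta>, r * sin \<eta>)"
    using polar_coordinates by blast
  \<comment> \<open>The lower sheet has negative radius; turning \<eta> by pi compensates for the
    sign.\<close>
  have g: "g = phiC G pr (ang g, (- r) * cos (\<eta> + pi), (- r) * sin (\<eta> + pi))"
    using phiC_surj[OF assms(1)] v by (simp add: cos_add sin_add)
  have "pr g = cartan_mat (ang g) ((- r) * cos (\<eta> + pi), (- r) * sin (\<eta> + pi))"
    by (subst g) (rule pr_phiC)
  then have "spread (pr g) = arctan (sinh r)"
    using r unfolding spread_cartan_mat norm_polar_coordinates by (simp add: spread_cartan_mat norm_polar_coordinates)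
  then have "ang g = 2 * of_int k * pi + arctan (sinh (- r))"
    using assms(2) by (simp add: hi_def arctan_minus)
  then have "g = sheet_point k (- r) (\<eta> + pi)"
    using g by (simp add: sheet_point_def)
  with r that[of "- r"] show ?thesis by simp
qed

lemma sheet_point_0: "sheet_point (int k) 0 \<eta> = iota G pr [^]\<^bsub>G\<^esub> (2 * k)"
  unfolding iota_pow by (simp add: sheet_point_def)

lemma sheet_point_in:
  "sheet_point k r \<eta> \<in> trace_level G pr 2 \<inter> cartan_strip G pr (2 * k)"
proof (cases "0 \<le> r")
  case True
  then show ?thesis
    using lo_iff[OF sheet_point(1)] lo_hi_sheet_point(1) by blast
next
  case False
  then show ?thesis
    using hi_iff[OF sheet_point(1)] lo_hi_sheet_point(2) by (meson nle_le)
qed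

lemma sheet_cases:
  assumes "g \<in> trace_level G pr 2 \<inter> cartan_strip G pr (2 * k)"
  shows "lo g = 2 * of_int k * pi \<or> hi g = 2 * of_int k * pi"
proof -
  have "g \<in> carrier G"
    using assms by (auto simp: trace_level_def)
  then show ?thesis
    using lo_iff[of g k] hi_iff[of g k] assms by linarith
qed

text \<open>Shrinking r to 0 along the sheet joins g to the unit inside the trace level.\<close>

lemma T20_lo:
  assumes "g \<in> carrier G" "lo g = 0"
  shows "g \<in> T20 G pr"
proof -
  obtain r \<eta> where r: "0 \<le> r" and g: "g = sheet_point 0 r \<eta>"
    using lo_sheet[of g 0] assms by auto
  let ?S = "(\<lambda>t. sheet_point 0 t \<eta>) ` {0..r}"
  have "connected ?S"
    by (intro connected_continuous_image continuous_sheet_point continuous_on_id continuous_on_const connected_Icc)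
  moreover have "?S \<subseteq> trace_level G pr 2"
    using sheet_point_in by blast
  moreover have "\<one>\<^bsub>G\<^esub> \<in> ?S"
  proof
    show "\<one>\<^bsub>G\<^esub> = sheet_point 0 0 \<eta>"
      using sheet_point_0[of 0 \<eta>] by simp
  qed (use r in simp)
  moreover have "g \<in> ?S"
    using g r by auto
  ultimately show ?thesis
    unfolding T20_def using connected_component_def by blast
qed

text \<open>On the trace level the cosine of the angle is the inverse of \<open>half_norm\<close>,
  hence positive, so a connected set through the unit keeps its angle within pi/2 of 0.\<close>

lemma T20_subset: "T20 G pr \<subseteq> trace_level G pr 2 \<inter> cartan_strip G pr 0"
proof
  fix g assume g: "g \<in> T20 G pr"
  have sub: "T20 G pr \<subseteq> trace_level G pr 2"
    unfolding T20_def by (rule connected_component_subset)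
  have car: "x \<in> carrier G" "trace (pr x) = 2" if "x \<in> T20 G pr" for x
    using that sub by (auto simp: trace_level_def)
  have "\<one>\<^bsub>G\<^esub> \<in> trace_level G pr 2"
    by (simp add: trace_level_def pr_one mat_1_mat2 trace_2)
  then have one: "\<one>\<^bsub>G\<^esub> \<in> T20 G pr"
    by (simp add: T20_def)
  have "\<bar>ang g\<bar> < pi/2"
  proof (rule angle_stays_acute[of "T20 G pr" ang, OF _ _ _ one _ g])
    show "connected (T20 G pr)"
      unfolding T20_def by (rule connected_connected_component)
    show "continuous_on (T20 G pr) ang"
      using continuous_ang car(1) continuous_on_subset by blast
    show "\<bar>ang \<one>\<^bsub>G\<^esub>\<bar> < pi/2"
      by (simp add: ang_one)
    fix x assume x: "x \<in> T20 G pr"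
    have "half_norm (pr x) * cos (ang x) = 1"
      using angle_ang[OF car(1)[OF x]] car(2)[OF x] by (simp add: angle_of_def)
    then show "0 < cos (ang x)"
      using half_norm_ge_1[OF pr_SL2[OF car(1)[OF x]]] zero_less_mult_pos[of "half_norm (pr x)" "cos (ang x)"] by simp
  qed
  then show "g \<in> trace_level G pr 2 \<inter> cartan_strip G pr 0"
    using g sub car(1)[OF g] by (auto simp: cartan_strip_iff)
qed

text \<open>The sign of r in \<open>sheet_point\<close> splits the punctured level into two
  connected halves. A connected subset cannot meet both, since its angle would pass 2 k pi, which
  happens only at the apex. So a component is one of the halves, and the apex closes it to r \<ge> 0
  or r \<le> 0.\<close>

lemma cone_leaf_sheet:
  assumes "l \<in> cone_leaves G pr k"
  defines "L \<equiv> l \<union> {iota G pr [^]\<^bsub>G\<^esub> (2 * k)}"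
  shows "L = {g \<in> carrier G. lo g = 2 * real k * pi} \<or> L = {g \<in> carrier G. hi g = 2 * real k * pi}"
proof -
  define X where "X = trace_level G pr 2 \<inter> cartan_strip G pr (2 * int k) - {iota G pr [^]\<^bsub>G\<^esub> (2 * k)}"
  define P where "P I = (\<lambda>(r, \<eta>). sheet_point (int k) r \<eta>) ` (I \<times> UNIV)" for I
  define apex where "apex = iota G pr [^]\<^bsub>G\<^esub> (2 * k)"
  have l: "l \<in> components X"
    using assms(1) by (simp add: cone_leaves_def X_def)
  have ang_apex: "ang apex = 2 * real k * pi"
    using sheet_point(2)[of "int k" 0 0] sheet_point_0[of k 0] by (simp add: apex_def)
  have conn: "connected (P I)" if "connected I" for I
    unfolding P_def case_prod_beta
    by (intro connected_continuous_image continuous_sheet_point continuous_on_fst continuous_on_snd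
       continuous_on_id connected_Times that connected_UNIV)
  have angP: "ang (sheet_point (int k) r \<eta>) = 2 * real k * pi + arctan (sinh r)" for r \<eta>
    using sheet_point(2)[of "int k" r \<eta>] by simp
  have ne: "sheet_point (int k) r \<eta> \<noteq> apex" if "r \<noteq> 0" for r \<eta>
  proof
    assume "sheet_point (int k) r \<eta> = apex"
    then have "arctan (sinh r) = 0"
      using angP[of r \<eta>] ang_apex by simp
    then show False
      using that by simp
  qed
  have PX: "P {0<..} \<subseteq> X" "P {..<0} \<subseteq> X"
    using sheet_point_in ne unfolding P_def X_def apex_def by fastforce+
  have XP: "X \<subseteq> P {0<..} \<union> P {..<0}"
  proof
    fix g assume g: "g \<in> X"
    then have car: "g \<in> carrier G" and "g \<noteq> apex"
      by (auto simp: X_def trace_level_def apex_def)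
    have "lo g = 2 * of_int (int k) * pi \<or> hi g = 2 * of_int (int k) * pi"
      using g by (intro sheet_cases) (auto simp: X_def)
    then obtain r \<eta> where r: "g = sheet_point (int k) r \<eta>"
      using lo_sheet[OF car] hi_sheet[OF car] by metis
    then have "r \<noteq> 0"
      using \<open>g \<noteq> apex\<close> sheet_point_0 by (auto simp: apex_def)
    then have "r \<in> {0<..} \<or> r \<in> {..<0}"
      by auto
    then show "g \<in> P {0<..} \<union> P {..<0}"
      unfolding P_def r by blast
  qed
  have disj: "l \<subseteq> P {0<..} \<or> l \<subseteq> P {..<0}"
  proof (rule ccontr)
    assume "\<not> ?thesis"
    moreover have lX: "l \<subseteq> X"
      using l by (rule in_components_subset)
    ultimately obtain x y where xy: "x \<in> l" "x \<in> P {..<0}" "y \<in> l" "y \<in> P {0<..}"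
      using XP by blast
    have "connected (ang ` l)"
    proof (rule connected_continuous_image)
      show "connected l"
        using l by (rule in_components_connected)
      have "l \<subseteq> carrier G"
        using lX by (auto simp: X_def trace_level_def)
      then show "continuous_on l ang"
        using continuous_ang continuous_on_subset by blast
    qed
    moreover have "ang x < 2 * real k * pi" "2 * real k * pi < ang y"
      using xy(2,4) by (auto simp: P_def angP)
    ultimately have "2 * real k * pi \<in> ang ` l"
      using connected_contains_Icc[of "ang ` l" "ang x" "ang y"] xy(1,3) by (auto simp: subset_iff)
    then obtain z where z: "z \<in> l" "ang z = 2 * real k * pi"
      by auto
    then obtain r \<eta> where "z = sheet_point (int k) r \<eta>" "r \<noteq> 0"
      using XP lX unfolding P_def by fastforce
    then show False
      using z(2) angP by simp
  qed
  have lne: "l \<noteq> {}"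
    using l by (rule in_components_nonempty)
  have max: "l = P I" if "l \<subseteq> P I" "P I \<subseteq> X" "connected I" for I
  proof (rule equalityI[OF that(1)])
    have "l \<inter> P I \<noteq> {}"
      using that(1) lne by blast
    then show "P I \<subseteq> l"
      using components_maximal[OF l conn[OF that(3)] that(2)] by blast
  qed
  have "l = P {0<..} \<or> l = P {..<0}"
    using disj max[of "{0<..}"] max[of "{..<0}"] PX by (auto simp: is_interval_connected_1[symmetric])
  then show ?thesis
  proof
    assume lP: "l = P {0<..}"
    have "L = {g \<in> carrier G. lo g = 2 * real k * pi}"
    proof (intro equalityI subsetI)
      fix g assume "g \<in> L"
      then have "g = sheet_point (int k) 0 0 \<or> g \<in> P {0<..}"
        unfolding L_def lP using sheet_point_0[of k 0] by auto
      then consider "g = sheet_point (int k) 0 0" | "g \<in> P {0<..}"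
        by blast
      then obtain r \<eta> where r: "0 \<le> r" "g = sheet_point (int k) r \<eta>"
      proof cases
        case 1
        then show ?thesis using that[of 0 0] by simp
      next
        case 2
        then obtain a b where "0 < a" "g = sheet_point (int k) a b"
          by (auto simp: P_def)
        then show ?thesis using that[of a b] by auto
      qed
      show "g \<in> {g \<in> carrier G. lo g = 2 * real k * pi}"
        unfolding r(2) using lo_hi_sheet_point(1)[OF r(1), of "int k" \<eta>] sheet_point(1) by simp
    next
      fix g assume "g \<in> {g \<in> carrier G. lo g = 2 * real k * pi}"
      then have "g \<in> carrier G" "lo g = 2 * of_int (int k) * pi" by auto
      then obtain r \<eta> where r: "0 \<le> r" "g = sheet_point (int k) r \<eta>"
        using lo_sheet by blast
      show "g \<in> L"
      proof (cases "r = 0")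
        case True
        then show ?thesis using r sheet_point_0 by (simp add: L_def)
      next
        case False
        then have "r \<in> {0<..}" using r by simp
        then show ?thesis unfolding L_def lP P_def r(2) by blast
      qed
    qed
    then show ?thesis ..
  next
    assume lP: "l = P {..<0}"
    have "L = {g \<in> carrier G. hi g = 2 * real k * pi}"
    proof (intro equalityI subsetI)
      fix g assume "g \<in> L"
      then have "g = sheet_point (int k) 0 0 \<or> g \<in> P {..<0}"
        unfolding L_def lP using sheet_point_0[of k 0] by auto
      then consider "g = sheet_point (int k) 0 0" | "g \<in> P {..<0}"
        by blast
      then obtain r \<eta> where r: "r \<le> 0" "g = sheet_point (int k) r \<eta>"
      proof cases
        case 1
        then show ?thesis using that[of 0 0] by simp
      next
        case 2
        then obtain a b where "a < 0" "g = sheet_point (int k) a b"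
          by (auto simp: P_def)
        then show ?thesis using that[of a b] by auto
      qed
      show "g \<in> {g \<in> carrier G. hi g = 2 * real k * pi}"
        unfolding r(2) using lo_hi_sheet_point(2)[OF r(1), of "int k" \<eta>] sheet_point(1) by simp
    next
      fix g assume "g \<in> {g \<in> carrier G. hi g = 2 * real k * pi}"
      then have "g \<in> carrier G" "hi g = 2 * of_int (int k) * pi" by auto
      then obtain r \<eta> where r: "r \<le> 0" "g = sheet_point (int k) r \<eta>"
        using hi_sheet by blast
      show "g \<in> L"
      proof (cases "r = 0")
        case True
        then show ?thesis using r sheet_point_0 by (simp add: L_def)
      next
        case False
        then have "r \<in> {..<0}" using r by simp
        then show ?thesis unfolding L_def lP P_def r(2) by blast
      qed
    qed
    then show ?thesis ..
  qed
qed

section \<open>The Iwasawa chart and the set \<open>G0\<close>\<close>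

definition iwasawa :: "real \<times> real \<times> real \<Rightarrow> real^2^2" where
  "iwasawa = (\<lambda>(\<theta>, \<rho>, \<nu>). mat2 (cos \<theta>) (sin \<theta>) (- sin \<theta>) (cos \<theta>) **
        mat2 (sqrt \<rho>) 0 0 (1 / sqrt \<rho>) ** mat2 1 0 (\<nu> / 2) 1)"

lemma phiL_spec:
  "continuous_on phiL_dom (phiL G pr) \<and> phiL G pr ` phiL_dom \<subseteq> carrier G \<and>
     phiL G pr (0, 1, 0) = \<one>\<^bsub>G\<^esub> \<and> (\<forall>(\<theta>, \<rho>, \<nu>)\<in>phiL_dom. pr (phiL G pr (\<theta>, \<rho>, \<nu>)) = iwasawa (\<theta>, \<rho>, \<nu>))"
proof -
  let ?P = "\<lambda>\<phi> :: real \<times> real \<times> real \<Rightarrow> 'g. continuous_on phiL_dom \<phi> \<and> \<phi> ` phiL_dom \<subseteq> carrier G \<and>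
     \<phi> (0, 1, 0) = \<one>\<^bsub>G\<^esub> \<and> (\<forall>(\<theta>, \<rho>, \<nu>)\<in>phiL_dom. pr (\<phi> (\<theta>, \<rho>, \<nu>)) = iwasawa (\<theta>, \<rho>, \<nu>))"
  have conv: "convex phiL_dom"
    unfolding phiL_dom_def by (intro convex_Times convex_UNIV) auto
  have z: "(0, 1, 0) \<in> phiL_dom"
    by (simp add: phiL_dom_def)
  have cont: "continuous_on phiL_dom iwasawa"
    unfolding iwasawa_def case_prod_beta mat2_mult phiL_dom_def
    by (intro continuous_on_mat2; intro continuous_intros) auto
  have SL2: "iwasawa x \<in> SL2" if "x \<in> phiL_dom" for x
  proof -
    obtain \<theta> \<rho> \<nu> where x: "x = (\<theta>, \<rho>, \<nu>)" by (cases x)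
    then have \<rho>: "\<rho> > 0" using that by (simp add: phiL_dom_def)
    have "det (mat2 (cos \<theta>) (sin \<theta>) (- sin \<theta>) (cos \<theta>)) = 1" "det (mat2 (sqrt \<rho>) 0 0 (1 / sqrt \<rho>)) = 1" "det (mat2 1 0 (\<nu> / 2) 1) = 1"
      using \<rho> by (simp_all add: det_2 power2_eq_square[symmetric])
    then show ?thesis
      by (simp add: x iwasawa_def SL2_def det_mul)
  qed
  have one: "iwasawa (0, 1, 0) = mat 1"
    by (simp add: iwasawa_def mat2_mult mat_1_mat2)
  obtain \<phi> where "continuous_on phiL_dom \<phi>" "\<And>x. x \<in> phiL_dom \<Longrightarrow> \<phi> x \<in> carrier G" "\<phi> (0, 1, 0) = \<one>\<^bsub>G\<^esub>"
    "\<And>x. x \<in> phiL_dom \<Longrightarrow> pr (\<phi> x) = iwasawa x"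
    using lift_exists[OF conv z cont SL2 one] by blast
  then have "?P \<phi>"
    by auto
  moreover have "phiL G pr = (SOME \<phi>. ?P \<phi>)"
    unfolding phiL_def iwasawa_def by simp
  ultimately show ?thesis
    using someI[of ?P \<phi>] by simp
qed

lemma phiL_carrier: "x \<in> phiL_dom \<Longrightarrow> phiL G pr x \<in> carrier G"
  and pr_phiL: "x \<in> phiL_dom \<Longrightarrow> pr (phiL G pr x) = iwasawa x"
  using phiL_spec by (auto simp: image_subset_iff)

lemma G0_dom_subset: "G0_dom \<subseteq> phiL_dom"
  by (auto simp: G0_dom_def phiL_dom_def)

lemma iwasawa_entries:
  "iwasawa (\<theta>, \<rho>, \<nu>) = mat2 (cos \<theta> * sqrt \<rho> + sin \<theta> * (\<nu> / (2 * sqrt \<rho>))) (sin \<theta> / sqrt \<rho>)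
     (- sin \<theta> * sqrt \<rho> + cos \<theta> * (\<nu> / (2 * sqrt \<rho>))) (cos \<theta> / sqrt \<rho>)"
  by (simp add: iwasawa_def mat2_mult mult_ac)

lemma same_direction:
  fixes a b :: real
  assumes "0 < \<rho>" "0 < \<sigma>" "\<rho> * sin a = \<sigma> * sin b" "\<rho> * cos a = \<sigma> * cos b"
  shows "cos (a - b) = 1"
proof -
  have "(\<rho> * sin a)\<^sup>2 + (\<rho> * cos a)\<^sup>2 = \<rho>\<^sup>2" "(\<sigma> * sin b)\<^sup>2 + (\<sigma> * cos b)\<^sup>2 = \<sigma>\<^sup>2"
    by (simp_all add: power_mult_distrib flip: distrib_left)
  then have "\<rho>\<^sup>2 = \<sigma>\<^sup>2"
    using assms(3,4) by metis
  then have "\<rho> = \<sigma>"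
    using assms(1,2) by simp
  then have "sin a = sin b" "cos a = cos b"
    using assms by simp_all
  then show ?thesis
    using sin_cos_squared_add3[of b] by (simp add: cos_diff)
qed

text \<open>The last two Iwasawa factors are lower triangular with positive diagonal and preserve
  the direction (0, 1), which belongs to \<phi> = 0; only the rotation displaces it. The branch is
  fixed at the unit.\<close>

lemma dsp_phiL:
  assumes "(\<theta>, \<rho>, \<nu>) \<in> phiL_dom"
  shows "dsp (phiL G pr (\<theta>, \<rho>, \<nu>)) 0 = \<theta>"
proof -
  have "dsp (phiL G pr (\<theta>, \<rho>, \<nu>)) 0 - fst (\<theta>, \<rho>, \<nu>) = 0"
  proof (rule angle_stays_zero[of phiL_dom "\<lambda>x. dsp (phiL G pr x) 0 - fst x", OF _ _ _ _ _ assms])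
    show "connected phiL_dom"
      unfolding phiL_dom_def by (intro convex_connected convex_Times convex_UNIV) auto
    show "continuous_on phiL_dom (\<lambda>x. dsp (phiL G pr x) 0 - fst x)"
      using continuous_lo_hi(3)[of phiL_dom "phiL G pr"] phiL_spec phiL_carrier
      by (intro continuous_on_diff continuous_on_fst continuous_on_id) blast
    show z: "(0, 1, 0) \<in> phiL_dom"
      by (simp add: phiL_dom_def)
    have "pr \<one>\<^bsub>G\<^esub> = mat 1" "ang \<one>\<^bsub>G\<^esub> = 0"
      by (simp_all add: pr_one ang_one)
    then show "dsp (phiL G pr (0, 1, 0)) 0 - fst (0, 1::real, 0::real) = 0"
      using phiL_spec by (simp add: dsp_def disp_def mat_1_mat2)
  next
    fix x assume x: "x \<in> phiL_dom"
    obtain \<theta> \<rho> \<nu> where x': "x = (\<theta>, \<rho>, \<nu>)" by (cases x)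
    then have \<rho>: "\<rho> > 0" using x by (simp add: phiL_dom_def)
    obtain \<sigma> where "\<sigma> > 0" "pr (phiL G pr x)$1$1 * sin 0 + pr (phiL G pr x)$1$2 * cos 0 = \<sigma> * sin (0 + dsp (phiL G pr x) 0)"
      "pr (phiL G pr x)$2$1 * sin 0 + pr (phiL G pr x)$2$2 * cos 0 = \<sigma> * cos (0 + dsp (phiL G pr x) 0)"
      using dsp_direction[OF phiL_carrier[OF x]] by blast
    then have "\<sigma> * sin (dsp (phiL G pr x) 0) = (1 / sqrt \<rho>) * sin \<theta>" "\<sigma> * cos (dsp (phiL G pr x) 0) = (1 / sqrt \<rho>) * cos \<theta>"
      unfolding pr_phiL[OF x] by (simp_all add: x' iwasawa_entries)
    then show "cos (dsp (phiL G pr x) 0 - fst x) = 1"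
      using same_direction[of \<sigma> "1 / sqrt \<rho>"] \<open>\<sigma> > 0\<close> \<rho> x' by simp
  qed
  then show ?thesis by simp
qed

text \<open>For the converse, Iwasawa coordinates are read off from g with \<theta> set to the
  displacement of (0, 1); equal matrices and equal displacements then force equal group
  elements.\<close>

lemma G0_iff:
  assumes "g \<in> carrier G"
  shows "g \<in> G0 G pr \<longleftrightarrow> 0 < dsp g 0"
proof
  assume "g \<in> G0 G pr"
  then obtain \<theta> \<rho> \<nu> where "(\<theta>, \<rho>, \<nu>) \<in> G0_dom" "g = phiL G pr (\<theta>, \<rho>, \<nu>)"
    by (auto simp: G0_def)
  moreover from this(1) have "(\<theta>, \<rho>, \<nu>) \<in> phiL_dom" "0 < \<theta>"
    by (auto simp: G0_dom_def phiL_dom_def)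
  ultimately show "0 < dsp g 0"
    using dsp_phiL by metis
next
  assume pos: "0 < dsp g 0"
  define \<theta> where "\<theta> = dsp g 0"
  obtain \<sigma> where \<sigma>: "\<sigma> > 0" "pr g$1$1 * sin 0 + pr g$1$2 * cos 0 = \<sigma> * sin (0 + dsp g 0)"
      "pr g$2$1 * sin 0 + pr g$2$2 * cos 0 = \<sigma> * cos (0 + dsp g 0)"
    using dsp_direction[OF assms] by blast
  then have e: "pr g$1$2 = \<sigma> * sin \<theta>" "pr g$2$2 = \<sigma> * cos \<theta>"
    by (simp_all add: \<theta>_def)
  define \<kappa> where "\<kappa> = sin \<theta> * pr g$1$1 + cos \<theta> * pr g$2$1"
  have det: "pr g$1$1 * (\<sigma> * cos \<theta>) - (\<sigma> * sin \<theta>) * pr g$2$1 = 1"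
    using pr_SL2[OF assms] by (simp add: SL2_iff e)
  have cs: "cos \<theta> * cos \<theta> + sin \<theta> * sin \<theta> = 1"
    by (simp add: power2_eq_square[symmetric])
  have col: "cos \<theta> * (1/\<sigma>) + sin \<theta> * \<kappa> = pr g$1$1" "- sin \<theta> * (1/\<sigma>) + cos \<theta> * \<kappa> = pr g$2$1"
  proof -
    have "1/\<sigma> = pr g$1$1 * cos \<theta> - sin \<theta> * pr g$2$1"
      using det \<sigma>(1) by (simp add: field_simps)
    then show "cos \<theta> * (1/\<sigma>) + sin \<theta> * \<kappa> = pr g$1$1" "- sin \<theta> * (1/\<sigma>) + cos \<theta> * \<kappa> = pr g$2$1"
      unfolding \<kappa>_def using cs by algebra+
  qed
  \<comment> \<open>By \<open>iwasawa_entries\<close> the second column has length 1 / sqrt \<rho> =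
    \<sigma>, and \<nu> / (2 sqrt \<rho>) must equal \<kappa>.\<close>
  define x where "x = (\<theta>, (1/\<sigma>)\<^sup>2, 2 * \<kappa> / \<sigma>)"
  have x: "x \<in> G0_dom" "x \<in> phiL_dom"
    using pos \<sigma>(1) by (auto simp: x_def G0_dom_def phiL_dom_def \<theta>_def)
  have sq: "sqrt ((1/\<sigma>)\<^sup>2) = 1/\<sigma>"
    using \<sigma>(1) by (simp add: real_sqrt_abs del: power_divide)
  have "pr (phiL G pr x) = pr g"
  proof -
    have "iwasawa x = mat2 (cos \<theta> * (1/\<sigma>) + sin \<theta> * \<kappa>) (\<sigma> * sin \<theta>) (- sin \<theta> * (1/\<sigma>) + cos \<theta> * \<kappa>) (\<sigma> * cos \<theta>)"
      unfolding x_def iwasawa_entries sq using \<sigma>(1) by (simp add: mult.commute)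
    also have "\<dots> = pr g"
      unfolding col by (rule mat2_eqI) (simp_all add: e)
    finally show ?thesis
      using pr_phiL[OF x(2)] by simp
  qed
  \<comment> \<open>Equal matrices give the same sine and cosine of the angle, hence the same
    arctangent term in \<open>disp\<close>; equality of the displacements then leaves equality of
    the angles.\<close>
  moreover have "ang (phiL G pr x) = ang g"
  proof -
    have d: "dsp (phiL G pr x) 0 = dsp g 0"
      using dsp_phiL x(2) unfolding x_def \<theta>_def by blast
    have "angle_of (pr g) (ang (phiL G pr x))"
      using angle_ang[OF phiL_carrier[OF x(2)]] \<open>pr (phiL G pr x) = pr g\<close> by simp
    then have "cos (ang (phiL G pr x)) = cos (ang g)" "sin (ang (phiL G pr x)) = sin (ang g)"
      using angle_of_unique[OF pr_SL2[OF assms] _ angle_ang[OF assms]] by blast+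
    then show ?thesis
      using d unfolding dsp_def disp_def \<open>pr (phiL G pr x) = pr g\<close> by simp
  qed
  ultimately have "phiL G pr x = g"
    using pr_ang_inj[OF phiL_carrier[OF x(2)] assms] by blast
  then show "g \<in> G0 G pr"
    unfolding G0_def using x(1) by blast
qed

lemma G0_carrier: "G0 G pr \<subseteq> carrier G"
  using phiL_carrier G0_dom_subset by (auto simp: G0_def)

end

section \<open>Monodromy along a line of potentials\<close>

text \<open>A maximum over [a, b] cannot sit to the left of b, since the function increases
  immediately to the right of every point.\<close>

lemma strict_mono_locally:
  fixes f :: "real \<Rightarrow> real"
  assumes cont: "continuous_on UNIV f" and loc: "\<And>s. \<exists>e>0. \<forall>s'. s < s' \<and> s' < s + e \<longrightarrow> f s < f s'"
  shows "strict_mono f"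
proof (rule strict_monoI)
  fix a b :: real assume ab: "a < b"
  have "compact {a..b}" "{a..b} \<noteq> {}" "continuous_on {a..b} f"
    using ab continuous_on_subset[OF cont] by auto
  then obtain m where m: "m \<in> {a..b}" "\<And>y. y \<in> {a..b} \<Longrightarrow> f y \<le> f m"
    using continuous_attains_sup by metis
  have *: "\<exists>s'. s < s' \<and> s' \<le> b \<and> f s < f s'" if s: "s < b" for s
  proof -
    obtain e where e: "e > 0" "\<And>s'. s < s' \<Longrightarrow> s' < s + e \<Longrightarrow> f s < f s'"
      using loc[of s] by blast
    have "s < min b (s + e/2)" "min b (s + e/2) < s + e" "min b (s + e/2) \<le> b"
      using s e(1) by (auto simp: min_def)
    then show ?thesis
      using e(2) by blast
  qed
  have "m = b"
  proof (rule ccontr)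
    assume "m \<noteq> b"
    then have "m < b" using m(1) by simp
    then obtain s' where "m < s'" "s' \<le> b" "f m < f s'"
      using * by blast
    then show False
      using m(2)[of s'] m(1) by simp
  qed
  obtain s' where "a < s'" "s' \<le> b" "f a < f s'"
    using *[OF ab] by blast
  then show "f a < f b"
    using m(2)[of s'] \<open>m = b\<close> by simp
qed

lemma strict_mono_ex1:
  fixes f :: "real \<Rightarrow> real"
  assumes "continuous_on UNIV f" "strict_mono f" "f a \<le> c" "c \<le> f b"
  shows "\<exists>!s. f s = c"
proof -
  have "a \<le> b"
    using assms(3,4) strict_mono_less_eq[OF assms(2), of a b] by linarith
  from IVT'[of f a c b, OF assms(3,4) this continuous_on_subset[OF assms(1) subset_UNIV]]
  obtain s where "f s = c"
    by blast
  show ?thesis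
  proof (rule ex1I[of _ s])
    show "f s = c" by fact
    fix t assume "f t = c"
    then show "t = s"
      using \<open>f s = c\<close> strict_mono_eq[OF assms(2), of t s] by simp
  qed
qed

section \<open>Comparison with constant potentials\<close>

lemma fund_const_neg:
  assumes "\<kappa> > 0"
  shows "fund (\<lambda>_. - (\<kappa>\<^sup>2)) (\<lambda>t. mat2 (cos (\<kappa> * t)) (sin (\<kappa> * t) / \<kappa>) (- \<kappa> * sin (\<kappa> * t)) (cos (\<kappa> * t)))"
  unfolding fund_def solves_def mat2_nth
proof (intro conjI ac_deriv)
  show "mat2 (cos (\<kappa> * 0)) (sin (\<kappa> * 0) / \<kappa>) (- \<kappa> * sin (\<kappa> * 0)) (cos (\<kappa> * 0)) = mat 1"
    by (simp add: mat_1_mat2)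
qed (use assms in \<open>auto intro!: derivative_eq_intros continuous_intros simp: power2_eq_square\<close>)

lemma fund_const_1: "fund (\<lambda>_. 1) (\<lambda>t. mat2 (cosh t) (sinh t) (sinh t) (cosh t))"
  unfolding fund_def solves_def mat2_nth
proof (intro conjI ac_deriv)
  show "mat2 (cosh 0) (sinh 0) (sinh 0) (cosh 0) = mat 1"
    by (simp add: mat_1_mat2)
qed (auto intro!: derivative_eq_intros continuous_intros)

text \<open>Dominated convergence turns convergence almost everywhere into L1 closeness of the
  coefficients. The bound B belongs to the solution of the limit equation, so it does not depend on
  n.\<close>

lemma fund_const_close:
  fixes R :: "nat \<Rightarrow> real \<Rightarrow> real"
  assumes \<Psi>: "fund (\<lambda>_. c) \<Psi>" and R: "\<And>n. integrable Leb (R n)"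
    and lim: "AE x in Leb. (\<lambda>n. R n x) \<longlonglongrightarrow> c"
    and h: "integrable Leb h" "\<And>n. AE x in Leb. \<bar>R n x\<bar> \<le> h x"
    and e: "0 < e"
  obtains n where "\<And>\<Phi> t i j. fund (R n) \<Phi> \<Longrightarrow> t \<in> {0..2*pi} \<Longrightarrow> \<bar>\<Psi> t $ i $ j - \<Phi> t $ i $ j\<bar> < e"
proof -
  obtain B where B: "B > 0" "\<And>t i j. t \<in> {0..2*pi} \<Longrightarrow> \<bar>\<Psi> t $ i $ j\<bar> \<le> B"
    using fund_bound[OF \<Psi>] by blast
  define D where "D n = (\<integral>x. \<bar>c - R n x\<bar> \<partial>Leb)" for n
  have ci: "integrable Leb (\<lambda>_. c)"
    by (intro integrable_Leb_continuous continuous_on_const)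
  have "D \<longlonglongrightarrow> (\<integral>x. 0 \<partial>Leb)"
    unfolding D_def
  proof (rule integral_dominated_convergence)
    show "integrable Leb (\<lambda>x. \<bar>c\<bar> + h x)"
      using h(1) ci by (intro Bochner_Integration.integrable_add) auto
    show "AE x in Leb. (\<lambda>n. \<bar>c - R n x\<bar>) \<longlonglongrightarrow> 0"
      using lim
    proof eventually_elim
      case (elim x)
      have "(\<lambda>n. \<bar>c - R n x\<bar>) \<longlonglongrightarrow> \<bar>c - c\<bar>"
        using elim by (intro tendsto_intros)
      then show ?case by simp
    qed
    show "AE x in Leb. norm \<bar>c - R n x\<bar> \<le> \<bar>c\<bar> + h x" for n
      using h(2)[of n] by eventually_elim auto
    show "(\<lambda>x. \<bar>c - R n x\<bar>) \<in> borel_measurable Leb" for n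
      using R[of n] ci by (intro borel_measurable_integrable) simp
  qed simp
  then have "(\<lambda>n. B * D n * exp (2*pi + (\<integral>x. h x \<partial>Leb))) \<longlonglongrightarrow> B * 0 * exp (2*pi + (\<integral>x. h x \<partial>Leb))"
    by (intro tendsto_mult tendsto_const) simp
  then have "\<forall>\<^sub>F n in sequentially. B * D n * exp (2*pi + (\<integral>x. h x \<partial>Leb)) < e"
    using e by (intro order_tendstoD(2)) auto
  then obtain n where n: "B * D n * exp (2*pi + (\<integral>x. h x \<partial>Leb)) < e"
    by (meson eventually_sequentially order_refl)
  have "\<bar>\<Psi> t $ i $ j - \<Phi> t $ i $ j\<bar> < e" if \<Phi>: "fund (R n) \<Phi>" and t: "t \<in> {0..2*pi}" for \<Phi> t i j
  proof -
    have "\<bar>\<Psi> t $ i $ j - \<Phi> t $ i $ j\<bar> \<le> B * D n * exp (2*pi + (\<integral>x. \<bar>R n x\<bar> \<partial>Leb))"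
      unfolding D_def using B(2) by (intro fund_entry_close[OF \<Psi> \<Phi> ci R _ t])
    also have "\<dots> \<le> B * D n * exp (2*pi + (\<integral>x. h x \<partial>Leb))"
    proof -
      have "(\<integral>x. \<bar>R n x\<bar> \<partial>Leb) \<le> (\<integral>x. h x \<partial>Leb)"
        using R h by (intro integral_mono_AE) auto
      moreover have "0 \<le> B * D n"
        using B(1) by (simp add: D_def)
      ultimately show ?thesis
        by (intro mult_left_mono) auto
    qed
    finally show ?thesis
      using n by linarith
  qed
  then show ?thesis
    using that by blast
qed

lemma square_integrable_abs: "square_integrable f \<Longrightarrow> square_integrable (\<lambda>x. \<bar>f x\<bar>)"
  unfolding square_integrable_def by (auto intro: borel_measurable_abs)

text \<open>\<open>monodromy\<close> acts on \<open>L2\<close>, so the approximating function is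
  turned into an element r; the domination by |q| + b is also what makes it square
  integrable.\<close>

lemma fund_truncation_close:
  fixes R :: "nat \<Rightarrow> real \<Rightarrow> real"
  assumes \<Psi>: "fund (\<lambda>_. c) \<Psi>" and R: "\<And>n. R n \<in> borel_measurable Leb"
    and b: "\<And>n. AE x in Leb. \<bar>R n x\<bar> \<le> \<bar>rep_L2 q x\<bar> + b" and lim: "AE x in Leb. (\<lambda>n. R n x) \<longlonglongrightarrow> c"
    and e: "0 < e"
  shows "\<exists>n r \<Phi>. (AE x in Leb. rep_L2 r x = R n x) \<and> fund (rep_L2 r) \<Phi> \<and>
    (\<forall>t\<in>{0..2*pi}. \<forall>i j. \<bar>\<Psi> t $ i $ j - \<Phi> t $ i $ j\<bar> < e)"
proof -
  have bound: "square_integrable (\<lambda>x. \<bar>rep_L2 q x\<bar> + b)"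
    by (intro square_integrable_add square_integrable_abs square_integrable_rep square_integrable_continuous continuous_on_const)
  have R2: "square_integrable (R n)" for n
    unfolding square_integrable_def
  proof
    show "integrable Leb (\<lambda>x. (R n x)\<^sup>2)"
    proof (rule Bochner_Integration.integrable_bound)
      show "integrable Leb (\<lambda>x. (\<bar>rep_L2 q x\<bar> + b)\<^sup>2)"
        using bound by (simp add: square_integrable_def)
      show "(\<lambda>x. (R n x)\<^sup>2) \<in> borel_measurable Leb"
        using R by measurable
      show "AE x in Leb. norm ((R n x)\<^sup>2) \<le> norm ((\<bar>rep_L2 q x\<bar> + b)\<^sup>2)"
        using b[of n] by eventually_elim (simp add: power2_le_iff_abs_le power_mono flip: abs_le_square_iff)
    qed
  qed (rule R)
  note Ri = square_integrable_imp_integrable[OF R2]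
  obtain n where n: "\<And>\<Phi> t i j. fund (R n) \<Phi> \<Longrightarrow> t \<in> {0..2*pi} \<Longrightarrow> \<bar>\<Psi> t $ i $ j - \<Phi> t $ i $ j\<bar> < e"
    using fund_const_close[OF \<Psi> Ri lim square_integrable_imp_integrable[OF bound] b e] by blast
  obtain \<Phi> where \<Phi>: "fund (R n) \<Phi>"
    using fund_exists[OF Ri] by blast
  have rep: "AE x in Leb. rep_L2 (abs_L2 (R n)) x = R n x"
    by (rule rep_abs_L2[OF R2])
  then have "AE x in Leb. R n x = rep_L2 (abs_L2 (R n)) x"
    by eventually_elim simp
  then have "fund (rep_L2 (abs_L2 (R n))) \<Phi>"
    by (rule fund_cong_AE[OF \<Phi> _ integrable_rep])
  with rep n[OF \<Phi>] show ?thesis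
    by (intro exI[of _ n] exI[of _ "abs_L2 (R n)"] exI[of _ \<Phi>] conjI ballI allI)
qed

section \<open>Lifting and monotonicity along a line of potentials\<close>

context SL2_cover
begin

lemma monodromy_eqI:
  assumes \<Phi>: "fund (rep_L2 q) \<Phi>" and h: "continuous_on {0..2*pi} h" "\<And>t. t \<in> {0..2*pi} \<Longrightarrow> h t \<in> carrier G"
    "h 0 = \<one>\<^bsub>G\<^esub>" "\<And>t. t \<in> {0..2*pi} \<Longrightarrow> pr (h t) = \<Phi> t"
  shows "monodromy G pr q = h (2*pi)"
  unfolding monodromy_def
proof (rule the_equality)
  show "\<exists>\<Phi> \<Phi>'. fundamental_solution q \<Phi> \<and> continuous_on {0..2*pi} \<Phi>' \<and> \<Phi>' ` {0..2*pi} \<subseteq> carrier G \<and>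
      \<Phi>' 0 = \<one>\<^bsub>G\<^esub> \<and> (\<forall>t\<in>{0..2*pi}. pr (\<Phi>' t) = \<Phi> t) \<and> h (2*pi) = \<Phi>' (2*pi)"
    using assms fundamental_solution_iff by (intro exI[of _ \<Phi>] exI[of _ h]) auto
next
  fix g assume "\<exists>\<Phi> \<Phi>'. fundamental_solution q \<Phi> \<and> continuous_on {0..2*pi} \<Phi>' \<and> \<Phi>' ` {0..2*pi} \<subseteq> carrier G \<and>
      \<Phi>' 0 = \<one>\<^bsub>G\<^esub> \<and> (\<forall>t\<in>{0..2*pi}. pr (\<Phi>' t) = \<Phi> t) \<and> g = \<Phi>' (2*pi)"
  then obtain \<Phi>2 h2 where 2: "fund (rep_L2 q) \<Phi>2" "continuous_on {0..2*pi} h2" "h2 ` {0..2*pi} \<subseteq> carrier G"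
      "h2 0 = \<one>\<^bsub>G\<^esub>" "\<forall>t\<in>{0..2*pi}. pr (h2 t) = \<Phi>2 t" "g = h2 (2*pi)"
    unfolding fundamental_solution_iff by blast
  have "h2 (2*pi) = h (2*pi)"
  proof (rule unique_lift[of "{0..2*pi}" h2 h 0 "2*pi"])
    show "pr (h2 t) = pr (h t)" if "t \<in> {0..2*pi}" for t
      using 2(5) h(4) that fund_unique[OF 2(1) \<Phi> integrable_rep that] by simp
    show "h2 0 = h 0"
      using 2(4) h(3) by simp
  qed (use 2(2,3) h in auto)
  then show "g = h (2*pi)"
    using 2(6) by simp
qed

lemma monodromy_lift:
  assumes \<Phi>: "fund (rep_L2 q) \<Phi>"
  obtains h where "continuous_on {0..2*pi} h" "\<And>t. t \<in> {0..2*pi} \<Longrightarrow> h t \<in> carrier G"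
    "h 0 = \<one>\<^bsub>G\<^esub>" "\<And>t. t \<in> {0..2*pi} \<Longrightarrow> pr (h t) = \<Phi> t" "monodromy G pr q = h (2*pi)"
proof -
  have c: "convex {0..2*pi}" and z: "0 \<in> {0..2*pi}"
    by auto
  have one: "\<Phi> 0 = mat 1"
    using \<Phi> by (simp add: fund_def)
  obtain h where h: "continuous_on {0..2*pi} h" "\<And>t. t \<in> {0..2*pi} \<Longrightarrow> h t \<in> carrier G"
    "h 0 = \<one>\<^bsub>G\<^esub>" "\<And>t. t \<in> {0..2*pi} \<Longrightarrow> pr (h t) = \<Phi> t"
    using lift_exists[OF c z fund_continuous[OF \<Phi>] fund_SL2[OF \<Phi>] one] by blast
  show ?thesis
    by (rule that[OF h monodromy_eqI[OF \<Phi> h]])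
qed

lemma monodromy_carrier: "monodromy G pr q \<in> carrier G"
proof -
  obtain \<Phi> where \<Phi>: "fund (rep_L2 q) \<Phi>"
    using fund_exists[OF integrable_rep] by blast
  obtain h where h: "continuous_on {0..2*pi} h" "\<And>t. t \<in> {0..2*pi} \<Longrightarrow> h t \<in> carrier G"
    "h 0 = \<one>\<^bsub>G\<^esub>" "\<And>t. t \<in> {0..2*pi} \<Longrightarrow> pr (h t) = \<Phi> t" "monodromy G pr q = h (2*pi)"
    using monodromy_lift[OF \<Phi>] by blast
  show ?thesis
    unfolding h(5) by (rule h(2)) simp
qed

lemma pr_monodromy:
  assumes \<Phi>: "fund (rep_L2 q) \<Phi>"
  shows "pr (monodromy G pr q) = \<Phi> (2*pi)"
proof -
  obtain h where h: "continuous_on {0..2*pi} h" "\<And>t. t \<in> {0..2*pi} \<Longrightarrow> h t \<in> carrier G"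
    "h 0 = \<one>\<^bsub>G\<^esub>" "\<And>t. t \<in> {0..2*pi} \<Longrightarrow> pr (h t) = \<Phi> t" "monodromy G pr q = h (2*pi)"
    using monodromy_lift[OF \<Phi>] by blast
  show ?thesis
    unfolding h(5) by (rule h(4)) simp
qed

text \<open>The endpoint alone determines the angle only up to multiples of 2 pi; control of the
  matrices on the whole interval fixes the branch.\<close>

lemma monodromy_near:
  assumes \<Phi>: "fund (rep_L2 q) \<Phi>" and \<theta>: "continuous_on {0..2*pi} \<theta>" "\<theta> 0 = 0"
    and pos: "\<And>t. t \<in> {0..2*pi} \<Longrightarrow> 0 < trace (\<Phi> t) * cos (\<theta> t) + skew (\<Phi> t) * sin (\<theta> t)"
  shows "\<bar>ang (monodromy G pr q) - \<theta> (2*pi)\<bar> < pi/2"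
proof -
  obtain h where h: "continuous_on {0..2*pi} h" "\<And>t. t \<in> {0..2*pi} \<Longrightarrow> h t \<in> carrier G"
    "h 0 = \<one>\<^bsub>G\<^esub>" "\<And>t. t \<in> {0..2*pi} \<Longrightarrow> pr (h t) = \<Phi> t" "monodromy G pr q = h (2*pi)"
    using monodromy_lift[OF \<Phi>] by blast
  have "\<bar>ang (h (2*pi)) - \<theta> (2*pi)\<bar> < pi/2"
  proof (rule ang_close[of "{0..2*pi}" h \<theta> 0 "2*pi"])
    show "0 < trace (pr (h t)) * cos (\<theta> t) + skew (pr (h t)) * sin (\<theta> t)" if "t \<in> {0..2*pi}" for t
      using pos[OF that] h(4)[OF that] by simp
    show "\<bar>ang (h 0) - \<theta> 0\<bar> < pi/2"
      by (simp add: h(3) ang_one \<theta>(2))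
  qed (use h \<theta> in auto)
  then show ?thesis
    by (simp add: h(5))
qed

text \<open>Continuity in s comes from a single lift over the strip of all (s, t); lifting each path
  separately would say nothing about neighbouring s.\<close>

lemma monodromy_line:
  fixes q w :: L2
  obtains \<Phi> where "\<And>s. fund (\<lambda>t. rep_L2 q t - s * rep_L2 w t) (\<Phi> s)" "\<And>s. fund (rep_L2 (q - s *\<^sub>R w)) (\<Phi> s)"
    "continuous_on UNIV (\<lambda>s. monodromy G pr (q - s *\<^sub>R w))"
proof -
  have "\<forall>s. \<exists>\<Phi>. fund (\<lambda>t. rep_L2 q t - s * rep_L2 w t) \<Phi>"
  proof
    fix s
    have "integrable Leb (\<lambda>t. rep_L2 q t - s * rep_L2 w t)"
      using integrable_rep[of q] integrable_rep[of w] by simp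
    from fund_exists[OF this] show "\<exists>\<Phi>. fund (\<lambda>t. rep_L2 q t - s * rep_L2 w t) \<Phi>"
      by blast
  qed
  then obtain \<Phi> where \<Phi>: "\<And>s. fund (\<lambda>t. rep_L2 q t - s * rep_L2 w t) (\<Phi> s)"
    by metis
  have \<Phi>': "fund (rep_L2 (q - s *\<^sub>R w)) (\<Phi> s)" for s
  proof (rule fund_cong_AE[OF \<Phi> _ integrable_rep])
    show "AE t in Leb. rep_L2 q t - s * rep_L2 w t = rep_L2 (q - s *\<^sub>R w) t"
      using rep_L2_lincomb[of q s w] by eventually_elim simp
  qed
  have entry: "continuous_on (UNIV \<times> {0..2*pi}) (\<lambda>x. \<Phi> (fst x) (snd x) $ i $ j)" for i j
  proof (rule continuous_on_parameter[of _ "\<lambda>s t. \<Phi> s t $ i $ j"])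
    show "continuous_on {0..2*pi} (\<lambda>t. \<Phi> s t $ i $ j)" for s
      by (intro continuous_on_component fund_continuous[OF \<Phi>])
    fix s0
    obtain C where C: "C > 0" "\<And>s t i j. \<bar>s - s0\<bar> \<le> 1 \<Longrightarrow> t \<in> {0..2*pi} \<Longrightarrow> \<bar>\<Phi> s t $ i $ j - \<Phi> s0 t $ i $ j\<bar> \<le> C * \<bar>s - s0\<bar>"
      using fund_lipschitz[of "rep_L2 q" "rep_L2 w" \<Phi> s0, OF \<Phi> integrable_rep integrable_rep] by blast
    from C(2) show "\<exists>C. \<forall>s t. \<bar>s - s0\<bar> \<le> 1 \<longrightarrow> t \<in> {0..2*pi} \<longrightarrow> \<bar>\<Phi> s t $ i $ j - \<Phi> s0 t $ i $ j\<bar> \<le> C * \<bar>s - s0\<bar>"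
      by blast
  qed
  have eq: "(\<lambda>x. \<Phi> (fst x) (snd x)) = (\<lambda>x. mat2 (\<Phi> (fst x) (snd x) $ 1 $ 1) (\<Phi> (fst x) (snd x) $ 1 $ 2) (\<Phi> (fst x) (snd x) $ 2 $ 1) (\<Phi> (fst x) (snd x) $ 2 $ 2))"
    by (rule ext, rule mat2_eqI) simp_all
  have cont: "continuous_on (UNIV \<times> {0..2*pi}) (\<lambda>x. \<Phi> (fst x) (snd x))"
    by (subst eq, intro continuous_on_mat2 entry)
  have conv: "convex ((UNIV :: real set) \<times> {0..2*pi})" and z: "(0, 0) \<in> (UNIV :: real set) \<times> {0..2*pi}"
    by (auto intro: convex_Times)
  have SL2: "\<Phi> (fst x) (snd x) \<in> SL2" if "x \<in> UNIV \<times> {0..2*pi}" for x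
    using fund_SL2[OF \<Phi>, of "snd x" "fst x"] that by auto
  have one: "\<Phi> s 0 = mat 1" for s
    using \<Phi>[of s] by (simp add: fund_def)
  have one': "\<Phi> (fst (0::real, 0::real)) (snd (0::real, 0::real)) = mat 1"
    by (simp add: one)
  obtain H where H: "continuous_on (UNIV \<times> {0..2*pi}) H" "\<And>x. x \<in> UNIV \<times> {0..2*pi} \<Longrightarrow> H x \<in> carrier G"
    "H (0, 0) = \<one>\<^bsub>G\<^esub>" "\<And>x. x \<in> UNIV \<times> {0..2*pi} \<Longrightarrow> pr (H x) = \<Phi> (fst x) (snd x)"
    using lift_exists[OF conv z cont SL2 one'] by blast
  \<comment> \<open>The lift is normalized at (0, 0) only. On the edge t = 0 it covers the constant
    identity and is therefore constant, which makes each slice the lift that defines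
    \<open>monodromy\<close>.\<close>
  have H0: "H (s, 0) = \<one>\<^bsub>G\<^esub>" for s
  proof (rule unique_lift[of UNIV "\<lambda>s. H (s, 0)" "\<lambda>_. \<one>\<^bsub>G\<^esub>" 0 s])
    show "continuous_on UNIV (\<lambda>s. H (s, 0))"
      by (rule continuous_on_compose2[OF H(1), of _ "\<lambda>s. (s, 0)"]) (auto intro!: continuous_on_Pair continuous_on_id continuous_on_const)
    show "pr (H (s, 0)) = pr \<one>\<^bsub>G\<^esub>" for s
      using H(4)[of "(s, 0)"] by (simp add: pr_one one)
  qed (use H(2,3) in auto)
  have "monodromy G pr (q - s *\<^sub>R w) = H (s, 2*pi)" for s
  proof (rule monodromy_eqI[OF \<Phi>', of "\<lambda>t. H (s, t)"])
    show "continuous_on {0..2*pi} (\<lambda>t. H (s, t))"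
      by (rule continuous_on_compose2[OF H(1), of _ "\<lambda>t. (s, t)"]) (auto intro!: continuous_on_Pair continuous_on_id continuous_on_const)
  qed (use H H0 in auto)
  moreover have "continuous_on UNIV (\<lambda>s. H (s, 2*pi))"
    by (rule continuous_on_compose2[OF H(1), of _ "\<lambda>s. (s, 2*pi)"]) (auto intro!: continuous_on_Pair continuous_on_id continuous_on_const)
  ultimately have "continuous_on UNIV (\<lambda>s. monodromy G pr (q - s *\<^sub>R w))"
    by simp
  from that[OF \<Phi> \<Phi>' this] show ?thesis .
qed

lemma continuous_line:
  "continuous_on UNIV (\<lambda>s. lo (monodromy G pr (q - s *\<^sub>R w)))"
  "continuous_on UNIV (\<lambda>s. hi (monodromy G pr (q - s *\<^sub>R w)))"
  "continuous_on UNIV (\<lambda>s. dsp (monodromy G pr (q - s *\<^sub>R w)) \<phi>)"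
proof -
  obtain \<Phi> where \<Phi>: "\<And>s. fund (\<lambda>t. rep_L2 q t - s * rep_L2 w t) (\<Phi> s)" "\<And>s. fund (rep_L2 (q - s *\<^sub>R w)) (\<Phi> s)"
    "continuous_on UNIV (\<lambda>s. monodromy G pr (q - s *\<^sub>R w))"
    using monodromy_line[of q w] by blast
  show "continuous_on UNIV (\<lambda>s. lo (monodromy G pr (q - s *\<^sub>R w)))"
    "continuous_on UNIV (\<lambda>s. hi (monodromy G pr (q - s *\<^sub>R w)))"
    "continuous_on UNIV (\<lambda>s. dsp (monodromy G pr (q - s *\<^sub>R w)) \<phi>)"
    by (rule continuous_lo_hi[OF \<Phi>(3) monodromy_carrier])+
qed

text \<open>By \<open>strict_mono_locally\<close> only s' slightly above s matters. With the
  endpoints in polar form the Wronskian at 2 pi is a positive multiple of the sine of the increment,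
  and it equals s' - s times an integral close to the positive number \<open>J\<close>.\<close>

lemma dsp_strict_mono:
  assumes w: "AE x in Leb. 0 < rep_L2 w x"
  shows "strict_mono (\<lambda>s. dsp (monodromy G pr (q - s *\<^sub>R w)) \<phi>)"
proof (rule strict_mono_locally[OF continuous_line(3)])
  fix s :: real
  obtain \<Phi> where \<Phi>: "\<And>s. fund (\<lambda>t. rep_L2 q t - s * rep_L2 w t) (\<Phi> s)" "\<And>s. fund (rep_L2 (q - s *\<^sub>R w)) (\<Phi> s)"
    "continuous_on UNIV (\<lambda>s. monodromy G pr (q - s *\<^sub>R w))"
    using monodromy_line[of q w] by blast
  define m where "m s = monodromy G pr (q - s *\<^sub>R w)" for s
  define y where "y s t = sin \<phi> * \<Phi> s t $ 1 $ 1 + cos \<phi> * \<Phi> s t $ 1 $ 2" for s t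
  define z where "z s t = sin \<phi> * \<Phi> s t $ 2 $ 1 + cos \<phi> * \<Phi> s t $ 2 $ 2" for s t
  let ?k = "\<lambda>s t. rep_L2 q t - s * rep_L2 w t"
  have sol: "solves (?k s) (y s) (z s)" for s
    unfolding y_def z_def by (rule fund_solves[OF \<Phi>(1)])
  have init: "y s 0 = sin \<phi>" "z s 0 = cos \<phi>" for s
    by (simp_all add: y_def z_def fund_0[OF \<Phi>(1)])
  have p: "2*pi \<in> {0..2*pi}" by simp
  \<comment> \<open>Equal initial data make the Wronskian vanish at 0, and the two coefficients
    differ by (s' - s) w.\<close>
  have wr: "y s' (2*pi) * z s (2*pi) - z s' (2*pi) * y s (2*pi) = (s' - s) * (\<integral>t. rep_L2 w t * (y s' t * y s t) \<partial>Leb)" for s'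
  proof -
    have "y s' (2*pi) * z s (2*pi) - z s' (2*pi) * y s (2*pi) = (\<integral>t. (?k s t - ?k s' t) * y s' t * y s t \<partial>Leb)"
      using acD(2)[OF wronskian[OF sol[of s] sol[of s']] p] by (simp add: init)
    also have "\<dots> = (\<integral>t. (s' - s) * (rep_L2 w t * (y s' t * y s t)) \<partial>Leb)"
      by (rule Bochner_Integration.integral_cong) (simp_all add: algebra_simps)
    finally show ?thesis by simp
  qed
  define J where "J = (\<integral>t. rep_L2 w t * (y s t)\<^sup>2 \<partial>Leb)"
  have J: "J > 0"
    unfolding J_def
  proof (rule solves_integral_pos[OF sol _ integrable_rep w])
    show "y s 0 \<noteq> 0 \<or> z s 0 \<noteq> 0"
      unfolding init using sin_zero_abs_cos_one[of \<phi>] by auto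
  qed
  obtain C where C: "C > 0" "\<And>s' t i j. \<bar>s' - s\<bar> \<le> 1 \<Longrightarrow> t \<in> {0..2*pi} \<Longrightarrow> \<bar>\<Phi> s' t $ i $ j - \<Phi> s t $ i $ j\<bar> \<le> C * \<bar>s' - s\<bar>"
    using fund_lipschitz[of "rep_L2 q" "rep_L2 w" \<Phi> s, OF \<Phi>(1) integrable_rep integrable_rep] by blast
  obtain B where B: "B > 0" "\<And>t. t \<in> {0..2*pi} \<Longrightarrow> \<bar>y s t\<bar> \<le> B"
    using bounded_on_interval[OF solvesD(3)[OF sol]] by blast
  define W where "W = (\<integral>x. \<bar>rep_L2 w x\<bar> \<partial>Leb)"
  have W: "W \<ge> 0"
    unfolding W_def by simp
  have ydiff: "\<bar>y s' t - y s t\<bar> \<le> 2 * C * \<bar>s' - s\<bar>" if "\<bar>s' - s\<bar> \<le> 1" "t \<in> {0..2*pi}" for s' t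
  proof -
    have "y s' t - y s t = sin \<phi> * (\<Phi> s' t $ 1 $ 1 - \<Phi> s t $ 1 $ 1) + cos \<phi> * (\<Phi> s' t $ 1 $ 2 - \<Phi> s t $ 1 $ 2)"
      by (simp add: y_def algebra_simps)
    then have "\<bar>y s' t - y s t\<bar> \<le> \<bar>sin \<phi>\<bar> * \<bar>\<Phi> s' t $ 1 $ 1 - \<Phi> s t $ 1 $ 1\<bar> + \<bar>cos \<phi>\<bar> * \<bar>\<Phi> s' t $ 1 $ 2 - \<Phi> s t $ 1 $ 2\<bar>"
      by (metis abs_mult abs_triangle_ineq)
    also have "\<dots> \<le> 1 * (C * \<bar>s' - s\<bar>) + 1 * (C * \<bar>s' - s\<bar>)"
      using C(2)[OF that] by (intro add_mono mult_mono) auto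
    finally show ?thesis by simp
  qed
  \<comment> \<open>Replacing one factor y s by y s' changes the integral by at most 2 B C |s' - s|
    W, the factor 2 coming from the two columns; \<open>e1\<close> keeps this below
    \<open>J\<close>. The cap 1 is the range of the Lipschitz bound, and the 1 in the denominator
    keeps it positive.\<close>
  define e1 where "e1 = min 1 (J / (2 * B * C * W + 1))"
  have den: "2 * B * C * W + 1 > 0"
    using B(1) C(1) W by (intro add_nonneg_pos mult_nonneg_nonneg) auto
  then have e1: "e1 > 0"
    using J by (simp add: e1_def)
  have Jpos: "0 < (\<integral>t. rep_L2 w t * (y s' t * y s t) \<partial>Leb)" if s': "s < s'" "s' < s + e1" for s'
  proof -
    have d: "\<bar>s' - s\<bar> \<le> 1" "\<bar>s' - s\<bar> < J / (2 * B * C * W + 1)"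
      using s' by (auto simp: e1_def)
    have cy: "continuous_on {0..2*pi} (y s)" "continuous_on {0..2*pi} (y s')"
      using solvesD(3)[OF sol] by blast+
    have i1: "integrable Leb (\<lambda>t. rep_L2 w t * (y s' t * y s t))"
      using cy by (intro integrable_mult_continuous integrable_rep continuous_on_mult)
    have i2: "integrable Leb (\<lambda>t. rep_L2 w t * (y s t)\<^sup>2)"
      using cy by (intro integrable_mult_continuous integrable_rep continuous_on_power)
    have i3: "integrable Leb (\<lambda>t. 2 * B * C * \<bar>s' - s\<bar> * \<bar>rep_L2 w t\<bar>)"
      using integrable_rep[of w] by simp
    have "J - 2 * B * C * \<bar>s' - s\<bar> * W = (\<integral>t. rep_L2 w t * (y s t)\<^sup>2 - 2 * B * C * \<bar>s' - s\<bar> * \<bar>rep_L2 w t\<bar> \<partial>Leb)"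
      by (subst Bochner_Integration.integral_diff[OF i2 i3]) (simp add: J_def W_def)
    also have "\<dots> \<le> (\<integral>t. rep_L2 w t * (y s' t * y s t) \<partial>Leb)"
    proof (rule integral_mono[OF Bochner_Integration.integrable_diff[OF i2 i3] i1])
      fix t assume "t \<in> space Leb"
      then have t: "t \<in> {0..2*pi}" by simp
      have "rep_L2 w t * (y s t)\<^sup>2 - rep_L2 w t * (y s' t * y s t) = rep_L2 w t * (y s t * (y s t - y s' t))"
        by (simp add: power2_eq_square algebra_simps)
      also have "\<dots> \<le> \<bar>rep_L2 w t\<bar> * (\<bar>y s t\<bar> * \<bar>y s t - y s' t\<bar>)"
        by (metis abs_ge_self abs_mult)
      also have "\<dots> \<le> \<bar>rep_L2 w t\<bar> * (B * (2 * C * \<bar>s' - s\<bar>))"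
        using B ydiff[OF d(1) t] t by (intro mult_left_mono mult_mono) (auto simp: abs_minus_commute)
      finally show "rep_L2 w t * (y s t)\<^sup>2 - 2 * B * C * \<bar>s' - s\<bar> * \<bar>rep_L2 w t\<bar> \<le> rep_L2 w t * (y s' t * y s t)"
        by (simp add: mult_ac)
    qed
    moreover have "2 * B * C * \<bar>s' - s\<bar> * W < J"
    proof -
      have "2 * B * C * \<bar>s' - s\<bar> * W \<le> \<bar>s' - s\<bar> * (2 * B * C * W + 1)"
        by (simp add: algebra_simps)
      also have "\<dots> < J"
        using d(2) den by (simp add: pos_less_divide_eq)
      finally show ?thesis .
    qed
    ultimately show ?thesis by linarith
  qed
  \<comment> \<open>The Wronskian shows only the sine of the increment; an increment known to be
    below pi in absolute value has the sign of its sine.\<close>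
  have "continuous (at s) (\<lambda>s. dsp (m s) \<phi>)"
    using continuous_line(3)[of q w \<phi>] by (simp add: continuous_on_eq_continuous_at m_def)
  then obtain e2 where e2: "e2 > 0" "\<And>s'. \<bar>s' - s\<bar> < e2 \<Longrightarrow> \<bar>dsp (m s') \<phi> - dsp (m s) \<phi>\<bar> < pi"
    unfolding continuous_at_eps_delta dist_real_def using pi_gt_zero by blast
  have "dsp (m s) \<phi> < dsp (m s') \<phi>" if s': "s < s'" "s' < s + min e1 e2" for s'
  proof -
    have dir: "\<exists>\<rho>>0. y s (2*pi) = \<rho> * sin (\<phi> + dsp (m s) \<phi>) \<and> z s (2*pi) = \<rho> * cos (\<phi> + dsp (m s) \<phi>)" for s
    proof -
      have "pr (m s) = \<Phi> s (2*pi)"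
        unfolding m_def by (rule pr_monodromy[OF \<Phi>(2)])
      then show ?thesis
        using dsp_direction[of "m s" \<phi>] monodromy_carrier[of "q - s *\<^sub>R w"]
        unfolding y_def z_def m_def[symmetric] by (metis mult.commute)
    qed
    obtain \<rho> where \<rho>: "\<rho> > 0" "y s (2*pi) = \<rho> * sin (\<phi> + dsp (m s) \<phi>)" "z s (2*pi) = \<rho> * cos (\<phi> + dsp (m s) \<phi>)"
      using dir by blast
    obtain \<rho>' where \<rho>': "\<rho>' > 0" "y s' (2*pi) = \<rho>' * sin (\<phi> + dsp (m s') \<phi>)" "z s' (2*pi) = \<rho>' * cos (\<phi> + dsp (m s') \<phi>)"
      using dir by blast
    have "0 < y s' (2*pi) * z s (2*pi) - z s' (2*pi) * y s (2*pi)"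
      unfolding wr using Jpos[of s'] s' by simp
    also have "\<dots> = (\<rho>' * \<rho>) * sin ((\<phi> + dsp (m s') \<phi>) - (\<phi> + dsp (m s) \<phi>))"
      unfolding \<rho> \<rho>' sin_diff by (simp add: algebra_simps)
    finally have "0 < (\<rho>' * \<rho>) * sin (dsp (m s') \<phi> - dsp (m s) \<phi>)"
      by simp
    then have pos: "0 < sin (dsp (m s') \<phi> - dsp (m s) \<phi>)"
      using zero_less_mult_pos[OF _ mult_pos_pos[OF \<rho>'(1) \<rho>(1)]] by blast
    have less: "\<bar>dsp (m s') \<phi> - dsp (m s) \<phi>\<bar> < pi"
      using e2(2)[of s'] s' by simp
    show ?thesis
    proof (rule ccontr)
      assume "\<not> ?thesis"
      then have "0 \<le> sin (dsp (m s) \<phi> - dsp (m s') \<phi>)"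
        using less by (intro sin_ge_zero) auto
      then show False
        using pos sin_minus[of "dsp (m s') \<phi> - dsp (m s) \<phi>"] by simp
    qed
  qed
  then show "\<exists>e>0. \<forall>s'. s < s' \<and> s' < s + e \<longrightarrow> dsp (monodromy G pr (q - s *\<^sub>R w)) \<phi> < dsp (monodromy G pr (q - s' *\<^sub>R w)) \<phi>"
    using e1 e2(1) by (intro exI[of _ "min e1 e2"]) (auto simp: m_def)
qed

text \<open>Strictness survives because the extrema are attained: \<open>lo\<close> is tested at a
  minimizing direction of the larger parameter, \<open>hi\<close> at a maximizing direction of the
  smaller one.\<close>

lemma lo_hi_strict_mono:
  assumes w: "AE x in Leb. 0 < rep_L2 w x"
  shows "strict_mono (\<lambda>s. lo (monodromy G pr (q - s *\<^sub>R w)))" "strict_mono (\<lambda>s. hi (monodromy G pr (q - s *\<^sub>R w)))"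
proof -
  note car = monodromy_carrier
  note mono = strict_monoD[OF dsp_strict_mono[OF w]]
  show "strict_mono (\<lambda>s. lo (monodromy G pr (q - s *\<^sub>R w)))"
  proof (rule strict_monoI)
    fix s s' :: real assume "s < s'"
    obtain \<phi> where \<phi>: "dsp (monodromy G pr (q - s' *\<^sub>R w)) \<phi> = lo (monodromy G pr (q - s' *\<^sub>R w))"
      using dsp_bounds(3)[OF car] by blast
    show "lo (monodromy G pr (q - s *\<^sub>R w)) < lo (monodromy G pr (q - s' *\<^sub>R w))"
      using dsp_bounds(1)[OF car, of "q - s *\<^sub>R w" \<phi>] mono[OF \<open>s < s'\<close>, of q \<phi>] unfolding \<phi> by linarith
  qed
  show "strict_mono (\<lambda>s. hi (monodromy G pr (q - s *\<^sub>R w)))"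
  proof (rule strict_monoI)
    fix s s' :: real assume "s < s'"
    obtain \<phi> where \<phi>: "dsp (monodromy G pr (q - s *\<^sub>R w)) \<phi> = hi (monodromy G pr (q - s *\<^sub>R w))"
      using dsp_bounds(4)[OF car] by blast
    show "hi (monodromy G pr (q - s *\<^sub>R w)) < hi (monodromy G pr (q - s' *\<^sub>R w))"
      using dsp_bounds(2)[OF car, of "q - s' *\<^sub>R w" \<phi>] mono[OF \<open>s < s'\<close>, of q \<phi>] unfolding \<phi> by linarith
  qed
qed

text \<open>The two potentials are joined by the line with direction r - q, which is positive almost
  everywhere.\<close>

lemma lo_antimono:
  assumes "AE x in Leb. rep_L2 q x < rep_L2 r x"
  shows "lo (monodromy G pr r) < lo (monodromy G pr q)"
proof -
  have "AE x in Leb. 0 < rep_L2 (r - 1 *\<^sub>R q) x"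
    using assms rep_L2_lincomb[of r 1 q] by eventually_elim simp
  from strict_monoD[OF lo_hi_strict_mono(1)[OF this, of r], of 0 1] show ?thesis
    by simp
qed

text \<open>The constant potential -\<kappa>^2 rotates by 2 pi \<kappa>. As q - n w falls below it
  only pointwise almost everywhere, a truncation from above is interposed: its angle is known up to
  pi/2, and \<open>lo_antimono\<close> passes from it to q - n w.\<close>

lemma lo_unbounded_above:
  assumes w: "AE x in Leb. 0 < rep_L2 w x"
  shows "\<exists>s. 2 * real k * pi \<le> lo (monodromy G pr (q - s *\<^sub>R w))"
proof -
  \<comment> \<open>One more than k, for a reserve of 2 pi: the angle is known up to pi/2, and
    \<open>lo\<close> subtracts a spread below pi/2.\<close>
  define \<kappa> where "\<kappa> = real k + 1"
  have \<kappa>: "\<kappa> \<ge> 1" by (simp add: \<kappa>_def)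
  define \<Psi> where "\<Psi> t = mat2 (cos (\<kappa> * t)) (sin (\<kappa> * t) / \<kappa>) (- \<kappa> * sin (\<kappa> * t)) (cos (\<kappa> * t))" for t
  have \<Psi>: "fund (\<lambda>_. - (\<kappa>\<^sup>2)) \<Psi>"
    using fund_const_neg[of \<kappa>] \<kappa> by (simp add: \<Psi>_def[abs_def])
  \<comment> \<open>Cutting at -\<kappa>^2 - 1 and adding 1 gives the limit -\<kappa>^2 and stays
    strictly above q - n w, as \<open>lo_antimono\<close> requires.\<close>
  define R where "R n x = max (rep_L2 q x - real n * rep_L2 w x) (- (\<kappa>\<^sup>2) - 1) + 1" for n x
  have meas: "rep_L2 q \<in> borel_measurable Leb" "rep_L2 w \<in> borel_measurable Leb"
    using square_integrable_rep by (auto simp: square_integrable_def)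
  have Rm: "R n \<in> borel_measurable Leb" for n
    unfolding R_def using meas by measurable
  have w0: "AE x in Leb. 0 \<le> rep_L2 w x"
    using w by eventually_elim simp
  have Rb: "AE x in Leb. \<bar>R n x\<bar> \<le> \<bar>rep_L2 q x\<bar> + (\<kappa>\<^sup>2 + 2)" for n
    using w0
  proof eventually_elim
    case (elim x)
    have "\<bar>max (c - a) (- b - 1) + 1\<bar> \<le> \<bar>c\<bar> + (b + 2)" if "0 \<le> a" "0 \<le> b" for a b c :: real
      using that by (auto simp: max_def abs_if)
    then show ?case
      unfolding R_def using elim by simp
  qed
  have lim: "AE x in Leb. (\<lambda>n. R n x) \<longlonglongrightarrow> - (\<kappa>\<^sup>2)"
    using w
  proof eventually_elim
    case (elim x)
    obtain N :: nat where N: "(rep_L2 q x + \<kappa>\<^sup>2 + 1) / rep_L2 w x \<le> real N"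
      using real_arch_simple by blast
    have "R n x = - (\<kappa>\<^sup>2)" if "N \<le> n" for n
    proof -
      have "rep_L2 q x + \<kappa>\<^sup>2 + 1 \<le> real N * rep_L2 w x"
        using N elim by (simp add: pos_divide_le_eq)
      also have "\<dots> \<le> real n * rep_L2 w x"
        using that elim by (intro mult_right_mono) auto
      finally show ?thesis
        by (simp add: R_def max_def)
    qed
    then show ?case
      by (intro tendsto_eventually) (auto simp: eventually_sequentially)
  qed
  have quarter: "0 < (1/4 :: real)" by simp
  obtain n r \<Phi> where rep_r: "AE x in Leb. rep_L2 r x = R n x" and \<Phi>r: "fund (rep_L2 r) \<Phi>"
    and close: "\<forall>t\<in>{0..2*pi}. \<forall>i j. \<bar>\<Psi> t $ i $ j - \<Phi> t $ i $ j\<bar> < 1/4"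
    using fund_truncation_close[OF \<Psi> Rm Rb lim quarter] by (elim exE conjE) (rule that)
  have n: "\<bar>\<Psi> t $ i $ j - \<Phi> t $ i $ j\<bar> < 1/4" if "t \<in> {0..2*pi}" for t i j
    using close that by blast
  have "\<bar>ang (monodromy G pr r) - \<kappa> * (2*pi)\<bar> < pi/2"
  proof (rule monodromy_near[OF \<Phi>r])
    show "continuous_on {0..2*pi} (\<lambda>t. \<kappa> * t)"
      by (intro continuous_on_mult continuous_on_const continuous_on_id)
    fix t assume t: "t \<in> {0..2*pi}"
    define c s where "c = cos (\<kappa> * t)" and "s = sin (\<kappa> * t)"
    have cs: "c\<^sup>2 + s\<^sup>2 = 1" "\<bar>c\<bar> \<le> 1" "\<bar>s\<bar> \<le> 1"
      by (simp_all add: c_def s_def)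
    have n': "\<bar>\<Psi> t $ i $ j - \<Phi> t $ i $ j\<bar> < 1/4" for i j
      using n[OF t] .
    have 1: "\<bar>trace (\<Psi> t) - trace (\<Phi> t)\<bar> < 1/2" "\<bar>skew (\<Psi> t) - skew (\<Phi> t)\<bar> < 1/2"
      unfolding trace_2 skew_def using n'[of 1 1] n'[of 2 2] n'[of 1 2] n'[of 2 1] by linarith+
    \<comment> \<open>Paired with the rotation by \<kappa> t, the conformal part gives 2 c^2 +
      (1/\<kappa> + \<kappa>) s^2, at least 2 by the inequality of means. Entries off by less than
      1/4 change trace and skew by less than 1/2 each, so the pairing stays positive.\<close>
    have 2: "trace (\<Psi> t) * c + skew (\<Psi> t) * s \<ge> 2"
    proof -
      have "2 * \<kappa> \<le> 1 + \<kappa> * \<kappa>"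
        using sum_squares_bound[of 1 \<kappa>] by (simp add: power2_eq_square)
      then have "2 \<le> 1/\<kappa> + \<kappa>"
        using \<kappa> by (simp add: field_simps)
      then have "2 * s\<^sup>2 \<le> (1/\<kappa> + \<kappa>) * s\<^sup>2"
        by (intro mult_right_mono) auto
      moreover have "trace (\<Psi> t) * c + skew (\<Psi> t) * s = 2 * c\<^sup>2 + (1/\<kappa> + \<kappa>) * s\<^sup>2"
        by (simp add: \<Psi>_def trace_2 skew_def c_def s_def power2_eq_square algebra_simps)
      ultimately show ?thesis
        using cs(1) by linarith
    qed
    have 3: "\<bar>(trace (\<Psi> t) - trace (\<Phi> t)) * c\<bar> \<le> 1/2 * 1" "\<bar>(skew (\<Psi> t) - skew (\<Phi> t)) * s\<bar> \<le> 1/2 * 1"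
      unfolding abs_mult using 1 cs(2,3) by (intro mult_mono; simp)+
    have "trace (\<Phi> t) * c + skew (\<Phi> t) * s = trace (\<Psi> t) * c + skew (\<Psi> t) * s
       - (trace (\<Psi> t) - trace (\<Phi> t)) * c - (skew (\<Psi> t) - skew (\<Phi> t)) * s"
      by (simp add: algebra_simps)
    then show "0 < trace (\<Phi> t) * cos (\<kappa> * t) + skew (\<Phi> t) * sin (\<kappa> * t)"
      using 2 3 unfolding c_def[symmetric] s_def[symmetric] by linarith
  qed simp
  then have "\<kappa> * (2*pi) - pi/2 < ang (monodromy G pr r)"
    by linarith
  moreover have "spread (pr (monodromy G pr r)) < pi/2"
    using spread_range(2)[OF pr_SL2[OF monodromy_carrier]] .
  moreover have "\<kappa> * (2*pi) = 2 * real k * pi + 2 * pi"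
    by (simp add: \<kappa>_def algebra_simps)
  ultimately have "2 * real k * pi \<le> lo (monodromy G pr r)"
    unfolding lo_def using pi_gt_zero by linarith
  moreover have "lo (monodromy G pr r) < lo (monodromy G pr (q - real n *\<^sub>R w))"
  proof (rule lo_antimono)
    show "AE x in Leb. rep_L2 (q - real n *\<^sub>R w) x < rep_L2 r x"
      using rep_r rep_L2_lincomb[of q "real n" w] by eventually_elim (simp add: R_def max_def)
  qed
  ultimately show ?thesis
    by (meson less_imp_le order_trans)
qed

text \<open>For the constant potential 1 the trace exceeds 2 and the angle stays near 0. Trace above
  2 means cos ang > cos spread, so the angle is below the spread. A truncation from below transfers
  this to q + n w.\<close>

lemma lo_negative:
  assumes w: "AE x in Leb. 0 < rep_L2 w x"
  shows "\<exists>s. lo (monodromy G pr (q - s *\<^sub>R w)) < 0"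
proof -
  define \<Psi> where "\<Psi> t = mat2 (cosh t) (sinh t) (sinh t) (cosh t)" for t :: real
  have \<Psi>: "fund (\<lambda>_. 1) \<Psi>"
    using fund_const_1 by (simp add: \<Psi>_def[abs_def])
  \<comment> \<open>Cutting at 2 and subtracting 1 gives the limit 1 and stays strictly below q + n
    w.\<close>
  define R where "R n x = min (rep_L2 q x + real n * rep_L2 w x) 2 - 1" for n x
  have meas: "rep_L2 q \<in> borel_measurable Leb" "rep_L2 w \<in> borel_measurable Leb"
    using square_integrable_rep by (auto simp: square_integrable_def)
  have Rm: "R n \<in> borel_measurable Leb" for n
    unfolding R_def using meas by measurable
  have w0: "AE x in Leb. 0 \<le> rep_L2 w x"
    using w by eventually_elim simp
  have Rb: "AE x in Leb. \<bar>R n x\<bar> \<le> \<bar>rep_L2 q x\<bar> + 3" for n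
    using w0
  proof eventually_elim
    case (elim x)
    then have "0 \<le> real n * rep_L2 w x" by simp
    then show ?case
      unfolding R_def by (auto simp: min_def abs_if)
  qed
  have lim: "AE x in Leb. (\<lambda>n. R n x) \<longlonglongrightarrow> 1"
    using w
  proof eventually_elim
    case (elim x)
    obtain N :: nat where N: "(2 - rep_L2 q x) / rep_L2 w x \<le> real N"
      using real_arch_simple by blast
    have "R n x = 1" if "N \<le> n" for n
    proof -
      have "2 - rep_L2 q x \<le> real N * rep_L2 w x"
        using N elim by (simp add: pos_divide_le_eq)
      also have "\<dots> \<le> real n * rep_L2 w x"
        using that elim by (intro mult_right_mono) auto
      finally show ?thesis
        by (simp add: R_def min_def)
    qed
    then show ?case
      by (intro tendsto_eventually) (auto simp: eventually_sequentially)
  qed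
  have quarter: "0 < (1/4 :: real)" by simp
  obtain n r \<Phi> where rep_r: "AE x in Leb. rep_L2 r x = R n x" and \<Phi>r: "fund (rep_L2 r) \<Phi>"
    and close: "\<forall>t\<in>{0..2*pi}. \<forall>i j. \<bar>\<Psi> t $ i $ j - \<Phi> t $ i $ j\<bar> < 1/4"
    using fund_truncation_close[OF \<Psi> Rm Rb lim quarter] by (elim exE conjE) (rule that)
  have n: "\<bar>\<Psi> t $ i $ j - \<Phi> t $ i $ j\<bar> < 1/4" if "t \<in> {0..2*pi}" for t i j
    using close that by blast
  define g where "g = monodromy G pr r"
  have g: "g \<in> carrier G"
    unfolding g_def by (rule monodromy_carrier)
  have tr: "2 * cosh t - 1/2 < trace (\<Phi> t)" if t: "t \<in> {0..2*pi}" for t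
    using n[OF t, of 1 1] n[OF t, of 2 2] unfolding trace_2 \<Psi>_def mat2_nth by linarith
  have "\<bar>ang g - 0\<bar> < pi/2"
    unfolding g_def
  proof (rule monodromy_near[OF \<Phi>r, of "\<lambda>_. 0"])
    fix t assume t: "t \<in> {0..2*pi}"
    show "0 < trace (\<Phi> t) * cos 0 + skew (\<Phi> t) * sin 0"
      using tr[OF t] cosh_real_ge_1[of t] by simp
  qed simp_all
  then have a: "\<bar>ang g\<bar> < pi/2" by simp
  have "2 < trace (pr g)"
  proof -
    have "1 + 2*pi \<le> exp (2*pi)"
      using exp_ge_add_one_self[of "2*pi"] by simp
    moreover have "exp (2*pi) / 2 \<le> cosh (2*pi)"
      by (simp add: cosh_def)
    \<comment> \<open>The perturbed trace is known to exceed 2 cosh (2 pi) - 1/2, which has to be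
      above 2.\<close>
    ultimately have "5/4 < cosh (2*pi)"
      using pi_ge_two by linarith
    then show ?thesis
      using tr[of "2*pi"] pr_monodromy[OF \<Phi>r] by (simp add: g_def)
  qed
  then have "1 / half_norm (pr g) < cos (ang g)"
    using angle_ang[OF g] half_norm_ge_1[OF pr_SL2[OF g]] by (simp add: angle_of_def field_simps)
  then have cos: "cos (spread (pr g)) < cos (ang g)"
    using spread_range(3)[OF pr_SL2[OF g]] by simp
  have "lo g < 0"
  proof (rule ccontr)
    assume "\<not> lo g < 0"
    then have "spread (pr g) \<le> ang g"
      by (simp add: lo_def)
    moreover have "ang g \<le> pi"
      using a pi_gt_zero by linarith
    ultimately have "cos (ang g) \<le> cos (spread (pr g))"
      using spread_range(1)[OF pr_SL2[OF g]] by (intro cos_monotone_0_pi_le)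
    then show False
      using cos by simp
  qed
  moreover have "lo (monodromy G pr (q - (- real n) *\<^sub>R w)) < lo g"
    unfolding g_def
  proof (rule lo_antimono)
    show "AE x in Leb. rep_L2 r x < rep_L2 (q - (- real n) *\<^sub>R w) x"
      using rep_r rep_L2_lincomb[of q "- real n" w] by eventually_elim (simp add: R_def min_def)
  qed
  ultimately show ?thesis
    by (meson less_trans)
qed

text \<open>One parameter with lo < 0 bounds both families from below: there hi < lo + pi < pi,
  which lies under 2 k pi once k is positive.\<close>

lemma line_meets_sheets:
  assumes w: "AE x in Leb. 0 < rep_L2 w x"
  shows "\<exists>!s. lo (monodromy G pr (q - s *\<^sub>R w)) = 2 * real k * pi"
    "1 \<le> k \<Longrightarrow> \<exists>!s. hi (monodromy G pr (q - s *\<^sub>R w)) = 2 * real k * pi"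
proof -
  let ?m = "\<lambda>s. monodromy G pr (q - s *\<^sub>R w)"
  obtain a b where a: "lo (?m a) < 0" and b: "2 * real k * pi \<le> lo (?m b)"
    using lo_negative[OF w] lo_unbounded_above[OF w] by blast
  have "0 \<le> 2 * real k * pi" by simp
  then show "\<exists>!s. lo (?m s) = 2 * real k * pi"
    using a b by (intro strict_mono_ex1[where a=a and b=b, OF continuous_line(1) lo_hi_strict_mono(1)[OF w]]) linarith+
  assume "1 \<le> k"
  then have "2 * 1 * pi \<le> 2 * real k * pi"
    by (intro mult_right_mono) auto
  moreover have "hi (?m a) < pi"
    using lo_hi(2)[OF monodromy_carrier, of "q - a *\<^sub>R w"] a by linarith
  ultimately show "\<exists>!s. hi (?m s) = 2 * real k * pi"
    using b lo_hi(1)[OF monodromy_carrier, of "q - b *\<^sub>R w"] pi_gt_zero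
    by (intro strict_mono_ex1[where a=a and b=b, OF continuous_line(2) lo_hi_strict_mono(2)[OF w]]) linarith+
qed

end

section \<open>Periodic eigenvalues and sheets\<close>

context SL2_cover
begin

text \<open>Both parities put index n at the level 2 \<lceil>n/2\<rceil> pi. Along an increasing
  family \<open>hi\<close> reaches a level no later than \<open>lo\<close>, so the odd index 2 k - 1
  belongs to \<open>hi\<close> and the even index 2 k to \<open>lo\<close>.\<close>

definition on_sheet :: "nat \<Rightarrow> 'g \<Rightarrow> bool" where
  "on_sheet n g \<longleftrightarrow> (if even n then lo g = real n * pi else hi g = real (n + 1) * pi)"

lemma on_sheet_even: "on_sheet (2 * k) g \<longleftrightarrow> lo g = 2 * real k * pi"
  by (simp add: on_sheet_def)

lemma on_sheet_odd: "1 \<le> k \<Longrightarrow> on_sheet (2 * k - 1) g \<longleftrightarrow> hi g = 2 * real k * pi"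
proof -
  assume "1 \<le> k"
  then have "odd (2 * k - 1)" "2 * k - 1 + 1 = 2 * k" by simp_all
  then show ?thesis
    unfolding on_sheet_def by (simp only: if_False) simp
qed

lemma index_cases:
  fixes n :: nat
  obtains k where "n = 2 * k" | k where "1 \<le> k" "n = 2 * k - 1"
proof (cases "even n")
  case True
  then show ?thesis using that(1) by (elim evenE)
next
  case False
  then obtain j where "n = 2 * j + 1" by (elim oddE)
  then show ?thesis using that(2)[of "j + 1"] by simp
qed

lemma ex1_on_sheet:
  assumes "AE x in Leb. 0 < rep_L2 w x"
  shows "\<exists>!s. on_sheet n (monodromy G pr (q - s *\<^sub>R w))"
proof (cases n rule: index_cases)
  case (1 k)
  then show ?thesis
    using line_meets_sheets(1)[OF assms] by (simp only: on_sheet_even)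
next
  case (2 k)
  then show ?thesis
    using line_meets_sheets(2)[OF assms 2(1)] by (simp only: on_sheet_odd[OF 2(1)])
qed

lemma on_sheet_level:
  assumes "g \<in> carrier G" "on_sheet n g"
  shows "g \<in> trace_level G pr 2 \<inter> cartan_strip G pr (2 * \<lceil>real n / 2\<rceil>)"
proof (cases n rule: index_cases)
  case (1 k)
  have "\<lceil>real n / 2\<rceil> = int k"
    unfolding 1 by simp
  then show ?thesis
    using lo_iff[OF assms(1), of "int k"] assms(2) by (simp add: 1 on_sheet_even)
next
  case (2 k)
  have "\<lceil>real n / 2\<rceil> = int k"
    using 2 by (simp add: ceiling_eq_iff of_nat_diff)
  then show ?thesis
    using hi_iff[OF assms(1), of "int k"] assms(2) on_sheet_odd[OF 2(1), of g] by (simp add: 2(2))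
qed

text \<open>The count is the dimension of the fixed space of \<open>pr g\<close>. As hi - lo < pi,
  the interval [lo, hi] holds at most one multiple of 2 pi, so at most two indices occur, and two
  exactly at an apex. Positivity of hi discards the negative levels and the apex at level 0, where
  hi has no index.\<close>

lemma card_on_sheet:
  assumes g: "g \<in> carrier G" and pos: "0 < hi g"
  shows "finite {n. on_sheet n g}"
    "card {n. on_sheet n g} = (if pr g = mat 1 then 2 else if trace (pr g) = 2 then 1 else 0)"
proof -
  have id: "pr g = mat 1 \<longleftrightarrow> lo g = hi g \<and> trace (pr g) = 2"
  proof
    assume *: "pr g = mat 1"
    then have "trace (pr g) = 2"
      by (simp add: trace_2 mat_1_mat2)
    then show "lo g = hi g \<and> trace (pr g) = 2"
      using identity_iff[OF pr_SL2[OF g] angle_ang[OF g]] * by (simp add: lo_def hi_def)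
  next
    assume *: "lo g = hi g \<and> trace (pr g) = 2"
    then have s: "spread (pr g) = 0"
      by (simp add: lo_def hi_def)
    then have "cos (ang g) = 1"
      using trace_eq_2_iff[OF pr_SL2[OF g] angle_ang[OF g]] * by simp
    then show "pr g = mat 1"
      using identity_iff[OF pr_SL2[OF g] angle_ang[OF g]] s by simp
  qed
  \<comment> \<open>Levels taken by lo and hi of one element differ by less than pi, hence
    coincide.\<close>
  have near: "j = k" if "\<bar>2 * of_int j * pi - 2 * of_int k * pi\<bar> < pi" for j k :: int
  proof -
    have "2 * of_int j * pi - 2 * of_int k * pi = 2 * real_of_int (j - k) * pi"
      by (simp add: algebra_simps)
    then have "\<bar>2 * real_of_int (j - k)\<bar> * \<bar>pi\<bar> < 1 * \<bar>pi\<bar>"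
      using that by (simp only: abs_mult)
    then have "\<bar>2 * real_of_int (j - k)\<bar> < 1"
      by (rule mult_right_less_imp_less) simp
    then have "real_of_int \<bar>2 * (j - k)\<bar> < real_of_int 1"
      by simp
    then have "\<bar>2 * (j - k)\<bar> < 1"
      by (simp only: of_int_less_iff)
    then show ?thesis by presburger
  qed
  note lh = lo_hi(1,2)[OF g]
  have "finite {n. on_sheet n g} \<and> card {n. on_sheet n g} = (if pr g = mat 1 then 2 else if trace (pr g) = 2 then 1 else 0)"
  proof (cases "trace (pr g) = 2")
    case False
    have "\<not> on_sheet n g" for n
      using on_sheet_level[OF g, of n] False by (auto simp: trace_level_def)
    then have "{n. on_sheet n g} = {}" by blast
    moreover have "pr g \<noteq> mat 1"
      using id False by blast
    ultimately show ?thesis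
      using False by simp
  next
    case True
    then obtain k :: int where k: "lo g = 2 * of_int k * pi \<or> hi g = 2 * of_int k * pi"
      using trace_2_imp_lo_hi[OF g] by blast
    have ev: "j = k" if "on_sheet (2 * m) g" "int m = j" "lo g = 2 * of_int k * pi \<or> hi g = 2 * of_int k * pi" for m j k
      using that lh by (intro near) (auto simp: on_sheet_even)
    have od: "j = k" if "1 \<le> m" "on_sheet (2 * m - 1) g" "int m = j" "lo g = 2 * of_int k * pi \<or> hi g = 2 * of_int k * pi" for m j k
      using that lh on_sheet_odd[OF that(1), of g] by (intro near) auto
    show ?thesis
    proof (cases "lo g = 2 * of_int k * pi")
      case lo: True
      \<comment> \<open>A negative level for lo would force hi below -pi.\<close>
      have "0 \<le> k"
      proof (rule ccontr)
        assume "\<not> 0 \<le> k"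
        then have "2 * of_int k * pi \<le> - (2::real) * pi"
          by (intro mult_right_mono) auto
        then show False
          using lo lh pos pi_gt_zero by linarith
      qed
      then obtain m where m: "k = int m"
        using nonneg_int_cases by blast
      show ?thesis
      proof (cases "lo g = hi g")
        case True
        \<comment> \<open>For m = 0 the index 2 m - 1 would be truncated to 0 and coincide with 2 m;
          hi > 0 rules this out.\<close>
        have "1 \<le> m"
          using pos lo True m by (cases m) auto
        have "{n. on_sheet n g} = {2 * m, 2 * m - 1}"
        proof (intro equalityI subsetI)
          fix n assume "n \<in> {n. on_sheet n g}"
          then have n: "on_sheet n g" by simp
          show "n \<in> {2 * m, 2 * m - 1}"
          proof (cases n rule: index_cases)
            case (1 j)
            then show ?thesis using ev[of j _ k] n k m by auto
          next
            case (2 j)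
            then show ?thesis using od[of j _ k] n k m by auto
          qed
        next
          fix n assume "n \<in> {2 * m, 2 * m - 1}"
          then show "n \<in> {n. on_sheet n g}"
            using lo True m on_sheet_even[of m g] on_sheet_odd[OF \<open>1 \<le> m\<close>, of g] by auto
        qed
        moreover have "2 * m \<noteq> 2 * m - 1"
          using \<open>1 \<le> m\<close> by simp
        ultimately show ?thesis
          using id True \<open>trace (pr g) = 2\<close> by simp
      next
        case False
        have "{n. on_sheet n g} = {2 * m}"
        proof (intro equalityI subsetI)
          fix n assume "n \<in> {n. on_sheet n g}"
          then have n: "on_sheet n g" by simp
          show "n \<in> {2 * m}"
          proof (cases n rule: index_cases)
            case (1 j)
            then show ?thesis using ev[of j _ k] n k m by auto
          next
            case (2 j)
            then have "int j = k" using od[of j _ k] n k by auto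
            then have "hi g = lo g"
              using n on_sheet_odd[OF 2(1), of g] lo unfolding 2(2) by auto
            then show ?thesis using False by simp
          qed
        next
          fix n assume "n \<in> {2 * m}"
          then show "n \<in> {n. on_sheet n g}"
            using lo m on_sheet_even[of m g] by auto
        qed
        then show ?thesis
          using id False True by simp
      qed
    next
      case nlo: False
      then have hi: "hi g = 2 * of_int k * pi"
        using k by blast
      have "1 \<le> k"
      proof (rule ccontr)
        assume "\<not> 1 \<le> k"
        then have "2 * of_int k * pi \<le> (2 * 0) * pi"
          by (intro mult_right_mono) auto
        then show False
          using hi pos by simp
      qed
      then obtain m where m: "k = int m" "1 \<le> m"
        using nonneg_int_cases[of k] by auto
      have "{n. on_sheet n g} = {2 * m - 1}"
      proof (intro equalityI subsetI)
        fix n assume "n \<in> {n. on_sheet n g}"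
        then have n: "on_sheet n g" by simp
        show "n \<in> {2 * m - 1}"
        proof (cases n rule: index_cases)
          case (1 j)
          then have "int j = k" using ev[of j _ k] n k by auto
          then show ?thesis
            using n nlo unfolding 1 on_sheet_even by auto
        next
          case (2 j)
          then show ?thesis using od[of j _ k] n k m by auto
        qed
      next
        fix n assume "n \<in> {2 * m - 1}"
        then show "n \<in> {n. on_sheet n g}"
          using hi m on_sheet_odd[OF m(2), of g] by auto
      qed
      then show ?thesis
        using id nlo hi True by simp
    qed
  qed
  then show "finite {n. on_sheet n g}"
    "card {n. on_sheet n g} = (if pr g = mat 1 then 2 else if trace (pr g) = 2 then 1 else 0)"
    by blast+
qed

lemma hi_pos_of_G0: "g \<in> G0 G pr \<Longrightarrow> 0 < hi g"
  using G0_iff[of g] dsp_bounds(2)[of g 0] G0_carrier by force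

lemma fund_shifted:
  obtains \<Phi> where "fund (\<lambda>t. rep_L2 q t - c) \<Phi>" "pr (monodromy G pr (q - c *\<^sub>R one_L2)) = \<Phi> (2*pi)"
proof -
  have ae: "AE t in Leb. rep_L2 (q - c *\<^sub>R one_L2) t = rep_L2 q t - c"
    using rep_L2_lincomb[of q c one_L2] rep_one_L2 by eventually_elim simp
  have int: "integrable Leb (\<lambda>t. rep_L2 q t - c)"
    using integrable_rep[of q] integrable_Leb_continuous[of "\<lambda>_. c"] by simp
  obtain \<Phi> where \<Phi>: "fund (rep_L2 (q - c *\<^sub>R one_L2)) \<Phi>"
    using fund_exists[OF integrable_rep] by blast
  have "fund (\<lambda>t. rep_L2 q t - c) \<Phi>"
    by (rule fund_cong_AE[OF \<Phi> ae int])
  then show ?thesis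
    using that pr_monodromy[OF \<Phi>] by blast
qed

definition eigenvalue :: "L2 \<Rightarrow> nat \<Rightarrow> real" where
  "eigenvalue q n = (THE c. on_sheet n (monodromy G pr (q - c *\<^sub>R one_L2)))"

lemma eigenvalue_iff: "eigenvalue q n = c \<longleftrightarrow> on_sheet n (monodromy G pr (q - c *\<^sub>R one_L2))"
  using ex1_on_sheet[OF rep_one_L2_pos, of n q] unfolding eigenvalue_def
  by (metis (no_types, lifting) theI')

text \<open>From 2 k - 1 to 2 k the level is the same and lo \<le> hi gives the order; from 2 k to 2
  k + 1 the level rises by 2 pi, more than hi can exceed lo.\<close>

lemma mono_eigenvalue: "mono (eigenvalue q)"
proof (rule mono_iff_le_Suc[THEN iffD2], rule allI)
  fix n
  define c c' where "c = eigenvalue q n" and "c' = eigenvalue q (Suc n)"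
  let ?m = "\<lambda>c. monodromy G pr (q - c *\<^sub>R one_L2)"
  have s: "on_sheet n (?m c)" "on_sheet (Suc n) (?m c')"
    using eigenvalue_iff[of q n c] eigenvalue_iff[of q "Suc n" c'] by (simp_all add: c_def c'_def)
  note mono = lo_hi_strict_mono[OF rep_one_L2_pos, of q]
  note lh = lo_hi(1,2)[OF monodromy_carrier[of "q - c *\<^sub>R one_L2"]]
  have "\<not> c' < c"
  proof
    assume less: "c' < c"
    have 1: "lo (?m c') < lo (?m c)" "hi (?m c') < hi (?m c)"
      using strict_monoD[OF mono(1) less] strict_monoD[OF mono(2) less] .
    show False
    proof (cases n rule: index_cases)
      case (1 k)
      have "Suc n = 2 * (k + 1) - 1" by (simp add: 1)
      then have "hi (?m c') = 2 * real (k + 1) * pi" "lo (?m c) = 2 * real k * pi"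
        using s on_sheet_odd[of "k + 1" "?m c'"] on_sheet_even[of k "?m c"] unfolding 1 by auto
      moreover have "2 * real (k + 1) * pi = 2 * real k * pi + 2 * pi"
        by (simp add: algebra_simps)
      ultimately show ?thesis
        using \<open>hi (?m c') < hi (?m c)\<close> lh pi_gt_zero by linarith
    next
      case (2 k)
      have "Suc n = 2 * k" using 2 by simp
      then have "lo (?m c') = 2 * real k * pi" "hi (?m c) = 2 * real k * pi"
        using s on_sheet_odd[OF 2(1), of "?m c"] on_sheet_even[of k "?m c'"] unfolding 2(2) by auto
      then show ?thesis
        using \<open>lo (?m c') < lo (?m c)\<close> lh by linarith
    qed
  qed
  then show "eigenvalue q n \<le> eigenvalue q (Suc n)"
    by (simp add: c_def c'_def)
qed

text \<open>Every shift q - c stays in \<open>Hp_circle p\<close>, so the hypothesis on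
  \<open>G0\<close> gives hi > 0 for all c and the counts of \<open>card_on_sheet\<close> and
  \<open>eigenspace_dim\<close> agree.\<close>

lemma nth_eigenvalue_eq:
  assumes q: "q \<in> Hp_circle p" and G0: "\<And>q. q \<in> Hp_circle p \<Longrightarrow> monodromy G pr q \<in> G0 G pr"
  shows "nth_eigenvalue p q = eigenvalue q"
  unfolding nth_eigenvalue_def
proof (rule the_equality)
  have *: "finite {n. eigenvalue q n = c} \<and> card {n. eigenvalue q n = c} = dim (eigenspace p q c)" for c
  proof -
    let ?g = "monodromy G pr (q - c *\<^sub>R one_L2)"
    have "0 < hi ?g"
      using G0[OF Hp_circle_lincomb[OF q one_L2_Hp]] by (rule hi_pos_of_G0)
    note cs = card_on_sheet[OF monodromy_carrier this]
    obtain \<Phi> where \<Phi>: "fund (\<lambda>t. rep_L2 q t - c) \<Phi>" "pr ?g = \<Phi> (2*pi)"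
      using fund_shifted by blast
    show ?thesis
      unfolding eigenvalue_iff eigenspace_dim(1)[OF q \<Phi>(1)] \<Phi>(2)[symmetric] using cs by blast
  qed
  then show lists: "lists_eigenvalues p q (eigenvalue q)"
    unfolding lists_eigenvalues_def using mono_eigenvalue by blast
  fix ev assume "lists_eigenvalues p q ev"
  then show "ev = eigenvalue q"
    unfolding lists_eigenvalues_def using * mono_eigenvalue
    by (intro mono_enumeration_unique) auto
qed

text \<open>0 is the n-th eigenvalue exactly when the unshifted potential is on sheet n, and on the
  line this happens for a single s.\<close>

lemma s_number_on_sheet:
  assumes q: "q \<in> Hp_circle p" and w: "w \<in> Hp_circle p" "AE x in Leb. 0 < rep_L2 w x"
    and G0: "\<And>q. q \<in> Hp_circle p \<Longrightarrow> monodromy G pr q \<in> G0 G pr"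
  shows "on_sheet n (monodromy G pr (q - s_number p q w n *\<^sub>R w))"
proof -
  have "nth_eigenvalue p (q - s *\<^sub>R w) n = 0 \<longleftrightarrow> on_sheet n (monodromy G pr (q - s *\<^sub>R w))" for s
    using nth_eigenvalue_eq[OF Hp_circle_lincomb[OF q w(1)] G0] eigenvalue_iff[of "q - s *\<^sub>R w" n 0] by simp
  then have "s_number p q w n = (THE s. on_sheet n (monodromy G pr (q - s *\<^sub>R w)))"
    by (simp add: s_number_def)
  then show ?thesis
    using theI'[OF ex1_on_sheet[OF w(2)]] by simp
qed

lemma C1_of_trace:
  assumes q: "q \<in> Hp_circle p" and tr: "trace (pr (monodromy G pr q)) = 2"
  shows "q \<in> C1 p"
proof -
  obtain \<Phi> where \<Phi>: "fund (\<lambda>t. rep_L2 q t - 0) \<Phi>" "pr (monodromy G pr (q - 0 *\<^sub>R one_L2)) = \<Phi> (2*pi)"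
    using fund_shifted by blast
  then have "trace (\<Phi> (2*pi)) = 2"
    using tr by simp
  then obtain v where "v \<in> eigenspace p q 0" "v \<noteq> 0"
    using eigenspace_dim(2)[OF q \<Phi>(1)] by blast
  then show ?thesis
    using q by (auto simp: C1_def eigenspace_def)
qed

text \<open>The trace level in the strip around the unit is also a double cone; its half with hi = 0
  is cut off because hi > 0 on \<open>G0\<close>.\<close>

lemma T20_G0: "T20 G pr \<inter> G0 G pr = {g \<in> G0 G pr. lo g = 0}"
proof (intro equalityI subsetI)
  fix g assume g: "g \<in> T20 G pr \<inter> G0 G pr"
  then have "lo g = 0 \<or> hi g = 0"
    using T20_subset sheet_cases[of g 0] by auto
  then show "g \<in> {g \<in> G0 G pr. lo g = 0}"
    using g hi_pos_of_G0[of g] by auto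
next
  fix g assume "g \<in> {g \<in> G0 G pr. lo g = 0}"
  then show "g \<in> T20 G pr \<inter> G0 G pr"
    using T20_lo G0_carrier by blast
qed

lemma sheet_in_G0:
  assumes "g \<in> carrier G" "1 \<le> k" "lo g = 2 * real k * pi \<or> hi g = 2 * real k * pi"
  shows "g \<in> G0 G pr"
proof -
  have "2 * 1 * pi \<le> 2 * real k * pi"
    using assms(2) by (intro mult_right_mono) auto
  then have "0 < lo g"
    using assms(3) lo_hi(1,2)[OF assms(1)] pi_gt_zero by linarith
  then show ?thesis
    using G0_iff[OF assms(1)] dsp_bounds(1)[OF assms(1), of 0] by linarith
qed

lemma level_trace:
  assumes "g \<in> carrier G" "lo g = 2 * real k * pi \<or> hi g = 2 * real k * pi"
  shows "trace (pr g) = 2"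
  using lo_iff[OF assms(1), of "int k"] hi_iff[OF assms(1), of "int k"] assms(2)
  by (auto simp: trace_level_def)

end

section \<open>From the sheets back to the potentials\<close>

theorem theorem5:
  fixes p :: nat
    and q0 qp :: L2
    and G :: "('g::real_normed_vector, 'm) monoid_scheme"
    and pr :: "'g \<Rightarrow> real^2^2"
    and \<Psi> :: "'g \<times> 'h::{real_inner, polish_space} \<Rightarrow> L2"
  assumes cover: "universal_cover_SL2 G pr"
    and infinite_dimensional: "\<nexists>B::'h set. finite B \<and> span B = UNIV"
    and q0: "q0 \<in> Hp_circle p"
    and qp: "qp \<in> Hp_circle p"
    and qp_pos: "AE x in Leb. rep_L2 qp x > 0"
    and diffeo: "diffeo_G0_Hp p G pr \<Psi>"
    and proj: "\<forall>g\<in>G0 G pr. \<forall>h. monodromy G pr (\<Psi> (g, h)) = g"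
  shows "(hyperplane G pr \<Psi> \<subseteq> C1 p \<and> (\<exists>!q. q \<in> line q0 qp \<inter> hyperplane G pr \<Psi>)) \<and>
    (\<forall>k\<ge>1. \<forall>S\<in>cone_sheets G pr \<Psi> k. S \<subseteq> C1 p \<and> (\<exists>!q. q \<in> line q0 qp \<inter> S)) \<and>
    (\<forall>n::nat. q0 - s_number p q0 qp n *\<^sub>R qp \<in>
       (if n = 0 then \<Psi> ` ((T20 G pr \<inter> G0 G pr) \<times> UNIV)
        else \<Psi> ` ((trace_level G pr 2 \<inter> cartan_strip G pr (2 * \<lceil>real n / 2\<rceil>)) \<times> UNIV)))"
proof -
  interpret SL2_cover G pr
    by unfold_locales (rule cover)
  let ?\<mu> = "monodromy G pr"
  have bij: "bij_betw (\<lambda>(x, h). \<Psi> (phiL G pr x, h)) (G0_dom \<times> UNIV) (Hp_circle p)"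
    using diffeo by (simp add: diffeo_G0_Hp_def diffeomorphism_between_def)
  have into: "\<Psi> (g, h) \<in> Hp_circle p" if "g \<in> G0 G pr" for g h
    using that bij_betw_apply[OF bij] unfolding G0_def by force
  \<comment> \<open>Surjectivity of \<Psi> places the monodromy of every potential in
    \<open>G0\<close>, the source of hi > 0.\<close>
  have onto: "?\<mu> q \<in> G0 G pr \<and> (\<exists>h. q = \<Psi> (?\<mu> q, h))" if q: "q \<in> Hp_circle p" for q
  proof -
    have "q \<in> (\<lambda>(x, h). \<Psi> (phiL G pr x, h)) ` (G0_dom \<times> UNIV)"
      using q bij by (simp add: bij_betw_def)
    then obtain x h where x: "x \<in> G0_dom" "q = \<Psi> (phiL G pr x, h)"
      by auto
    then have "phiL G pr x \<in> G0 G pr"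
      by (simp add: G0_def)
    then show ?thesis
      using proj x(2) by auto
  qed
  \<comment> \<open>The first coordinate of a potential under \<Psi> is its monodromy, so images of
    product sets become conditions on the monodromy.\<close>
  have image: "\<Psi> ` (A \<times> UNIV) = {q \<in> Hp_circle p. ?\<mu> q \<in> A}" if A: "A \<subseteq> G0 G pr" for A
  proof (intro equalityI subsetI)
    fix q assume "q \<in> \<Psi> ` (A \<times> UNIV)"
    then obtain g h where "g \<in> A" "q = \<Psi> (g, h)" by auto
    then show "q \<in> {q \<in> Hp_circle p. ?\<mu> q \<in> A}"
      using A into proj by auto
  next
    fix q assume "q \<in> {q \<in> Hp_circle p. ?\<mu> q \<in> A}"
    then show "q \<in> \<Psi> ` (A \<times> UNIV)"
      using onto[of q] by (metis (no_types, lifting) UNIV_I image_eqI mem_Collect_eq mem_Sigma_iff)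
  qed
  have in_line: "q0 - s *\<^sub>R qp \<in> Hp_circle p" for s
    using q0 qp by (rule Hp_circle_lincomb)
  have unique: "\<exists>!q. q \<in> line q0 qp \<inter> {q \<in> Hp_circle p. ?\<mu> q \<in> A}"
    if ex1: "\<exists>!s. ?\<mu> (q0 - s *\<^sub>R qp) \<in> A" for A
  proof -
    from ex1 obtain s where s: "?\<mu> (q0 - s *\<^sub>R qp) \<in> A" "\<And>t. ?\<mu> (q0 - t *\<^sub>R qp) \<in> A \<Longrightarrow> t = s"
      by blast
    show ?thesis
    proof (rule ex1I[of _ "q0 - s *\<^sub>R qp"])
      show "q0 - s *\<^sub>R qp \<in> line q0 qp \<inter> {q \<in> Hp_circle p. ?\<mu> q \<in> A}"
        using s(1) in_line by (auto simp: line_def)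
      fix q assume "q \<in> line q0 qp \<inter> {q \<in> Hp_circle p. ?\<mu> q \<in> A}"
      then obtain t where "q = q0 - t *\<^sub>R qp" "?\<mu> (q0 - t *\<^sub>R qp) \<in> A"
        by (auto simp: line_def)
      then show "q = q0 - s *\<^sub>R qp"
        using s(2) by blast
    qed
  qed
  have G0_line: "?\<mu> (q0 - s *\<^sub>R qp) \<in> G0 G pr" for s
    using onto in_line by blast
  have hyp: "hyperplane G pr \<Psi> = {q \<in> Hp_circle p. ?\<mu> q \<in> {g \<in> G0 G pr. lo g = 0}}"
    unfolding hyperplane_def T20_G0 by (rule image) blast
  have part1: "hyperplane G pr \<Psi> \<subseteq> C1 p"
  proof
    fix q assume "q \<in> hyperplane G pr \<Psi>"
    then have "q \<in> Hp_circle p" "lo (?\<mu> q) = 2 * real 0 * pi"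
      by (auto simp: hyp)
    then show "q \<in> C1 p"
      using C1_of_trace level_trace[OF monodromy_carrier] by blast
  qed
  have part2: "\<exists>!q. q \<in> line q0 qp \<inter> hyperplane G pr \<Psi>"
    unfolding hyp
  proof (rule unique)
    show "\<exists>!s. ?\<mu> (q0 - s *\<^sub>R qp) \<in> {g \<in> G0 G pr. lo g = 0}"
      using line_meets_sheets(1)[OF qp_pos, of q0 0] G0_line by simp
  qed
  have part3: "S \<subseteq> C1 p \<and> (\<exists>!q. q \<in> line q0 qp \<inter> S)" if k: "1 \<le> k" and S: "S \<in> cone_sheets G pr \<Psi> k" for k S
  proof -
    obtain l where l: "l \<in> cone_leaves G pr k" "S = \<Psi> ` ((l \<union> {iota G pr [^]\<^bsub>G\<^esub> (2 * k)}) \<times> UNIV)"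
      using S by (auto simp: cone_sheets_def)
    define L where "L = l \<union> {iota G pr [^]\<^bsub>G\<^esub> (2 * k)}"
    have L: "L = {g \<in> carrier G. lo g = 2 * real k * pi} \<or> L = {g \<in> carrier G. hi g = 2 * real k * pi}"
      unfolding L_def by (rule cone_leaf_sheet[OF l(1)])
    then have Lg: "g \<in> carrier G \<and> (lo g = 2 * real k * pi \<or> hi g = 2 * real k * pi)" if "g \<in> L" for g
      using that by auto
    have S': "S = {q \<in> Hp_circle p. ?\<mu> q \<in> L}"
      unfolding l(2) L_def[symmetric]
    proof (rule image)
      show "L \<subseteq> G0 G pr"
        using Lg sheet_in_G0 k by blast
    qed
    have "S \<subseteq> C1 p"
      unfolding S' using C1_of_trace level_trace Lg by blast
    moreover have "\<exists>!q. q \<in> line q0 qp \<inter> S"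
      unfolding S'
    proof (rule unique)
      show "\<exists>!s. ?\<mu> (q0 - s *\<^sub>R qp) \<in> L"
        using L line_meets_sheets(1)[OF qp_pos, of q0 k] line_meets_sheets(2)[OF qp_pos k, of q0]
        by (elim disjE) (simp_all add: monodromy_carrier)
    qed
    ultimately show ?thesis ..
  qed
  have part4: "q0 - s_number p q0 qp n *\<^sub>R qp \<in>
       (if n = 0 then \<Psi> ` ((T20 G pr \<inter> G0 G pr) \<times> UNIV)
        else \<Psi> ` ((trace_level G pr 2 \<inter> cartan_strip G pr (2 * \<lceil>real n / 2\<rceil>)) \<times> UNIV))" for n
  proof -
    let ?q = "q0 - s_number p q0 qp n *\<^sub>R qp"
    have on: "on_sheet n (?\<mu> ?q)"
      using onto by (intro s_number_on_sheet[OF q0 qp qp_pos]) blast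
    obtain h where h: "?q = \<Psi> (?\<mu> ?q, h)"
      using onto[OF in_line] by blast
    \<comment> \<open>The target for n > 0 is not given as a subset of \<open>G0\<close>, so instead
      of \<open>image\<close> the second coordinate \<open>h\<close> of this particular potential is
      used.\<close>
    have mem: "?q \<in> \<Psi> ` (A \<times> UNIV)" if "?\<mu> ?q \<in> A" for A
      using that h by (metis (no_types, lifting) UNIV_I image_eqI mem_Sigma_iff)
    show ?thesis
    proof (cases "n = 0")
      case True
      have "lo (?\<mu> ?q) = 0"
        using on on_sheet_even[of 0 "?\<mu> ?q"] True by simp
      then have "?\<mu> ?q \<in> T20 G pr \<inter> G0 G pr"
        unfolding T20_G0 using G0_line by blast
      then show ?thesis
        using mem True by simp
    next
      case False
      then show ?thesis
        using mem[OF on_sheet_level[OF monodromy_carrier on]] by simp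
    qed
  qed
  show ?thesis
    using part1 part2 part3 part4 by blast
qed

end
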